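(* Let $k$ be a field, let $A$ be a (standard graded, not necessarily commutative) Koszul $k$-algebra with homogeneous maximal ideal $\mathfrak m=A_{>0}$, and let $a\ge 1$. (1) The nonzero graded Betti numbers of $\mathfrak m^a$ are given by $$\beta^A_{n,n+a}(\mathfrak m^a)=\sum_{i=1}^a(-1)^{i+1}\dim_k\big((A^!)^*_{n+i}\big)\dim_k(A_{a-i})\qquad(n\ge 0).$$ In particular, the minimal graded free resolution of $\mathfrak m^a$ over $A$ is $a$-linear. (2) The graded Poincaré series of $\mathfrak m^a$ is $$P^A_{\mathfrak m^a}(y,z)=-(-z)^{-a}\,H_{(A^!)^*}(yz)\,H_{A/\mathfrak m^a}(-yz).$$ (3) Consequently, the nonzero graded Betti numbers of $A/\mathfrak m^a$ are given by $$\beta^A_{n,j}(A/\mathfrak m^a)=\begin{cases}\displaystyle\sum_{i=1}^{a}(-1)^{i+1}\dim_k\big((A^!)^*_{n+i-1}\big)\dim_k(A_{a-i}) & n>0,\ j=n+a-1,\\ 1 & n=j=0.\end{cases}$$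
   Context: Algebras. $A=\bigoplus_{i\ge 0}A_i$ is a graded $k$-algebra with $A_0=k$, all $A_i$ finite-dimensional over $k$, and $A$ generated by $A_1$ as a $k$-algebra (standard graded). $A$ is Koszul if $k=A/A_{>0}$ has a graded free resolution $P_\bullet$ over $A$ with $P_i$ generated in degree $i$ for all $i$. A Koszul algebra is quadratic: $A=T(V)/Q$, where $V=A_1$, $T(V)$ is the tensor algebra and $Q$ is the two-sided ideal generated by $Q_2\subseteq V\otimes_k V$. Quadratic dual. $A^!=T(V^* )/Q^\perp$, where $V^*=\operatorname{Hom}_k(V,k)$ and $Q^\perp$ is the two-sided ideal generated by the orthogonal complement of $Q_2$ in $V^*\otimes_k V^*$ under the pairing $\langle v_1\otimes v_2,v_1^*\otimes v_2^*\rangle=\langle v_1,v_1^*\rangle\langle v_2,v_2^*\rangle$. For $n\ge 0$, $(A^!)^*_n$ denotes the $k$-linear dual of the component of $A^!$ spanned by products of $n$ elements of $V^*$ (so $(A^!)^*_0=k$). Modules are left $A$-modules. Graded Betti numbers: $\beta^A_{i,j}(M)=\dim_k\operatorname{Tor}^A_i(M,k)_j$, i.e. the number of degree-$j$ generators of the $i$-th module in a minimal graded free resolution of $M$ over $A$. The graded Poincaré series is $P^A_M(y,z)=\sum_{i,j\ge0}\beta^A_{i,j}(M)\,y^jz^i$. A resolution is $a$-linear if its $n$-th free module is generated in degree $n+a$ for all $n\geq 0$. Hilbert series: $H_{(A^!)^*}(t)=\sum_{\ell\ge0}\dim_k (A^!)^*_\ell\, t^\ell$ and $H_{A/\mathfrak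 m^a}(t)=\sum_{j=0}^{a-1}\dim_k A_j\,t^j$.
   Formalization: In (2) the printed formula has a spurious term -(-z)^{-a} (e.g. for a=1 it gives z^{-1}H(yz) instead of z^{-1}(H(yz)-1)); the formal version proves P = -(-z)^{-a}(H_{(A^!)^*}(yz) H_{A/m^a}(-yz) - 1). *)

theory Defs
  imports
    "HOL-Computational_Algebra.Formal_Laurent_Series"
    "HOL-Library.Poly_Mapping"
    "HOL-Library.Function_Algebras"
    "HOL-Library.Set_Algebras"
begin

section \<open>Standard graded algebras\<close>

text \<open>
  The algebra is the whole type \<open>'a\<close> with \<open>k\<close>-scaling \<open>scale\<close>; \<open>A i\<close> is its homogeneous
  component of degree \<open>i\<close>. It need not be commutative.
\<close>

locale standard_graded_algebra = vector_space scale
  for scale :: "'k::field \<Rightarrow> 'a::ring_1 \<Rightarrow> 'a" +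
  fixes A :: "nat \<Rightarrow> 'a set"
  assumes scale_mult_left: "scale c x * y = scale c (x * y)"
    and scale_mult_right: "x * scale c y = scale c (x * y)"
    and component_subspace: "subspace (A i)"
    and direct_sum: "\<exists>!f. (\<forall>i. f i \<in> A i) \<and> finite {i. f i \<noteq> 0} \<and> x = (\<Sum>i | f i \<noteq> 0. f i)"
    and component_mult: "x \<in> A i \<Longrightarrow> y \<in> A j \<Longrightarrow> x * y \<in> A (i + j)"
    and component_zero: "A 0 = range (\<lambda>c. scale c 1)"
    and component_finite_dim: "\<exists>B. finite B \<and> A i \<subseteq> span B"
    and generated_in_degree_one: "span {prod_list xs | xs. set xs \<subseteq> A 1} = UNIV"

definition irrelevant_ideal :: "('k::field \<Rightarrow> 'a::ring_1 \<Rightarrow> 'a) \<Rightarrow> (nat \<Rightarrow> 'a set) \<Rightarrow> 'a set" where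
  "irrelevant_ideal scale A = module.span scale (\<Union>i\<in>{1..}. A i)"


section \<open>Graded left modules\<close>

record ('a, 'm) graded_module =
  carr :: "'m set"
  zero_of :: 'm
  add_of :: "'m \<Rightarrow> 'm \<Rightarrow> 'm"
  act :: "'a \<Rightarrow> 'm \<Rightarrow> 'm"
  comp_of :: "nat \<Rightarrow> 'm set"

definition left_ideal_module ::
    "(nat \<Rightarrow> 'a::ring_1 set) \<Rightarrow> 'a set \<Rightarrow> ('a, 'a) graded_module" where
  "left_ideal_module A I =
     \<lparr>carr = I, zero_of = 0, add_of = (+), act = (*), comp_of = (\<lambda>j. I \<inter> A j)\<rparr>"

text \<open>
  The quotient \<open>A/I\<close>, whose elements are the cosets \<open>x +o I\<close>; sums of cosets are sums of sets,
  and \<open>r\<close> acts by \<open>r (x + I) = r x + I\<close>.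
\<close>

definition quotient_module ::
    "(nat \<Rightarrow> 'a::ring_1 set) \<Rightarrow> 'a set \<Rightarrow> ('a, 'a set) graded_module" where
  "quotient_module A I =
     \<lparr>carr = range (\<lambda>x. x +o I), zero_of = I, add_of = (+),
      act = (\<lambda>r C. (*) r ` C + I), comp_of = (\<lambda>j. (\<lambda>x. x +o I) ` A j)\<rparr>"

inductive_set submodule_generated ::
    "('a, 'm) graded_module \<Rightarrow> 'm set \<Rightarrow> 'm set"
  for M :: "('a, 'm) graded_module" and S :: "'m set" where
  gen_zero: "zero_of M \<in> submodule_generated M S"
| gen_incl: "s \<in> S \<Longrightarrow> s \<in> submodule_generated M S"
| gen_add: "x \<in> submodule_generated M S \<Longrightarrow> y \<in> submodule_generated M S \<Longrightarrow>
    add_of M x y \<in> submodule_generated M S"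
| gen_act: "x \<in> submodule_generated M S \<Longrightarrow> act M r x \<in> submodule_generated M S"

definition generated_in_degree :: "('a, 'm) graded_module \<Rightarrow> nat \<Rightarrow> bool" where
  "generated_in_degree M d \<longleftrightarrow> submodule_generated M (comp_of M d) = carr M"

definition ideal_times :: "'a set \<Rightarrow> ('a, 'm) graded_module \<Rightarrow> 'm set" where
  "ideal_times I M = submodule_generated M {act M r x | r x. r \<in> I \<and> x \<in> carr M}"

primrec ideal_power :: "(nat \<Rightarrow> 'a::ring_1 set) \<Rightarrow> 'a set \<Rightarrow> nat \<Rightarrow> 'a set" where
  "ideal_power A I 0 = UNIV"
| "ideal_power A I (Suc n) = ideal_times I (left_ideal_module A (ideal_power A I n))"

abbreviation max_ideal_power_module ::
    "('k::field \<Rightarrow> 'a::ring_1 \<Rightarrow> 'a) \<Rightarrow> (nat \<Rightarrow> 'a set) \<Rightarrow> nat \<Rightarrow> ('a, 'a) graded_module" where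
  "max_ideal_power_module scale A a \<equiv>
     left_ideal_module A (ideal_power A (irrelevant_ideal scale A) a)"

abbreviation max_ideal_power_quotient ::
    "('k::field \<Rightarrow> 'a::ring_1 \<Rightarrow> 'a) \<Rightarrow> (nat \<Rightarrow> 'a set) \<Rightarrow> nat \<Rightarrow> ('a, 'a set) graded_module" where
  "max_ideal_power_quotient scale A a \<equiv>
     quotient_module A (ideal_power A (irrelevant_ideal scale A) a)"

definition graded_hom ::
    "('a, 'm) graded_module \<Rightarrow> ('a, 'n) graded_module \<Rightarrow> ('m \<Rightarrow> 'n) \<Rightarrow> bool" where
  "graded_hom M N h \<longleftrightarrow>
     (\<forall>x\<in>carr M. h x \<in> carr N) \<and>
     (\<forall>x\<in>carr M. \<forall>y\<in>carr M. h (add_of M x y) = add_of N (h x) (h y)) \<and>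
     (\<forall>r. \<forall>x\<in>carr M. h (act M r x) = act N r (h x)) \<and>
     (\<forall>j. \<forall>x\<in>comp_of M j. h x \<in> comp_of N j)"


section \<open>Graded free resolutions\<close>

text \<open>
  The graded free module with homogeneous basis \<open>B\<close>, the basis element \<open>b\<close> having degree
  \<open>deg b\<close>, consists of the finitely supported families of coefficients indexed by \<open>B\<close>. Bases
  are indexed by natural numbers. This is no restriction for locally finite modules over a
  locally finite algebra, which have resolutions with finitely many basis elements in each
  degree, nor in the definition of Koszulness below, since a resolution of \<open>k\<close> whose \<open>i\<close>-th
  module is generated in degree \<open>i\<close> is minimal and therefore has finite ranks.
\<close>

definition free_scale :: "'a::ring_1 \<Rightarrow> (nat \<Rightarrow>\<^sub>0 'a) \<Rightarrow> (nat \<Rightarrow>\<^sub>0 'a)" where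
  "free_scale r f = Poly_Mapping.map ((*) r) f"

definition free_module ::
    "(nat \<Rightarrow> 'a::ring_1 set) \<Rightarrow> nat set \<Rightarrow> (nat \<Rightarrow> nat) \<Rightarrow> ('a, nat \<Rightarrow>\<^sub>0 'a) graded_module" where
  "free_module A B deg =
     \<lparr>carr = {f. Poly_Mapping.keys f \<subseteq> B}, zero_of = 0, add_of = (+), act = free_scale,
      comp_of = (\<lambda>j. {f. Poly_Mapping.keys f \<subseteq> B \<and>
        (\<forall>b\<in>Poly_Mapping.keys f. \<exists>i. deg b + i = j \<and> Poly_Mapping.lookup f b \<in> A i)})\<rparr>"

text \<open>\<open>diff F n\<close> is the differential from the \<open>(n+1)\<close>-st to the \<open>n\<close>-th free module.\<close>

record (overloaded) ('a, 'm) resolution =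
  basis :: "nat \<Rightarrow> nat set"
  bdeg :: "nat \<Rightarrow> nat \<Rightarrow> nat"
  diff :: "nat \<Rightarrow> (nat \<Rightarrow>\<^sub>0 'a) \<Rightarrow> (nat \<Rightarrow>\<^sub>0 'a)"
  aug :: "(nat \<Rightarrow>\<^sub>0 'a) \<Rightarrow> 'm"

definition res_module ::
    "(nat \<Rightarrow> 'a::ring_1 set) \<Rightarrow> ('a, 'm) resolution \<Rightarrow> nat \<Rightarrow> ('a, nat \<Rightarrow>\<^sub>0 'a) graded_module" where
  "res_module A F n = free_module A (basis F n) (bdeg F n)"

definition graded_free_resolution ::
    "(nat \<Rightarrow> 'a::ring_1 set) \<Rightarrow> ('a, 'm) graded_module \<Rightarrow> ('a, 'm) resolution \<Rightarrow> bool" where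
  "graded_free_resolution A M F \<longleftrightarrow>
     graded_hom (res_module A F 0) M (aug F) \<and>
     (\<forall>n. graded_hom (res_module A F (Suc n)) (res_module A F n) (diff F n)) \<and>
     aug F ` carr (res_module A F 0) = carr M \<and>
     {x \<in> carr (res_module A F 0). aug F x = zero_of M} = diff F 0 ` carr (res_module A F 1) \<and>
     (\<forall>n. {x \<in> carr (res_module A F (Suc n)). diff F n x = 0}
        = diff F (Suc n) ` carr (res_module A F (Suc (Suc n))))"

definition minimal_graded_free_resolution ::
    "('k::field \<Rightarrow> 'a::ring_1 \<Rightarrow> 'a) \<Rightarrow> (nat \<Rightarrow> 'a set) \<Rightarrow> ('a, 'm) graded_module \<Rightarrow>
     ('a, 'm) resolution \<Rightarrow> bool" where
  "minimal_graded_free_resolution scale A M F \<longleftrightarrow>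
     graded_free_resolution A M F \<and>
     (\<forall>n. diff F n ` carr (res_module A F (Suc n))
        \<subseteq> ideal_times (irrelevant_ideal scale A) (res_module A F n))"

definition linear_resolution ::
    "(nat \<Rightarrow> 'a::ring_1 set) \<Rightarrow> nat \<Rightarrow> ('a, 'm) resolution \<Rightarrow> bool" where
  "linear_resolution A a F \<longleftrightarrow> (\<forall>n. generated_in_degree (res_module A F n) (n + a))"

definition koszul :: "('k::field \<Rightarrow> 'a::ring_1 \<Rightarrow> 'a) \<Rightarrow> (nat \<Rightarrow> 'a set) \<Rightarrow> bool" where
  "koszul scale A \<longleftrightarrow>
     (\<exists>F. graded_free_resolution A (quotient_module A (irrelevant_ideal scale A)) F \<and>
          linear_resolution A 0 F)"


section \<open>Graded Betti numbers\<close>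

text \<open>\<open>dim (Z/W)\<close> for subspaces \<open>W \<subseteq> Z\<close>, as the least number of generators of \<open>Z\<close> modulo \<open>W\<close>.\<close>

definition quotient_dim ::
    "('k::field \<Rightarrow> 'v::ab_group_add \<Rightarrow> 'v) \<Rightarrow> 'v set \<Rightarrow> 'v set \<Rightarrow> nat" where
  "quotient_dim s Z W =
     (LEAST n. \<exists>S\<subseteq>Z. finite S \<and> card S = n \<and> Z \<subseteq> module.span s (W \<union> S))"

text \<open>
  With \<open>\<mm>\<close> the irrelevant ideal, tensoring a complex \<open>F\<close> of free left modules with the right
  module \<open>k = A/\<mm>\<close> gives the complex \<open>F/\<mm>F\<close>. The following are the preimages in the degree \<open>j\<close>
  component of \<open>F\<^sub>i\<close> of its cycles and boundaries.
\<close>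

definition tor_cycles ::
    "('k::field \<Rightarrow> 'a::ring_1 \<Rightarrow> 'a) \<Rightarrow> (nat \<Rightarrow> 'a set) \<Rightarrow> ('a, 'm) resolution \<Rightarrow> nat \<Rightarrow> nat \<Rightarrow>
     (nat \<Rightarrow>\<^sub>0 'a) set" where
  "tor_cycles scale A F i j =
     {x \<in> comp_of (res_module A F i) j.
        \<forall>n. i = Suc n \<longrightarrow> diff F n x \<in> ideal_times (irrelevant_ideal scale A) (res_module A F n)}"

definition tor_boundaries ::
    "('k::field \<Rightarrow> 'a::ring_1 \<Rightarrow> 'a) \<Rightarrow> (nat \<Rightarrow> 'a set) \<Rightarrow> ('a, 'm) resolution \<Rightarrow> nat \<Rightarrow> nat \<Rightarrow>
     (nat \<Rightarrow>\<^sub>0 'a) set" where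
  "tor_boundaries scale A F i j =
     {diff F i y + w | y w. y \<in> comp_of (res_module A F (Suc i)) j \<and>
        w \<in> comp_of (res_module A F i) j \<inter>
            ideal_times (irrelevant_ideal scale A) (res_module A F i)}"

text \<open>
  \<open>dim Tor\<^sub>i(M, k)\<^sub>j\<close>, computed from an arbitrary graded free resolution of \<open>M\<close>; the value does
  not depend on the choice.
\<close>

definition betti ::
    "('k::field \<Rightarrow> 'a::ring_1 \<Rightarrow> 'a) \<Rightarrow> (nat \<Rightarrow> 'a set) \<Rightarrow> ('a, 'm) graded_module \<Rightarrow> nat \<Rightarrow> nat \<Rightarrow> nat" where
  "betti scale A M i j =
     (let F = (SOME F. graded_free_resolution A M F)
      in quotient_dim (\<lambda>c. free_scale (scale c 1))
           (tor_cycles scale A F i j) (tor_boundaries scale A F i j))"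


section \<open>The quadratic dual\<close>

abbreviation fun_scale :: "'k::field \<Rightarrow> ('x \<Rightarrow> 'k) \<Rightarrow> 'x \<Rightarrow> 'k" where
  "fun_scale c f \<equiv> (\<lambda>x. c * f x)"

text \<open>The linear dual of a subspace \<open>U\<close>, its elements being extended by \<open>0\<close> outside \<open>U\<close>.\<close>

definition dual_space ::
    "('k::field \<Rightarrow> 'v::ab_group_add \<Rightarrow> 'v) \<Rightarrow> 'v set \<Rightarrow> ('v \<Rightarrow> 'k) set" where
  "dual_space s U =
     {f. (\<forall>x\<in>U. \<forall>y\<in>U. f (x + y) = f x + f y) \<and> (\<forall>c. \<forall>x\<in>U. f (s c x) = c * f x) \<and>
         (\<forall>x. x \<notin> U \<longrightarrow> f x = 0)}"

text \<open>
  The tensor algebra \<open>T(V\<^sup>*)\<close> is realised inside the functions from words over \<open>V\<close> to \<open>k\<close> by the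
  canonical embedding that sends \<open>f\<^sub>1 \<otimes> \<dots> \<otimes> f\<^sub>n\<close> to the \<open>n\<close>-linear form
  \<open>(v\<^sub>1, \<dots>, v\<^sub>n) \<mapsto> f\<^sub>1 v\<^sub>1 \<cdots> f\<^sub>n v\<^sub>n\<close>, which vanishes on words of any other length. The product
  of \<open>T(V\<^sup>*)\<close> becomes the convolution \<open>tensor_mult\<close>, and the pairing of a tensor in
  \<open>V\<^sup>* \<otimes> V\<^sup>*\<close> with \<open>v \<otimes> w\<close> is its value at the word \<open>[v, w]\<close>.
\<close>

definition pure_tensor :: "('a \<Rightarrow> 'k::field) list \<Rightarrow> 'a list \<Rightarrow> 'k" where
  "pure_tensor fs vs =
     (if length vs = length fs then prod_list (map2 (\<lambda>f v. f v) fs vs) else 0)"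

definition tensor_mult :: "('a list \<Rightarrow> 'k::field) \<Rightarrow> ('a list \<Rightarrow> 'k) \<Rightarrow> 'a list \<Rightarrow> 'k" where
  "tensor_mult \<phi> \<psi> vs = (\<Sum>p\<le>length vs. \<phi> (take p vs) * \<psi> (drop p vs))"

definition tensor_algebra ::
    "('k::field \<Rightarrow> 'a::ring_1 \<Rightarrow> 'a) \<Rightarrow> (nat \<Rightarrow> 'a set) \<Rightarrow> ('a list \<Rightarrow> 'k) set" where
  "tensor_algebra scale A =
     module.span fun_scale {pure_tensor fs | fs. set fs \<subseteq> dual_space scale (A 1)}"

definition tensor_component ::
    "('k::field \<Rightarrow> 'a::ring_1 \<Rightarrow> 'a) \<Rightarrow> (nat \<Rightarrow> 'a set) \<Rightarrow> nat \<Rightarrow> ('a list \<Rightarrow> 'k) set" where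
  "tensor_component scale A n =
     module.span fun_scale
       {pure_tensor fs | fs. set fs \<subseteq> dual_space scale (A 1) \<and> length fs = n}"

text \<open>
  The orthogonal complement of \<open>Q\<^sub>2\<close>, the kernel of the multiplication \<open>V \<otimes> V \<rightarrow> A\<^sub>2\<close>; the list
  \<open>ps\<close> of pairs stands for the tensor \<open>\<Sum> v \<otimes> w\<close> over its entries \<open>(v, w)\<close>.
\<close>

definition quadratic_orthogonal ::
    "('k::field \<Rightarrow> 'a::ring_1 \<Rightarrow> 'a) \<Rightarrow> (nat \<Rightarrow> 'a set) \<Rightarrow> ('a list \<Rightarrow> 'k) set" where
  "quadratic_orthogonal scale A =
     {\<phi> \<in> tensor_component scale A 2.
        \<forall>ps. set ps \<subseteq> A 1 \<times> A 1 \<and> (\<Sum>(v, w)\<leftarrow>ps. v * w) = 0 \<longrightarrow> (\<Sum>(v, w)\<leftarrow>ps. \<phi> [v, w]) = 0}"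

definition quadratic_dual_ideal ::
    "('k::field \<Rightarrow> 'a::ring_1 \<Rightarrow> 'a) \<Rightarrow> (nat \<Rightarrow> 'a set) \<Rightarrow> ('a list \<Rightarrow> 'k) set" where
  "quadratic_dual_ideal scale A =
     module.span fun_scale
       {tensor_mult (tensor_mult \<psi> \<phi>) \<chi> | \<psi> \<phi> \<chi>. \<psi> \<in> tensor_algebra scale A \<and>
          \<phi> \<in> quadratic_orthogonal scale A \<and> \<chi> \<in> tensor_algebra scale A}"

text \<open>
  The image of \<open>T(V\<^sup>*)\<^sub>n\<close> in \<open>A\<^sup>! = T(V\<^sup>*)/Q\<^sup>\<bottom>\<close> is \<open>T(V\<^sup>*)\<^sub>n/(T(V\<^sup>*)\<^sub>n \<inter> Q\<^sup>\<bottom>)\<close>; its dual consists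
  of the linear forms on \<open>T(V\<^sup>*)\<^sub>n\<close> that vanish on \<open>T(V\<^sup>*)\<^sub>n \<inter> Q\<^sup>\<bottom>\<close>.
\<close>

definition quadratic_dual_star ::
    "('k::field \<Rightarrow> 'a::ring_1 \<Rightarrow> 'a) \<Rightarrow> (nat \<Rightarrow> 'a set) \<Rightarrow> nat \<Rightarrow> (('a list \<Rightarrow> 'k) \<Rightarrow> 'k) set" where
  "quadratic_dual_star scale A n =
     {\<xi> \<in> dual_space fun_scale (tensor_component scale A n).
        \<forall>\<phi> \<in> tensor_component scale A n \<inter> quadratic_dual_ideal scale A. \<xi> \<phi> = 0}"

definition dim_quadratic_dual_star ::
    "('k::field \<Rightarrow> 'a::ring_1 \<Rightarrow> 'a) \<Rightarrow> (nat \<Rightarrow> 'a set) \<Rightarrow> nat \<Rightarrow> nat" where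
  "dim_quadratic_dual_star scale A n =
     vector_space.dim fun_scale (quadratic_dual_star scale A n)"


section \<open>Generating series\<close>

text \<open>
  Series in \<open>y\<close> and \<open>z\<close> are power series in \<open>z\<close> (outer variable) whose coefficients are power
  series in \<open>y\<close> (inner variable).
\<close>

definition poincare_series ::
    "('k::field \<Rightarrow> 'a::ring_1 \<Rightarrow> 'a) \<Rightarrow> (nat \<Rightarrow> 'a set) \<Rightarrow> ('a, 'm) graded_module \<Rightarrow> int fps fps" where
  "poincare_series scale A M = Abs_fps (\<lambda>i. Abs_fps (\<lambda>j. int (betti scale A M i j)))"

definition hilbert_dual ::
    "('k::field \<Rightarrow> 'a::ring_1 \<Rightarrow> 'a) \<Rightarrow> (nat \<Rightarrow> 'a set) \<Rightarrow> int fps" where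
  "hilbert_dual scale A = Abs_fps (\<lambda>l. int (dim_quadratic_dual_star scale A l))"

definition hilbert_truncated ::
    "('k::field \<Rightarrow> 'a::ring_1 \<Rightarrow> 'a) \<Rightarrow> (nat \<Rightarrow> 'a set) \<Rightarrow> nat \<Rightarrow> int fps" where
  "hilbert_truncated scale A a = (\<Sum>j<a. fps_const (int (vector_space.dim scale (A j))) * fps_X ^ j)"

text \<open>The substitution \<open>t \<mapsto> c y z\<close> in a series \<open>H(t)\<close>.\<close>

definition subst_yz :: "int \<Rightarrow> int fps \<Rightarrow> int fps fps" where
  "subst_yz c H = Abs_fps (\<lambda>l. fps_const (c ^ l * fps_nth H l) * fps_X ^ l)"

text \<open>
  For a Koszul algebra, \<open>H\<^bsub>(A\<^sup>!)\<^sup>*\<^esub>(t) H\<^bsub>A/\<mm>\<^sup>a\<^esub>(-t)\<close> has constant term \<open>1\<close> and its other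
  terms of degree below \<open>a\<close> vanish, because it agrees with \<open>H\<^bsub>(A\<^sup>!)\<^sup>*\<^esub>(t) H\<^sub>A(-t) = 1\<close> in those
  degrees. Multiplying it by \<open>-(-z)\<^bsup>-a\<^esup>\<close> at \<open>t = yz\<close> hence yields the Poincare series of
  \<open>\<mm>\<^sup>a\<close> only after the constant term \<open>1\<close> is removed from the product.
\<close>

end

theory Submission
  imports Defs
begin

text \<open>
  Linear resolutions are unrolled one syzygy module at a time, so that linearity becomes a
  coinductive property of submodules of free modules. If \<open>0 \<rightarrow> N' \<rightarrow> N \<rightarrow> N'' \<rightarrow> 0\<close> is exact and
  \<open>N'\<close>, \<open>N\<close> are linear of the same degree, a basis of the generators of \<open>N'\<close> extends to one of
  the generators of \<open>N\<close>, so the syzygy modules again form such a sequence, and \<open>N''\<close> is linear;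
  the ranks are additive. The syzygies \<open>\<Omega>\<close> of \<open>\<mm>\<^sup>a\<close> fit into
  \<open>0 \<rightarrow> \<Omega> \<rightarrow> \<mm> \<otimes> A\<^sub>a \<rightarrow> \<mm>\<^bsup>a+1\<^esup> \<rightarrow> 0\<close>, and \<open>\<mm>\<close> is linear because \<open>A\<close> is Koszul. Induction on \<open>a\<close>
  gives the linear resolution of \<open>\<mm>\<^sup>a\<close> and the recursion
  \<open>\<beta>\<^bsub>n\<^esub>(\<mm>\<^bsup>a+1\<^esup>) = dim A\<^sub>a \<cdot> w\<^bsub>n+1\<^esub> - \<beta>\<^bsub>n+1\<^esub>(\<mm>\<^sup>a)\<close>, where \<open>w\<^sub>n\<close> is the \<open>n\<close>-th rank in the
  resolution of \<open>k\<close>. Finally \<open>w\<^sub>n = dim (A\<^sup>!)\<^sup>*\<^sub>n\<close>: unfolding the differentials of the resolution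
  turns its generators into linear forms on \<open>T(V\<^sup>*)\<^sub>n\<close>, and by exactness their common kernel is
  the degree \<open>n\<close> part of \<open>Q\<^sup>\<bottom>\<close>.
\<close>

text \<open>All degrees are normalised. In \<open>lin\<close> the ambient free module sits in degree
  0 and the submodule is generated in degree 1, so passing to syzygies reproduces the situation and
  coinduction carries no shifts; basis degrees return only when the resolutions are assembled.
  Minimality is then automatic: the syzygies have no degree-0 part, so generators satisfy no
  relation with scalar coefficients. Three obstacles shape the rest. Ranks are natural numbers, so
  the rank of a quotient is an honest difference only after the rank of the submodule has been
  bounded. \<open>betti\<close> uses an arbitrary resolution and a \<open>graded_module\<close>
  obeys no axioms; comparison maps and homotopies are therefore built from the resolutions alone,
  homogeneity coming from an embedding of the module into \<open>A\<close>. Finally, membership in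
  the ideal of \<open>A!\<close> is extracted from exactness: a linear form on the degree-1 part of
  a free module that kills the next boundaries factors through the degree-2 part of the previous
  one, and its pullback along \<open>V \<otimes> V -> A_2\<close> annihilates
  \<open>Q_2\<close>.\<close>

type_synonym 'a vec = "nat \<Rightarrow>\<^sub>0 'a"

abbreviation lookup where "lookup \<equiv> Poly_Mapping.lookup"
abbreviation keys where "keys \<equiv> Poly_Mapping.keys"
abbreviation single where "single \<equiv> Poly_Mapping.single"

section \<open>Homogeneous components\<close>

context standard_graded_algebra
begin

lemma zero_in_component [simp]: "0 \<in> A i"
  using component_subspace subspace_0 by blast

lemma component_add: "x \<in> A i \<Longrightarrow> y \<in> A i \<Longrightarrow> x + y \<in> A i"
  using component_subspace subspace_add by blast

lemma component_scale: "x \<in> A i \<Longrightarrow> scale c x \<in> A i"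
  using component_subspace subspace_scale by blast

lemma component_diff: "x \<in> A i \<Longrightarrow> y \<in> A i \<Longrightarrow> x - y \<in> A i"
  using component_subspace subspace_diff by blast

lemma component_sum: "(\<And>s. s \<in> S \<Longrightarrow> f s \<in> A i) \<Longrightarrow> sum f S \<in> A i"
  using component_subspace subspace_sum by blast

lemma scale_in_component_zero [simp]: "scale c 1 \<in> A 0"
  by (simp add: component_zero)

lemma one_in_component_zero [simp]: "1 \<in> A 0"
  using scale_in_component_zero[of 1] by simp

lemma scale_one_mult [simp]: "scale c 1 * x = scale c x"
  by (simp add: scale_mult_left)

definition part :: "nat \<Rightarrow> 'a \<Rightarrow> 'a" where
  "part i x = (THE f. (\<forall>i. f i \<in> A i) \<and> finite {i. f i \<noteq> 0} \<and> x = (\<Sum>i | f i \<noteq> 0. f i)) i"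

lemma part_props:
  "part i x \<in> A i" "finite {i. part i x \<noteq> 0}" "(\<Sum>i | part i x \<noteq> 0. part i x) = x"
proof -
  let ?P = "\<lambda>f. (\<forall>i. f i \<in> A i) \<and> finite {i. f i \<noteq> 0} \<and> x = (\<Sum>i | f i \<noteq> 0. f i)"
  have "?P (THE f. ?P f)"
    using theI'[OF direct_sum[of x]] .
  hence "?P (\<lambda>i. part i x)"
    by (simp add: part_def)
  thus "part i x \<in> A i" "finite {i. part i x \<noteq> 0}" "(\<Sum>i | part i x \<noteq> 0. part i x) = x"
    by auto
qed

lemma part_in [simp]: "part i x \<in> A i"
  by (rule part_props)

lemma part_unique:
  assumes "\<And>i. f i \<in> A i" "finite S" "\<And>i. i \<notin> S \<Longrightarrow> f i = 0" "x = sum f S"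
  shows "part i x = f i"
proof -
  let ?P = "\<lambda>f. (\<forall>i. f i \<in> A i) \<and> finite {i. f i \<noteq> 0} \<and> x = (\<Sum>i | f i \<noteq> 0. f i)"
  have sub: "{i. f i \<noteq> 0} \<subseteq> S"
    using assms(3) by auto
  have "x = (\<Sum>i | f i \<noteq> 0. f i)"
    unfolding assms(4) by (rule sum.mono_neutral_right) (use assms(2) sub in auto)
  hence "?P f"
    using assms(1) finite_subset[OF sub assms(2)] by auto
  thus ?thesis
    unfolding part_def by (rule the1_equality[OF direct_sum[of x], THEN fun_cong])
qed

lemma sum_part:
  assumes "finite S" "\<And>i. i \<notin> S \<Longrightarrow> part i x = 0"
  shows "(\<Sum>i\<in>S. part i x) = x"
proof -
  have "(\<Sum>i\<in>S. part i x) = (\<Sum>i | part i x \<noteq> 0. part i x)"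
    by (rule sum.mono_neutral_right) (use assms in auto)
  thus ?thesis by (simp add: part_props)
qed

lemma part_add: "part i (x + y) = part i x + part i y"
proof (rule part_unique[where f = "\<lambda>i. part i x + part i y" and S = "{i. part i x \<noteq> 0} \<union> {i. part i y \<noteq> 0}"])
  let ?S = "{i. part i x \<noteq> 0} \<union> {i. part i y \<noteq> 0}"
  have "x = (\<Sum>i\<in>?S. part i x)"
    by (rule sum_part[symmetric]) (auto simp: part_props)
  moreover have "y = (\<Sum>i\<in>?S. part i y)"
    by (rule sum_part[symmetric]) (auto simp: part_props)
  ultimately show "x + y = (\<Sum>i\<in>?S. part i x + part i y)"
    by (simp only: sum.distrib)
qed (auto simp: part_props component_add)

lemma part_component: "x \<in> A j \<Longrightarrow> part i x = (if i = j then x else 0)"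
  by (rule part_unique[where S = "{j}"]) auto

lemma part_scale: "part i (scale c x) = scale c (part i x)"
proof (rule part_unique[where S = "{i. part i x \<noteq> 0}"])
  show "scale c x = (\<Sum>i | part i x \<noteq> 0. scale c (part i x))"
    using part_props(3)[of x] by (simp flip: scale_sum_right)
qed (auto simp: part_props component_scale)

lemma part_zero [simp]: "part i 0 = 0"
  using part_component[of 0] by simp

lemma part_uminus: "part i (- x) = - part i x"
  using part_add[of i x "- x"] by (simp add: eq_neg_iff_add_eq_0 add.commute)

lemma part_diff: "part i (x - y) = part i x - part i y"
  using part_add[of i x "- y"] by (simp add: part_uminus)

lemma part_sum: "part i (sum f S) = (\<Sum>s\<in>S. part i (f s))"
  by (induction S rule: infinite_finite_induct) (auto simp: part_add)

lemma part_part: "part i (part j x) = (if i = j then part j x else 0)"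
  by (rule part_component) simp

lemma graded_induct [case_names add component]:
  assumes "\<And>x y. P x \<Longrightarrow> P y \<Longrightarrow> P (x + y)" "\<And>i x. x \<in> A i \<Longrightarrow> P x"
  shows "P x"
proof -
  have "P (\<Sum>i\<in>S. part i x)" if "finite S" for S
    using that by induction (auto intro: assms(1) assms(2)[of _ 0] assms(2)[OF part_in])
  thus ?thesis using part_props(2,3)[of x] by metis
qed

lemma part_mult: "part n (x * y) = (\<Sum>i\<le>n. part i x * part (n - i) y)"
proof (induction x rule: graded_induct)
  case (add x x')
  thus ?case by (simp add: distrib_right part_add sum.distrib)
next
  case x: (component i x)
  show ?case
  proof (induction y rule: graded_induct)
    case (add y y')
    thus ?case by (simp add: distrib_left part_add sum.distrib)
  next
    case y: (component j y)
    have "(\<Sum>l\<le>n. part l x * part (n - l) y) = (\<Sum>l\<le>n. if l = i then x * part (n - i) y else 0)"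
      by (intro sum.cong) (auto simp: part_component[OF x])
    also have "\<dots> = (if i \<le> n then x * part (n - i) y else 0)"
      by simp
    also have "\<dots> = part n (x * y)"
      using component_mult[OF x y] by (auto simp: part_component[OF y] part_component)
    finally show ?case ..
  qed
qed

lemma part_mult_right_component:
  "y \<in> A j \<Longrightarrow> part n (x * y) = (if j \<le> n then part (n - j) x * y else 0)"
proof -
  assume y: "y \<in> A j"
  have "part n (x * y) = (\<Sum>i\<le>n. if i = n - j \<and> j \<le> n then part (n - j) x * y else 0)"
    unfolding part_mult by (intro sum.cong) (auto simp: part_component[OF y])
  thus ?thesis by auto
qed

lemma part_zero_mult: "part 0 (x * y) = part 0 x * part 0 y"
  by (simp add: part_mult)

lemma prod_list_in_component: "set xs \<subseteq> A 1 \<Longrightarrow> prod_list xs \<in> A (length xs)"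
  by (induction xs) (use component_mult[of _ 1] in auto)

text \<open>The degree-n projection fixes a word of length n in elements of \<open>A 1\<close> and
  kills every other word, so applying it to the spanning set of
  \<open>generated_in_degree_one\<close> leaves the words of length n.\<close>

lemma component_eq_span: "A n = span {prod_list xs | xs. set xs \<subseteq> A 1 \<and> length xs = n}"
  (is "_ = span ?S")
proof
  show "span ?S \<subseteq> A n"
    using prod_list_in_component component_subspace by (intro span_minimal) auto
  have "part n x \<in> span ?S" if "x \<in> span {prod_list xs | xs. set xs \<subseteq> A 1}" for x
    using that
  proof (induction rule: span_induct_alt)
    case base
    thus ?case by (simp add: span_zero)
  next
    case (step c x y)
    then obtain xs where "x = prod_list xs" "set xs \<subseteq> A 1" by auto
    hence "part n x \<in> span ?S"
      using part_component[OF prod_list_in_component, of xs n]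
      by (auto intro: span_base span_zero)
    thus ?case using step by (simp add: part_add part_scale span_add span_scale)
  qed
  hence prn: "part n x \<in> span ?S" for x
    by (simp only: generated_in_degree_one UNIV_I)
  show "A n \<subseteq> span ?S"
  proof
    fix x assume "x \<in> A n"
    hence "part n x = x" by (simp add: part_component)
    thus "x \<in> span ?S" using prn[of x] by (rule subst)
  qed
qed

text \<open>This is \<open>A (Suc n) = A 1 * A n\<close> as an induction rule, the form in which
  generation in degree one is used later. There is no case for scaling because the scalar is moved
  into the factor \<open>v\<close>.\<close>

lemma component_Suc_induct [consumes 1, case_names zero add mult]:
  assumes "x \<in> A (Suc n)" "P 0" "\<And>x y. P x \<Longrightarrow> P y \<Longrightarrow> P (x + y)"
    "\<And>v y. v \<in> A 1 \<Longrightarrow> y \<in> A n \<Longrightarrow> P (v * y)"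
  shows "P x"
proof -
  have "x \<in> span {prod_list xs | xs. set xs \<subseteq> A 1 \<and> length xs = Suc n}"
    using assms(1) component_eq_span by blast
  thus ?thesis
  proof (induction rule: span_induct_alt)
    case (step c x y)
    then obtain v vs where "x = v * prod_list vs" "v \<in> A 1" "set vs \<subseteq> A 1" "length vs = n"
      by (auto simp: length_Suc_conv)
    hence "P (scale c v * prod_list vs)"
      using prod_list_in_component[of vs] by (intro assms(4)) (auto simp: component_scale)
    thus ?case
      using step \<open>x = _\<close> by (intro assms(3)) (simp_all add: scale_mult_left)
  qed (fact assms(2))
qed

lemma irrelevant_ideal_eq: "irrelevant_ideal scale A = {x. part 0 x = 0}"
proof
  have "subspace {x. part 0 x = 0}"
    by (auto simp: subspace_def part_add part_scale)
  thus "irrelevant_ideal scale A \<subseteq> {x. part 0 x = 0}"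
    unfolding irrelevant_ideal_def by (intro span_minimal) (auto simp: part_component)
  show "{x. part 0 x = 0} \<subseteq> irrelevant_ideal scale A"
  proof
    fix x assume "x \<in> {x. part 0 x = 0}"
    hence "part i x \<in> span (\<Union>i\<in>{1..}. A i)" for i
      by (cases "i = 0") (auto intro: span_zero intro!: span_base bexI[of _ i])
    hence "(\<Sum>i | part i x \<noteq> 0. part i x) \<in> span (\<Union>i\<in>{1..}. A i)"
      by (intro span_sum)
    thus "x \<in> irrelevant_ideal scale A"
      by (simp add: irrelevant_ideal_def part_props)
  qed
qed

lemma submodule_generated_left_idealI:
  assumes "0 \<in> J" "S \<subseteq> J" "\<And>x y. x \<in> J \<Longrightarrow> y \<in> J \<Longrightarrow> x + y \<in> J" "\<And>r x. x \<in> J \<Longrightarrow> r * x \<in> J"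
  shows "submodule_generated (left_ideal_module A I) S \<subseteq> J"
proof
  fix x assume "x \<in> submodule_generated (left_ideal_module A I) S"
  thus "x \<in> J"
    by induction (use assms in \<open>auto simp: left_ideal_module_def\<close>)
qed

text \<open>In a standard graded algebra the powers of \<open>\<mm>\<close> are the order
  filtration. For the inclusion that rests on generation in degree one, a component of degree
  \<open>Suc j\<close> with \<open>a \<le> j\<close> is a sum of products \<open>v * y\<close> with
  \<open>v\<close> in \<open>A 1\<close>, and \<open>y\<close> in \<open>A j\<close> already lies in
  the \<open>a\<close>-th power.\<close>

lemma ideal_power_eq: "ideal_power A (irrelevant_ideal scale A) a = {x. \<forall>i<a. part i x = 0}"
proof (induction a)
  case (Suc a)
  let ?M = "left_ideal_module A (ideal_power A (irrelevant_ideal scale A) a)"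
  let ?S = "{act ?M r x | r x. r \<in> irrelevant_ideal scale A \<and> x \<in> carr ?M}"
  have S: "?S = {r * x | r x. part 0 r = 0 \<and> (\<forall>i<a. part i x = 0)}"
    using Suc by (simp add: irrelevant_ideal_eq left_ideal_module_def)
  have gen0: "0 \<in> submodule_generated ?M ?S"
    using gen_zero[of ?M ?S] by (simp add: left_ideal_module_def)
  have gena: "x + y \<in> submodule_generated ?M ?S"
    if "x \<in> submodule_generated ?M ?S" "y \<in> submodule_generated ?M ?S" for x y
    using gen_add[OF that] by (simp add: left_ideal_module_def)
  have "submodule_generated ?M ?S \<subseteq> {x. \<forall>i<Suc a. part i x = 0}"
  proof (rule submodule_generated_left_idealI)
    show "?S \<subseteq> {x. \<forall>i<Suc a. part i x = 0}"
      unfolding S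
    proof safe
      fix r x i assume r: "part 0 r = 0" and x: "\<forall>i<a. part i x = 0" and "i < Suc a"
      have "part j r * part (i - j) x = 0" if "j \<le> i" for j
        using r x \<open>i < Suc a\<close> that by (cases "j = 0") auto
      thus "part i (r * x) = 0" by (simp add: part_mult)
    qed
  qed (auto simp: part_add part_mult)
  moreover have "x \<in> submodule_generated ?M ?S" if x: "\<forall>i<Suc a. part i x = 0" for x
  proof -
    have "part i x \<in> submodule_generated ?M ?S" for i
    proof (cases "i < Suc a")
      case False
      then obtain j where i: "i = Suc j" "a \<le> j"
        by (cases i) auto
      have "part i x \<in> A (Suc j)" by (simp add: i)
      thus ?thesis
      proof (induction rule: component_Suc_induct)
        case (mult v y)
        hence "part 0 v = 0 \<and> (\<forall>l<a. part l y = 0)" using i by (auto simp: part_component)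
        hence "v * y \<in> ?S" unfolding S by blast
        thus ?case by (rule gen_incl)
      qed (auto intro: gen0 gena)
    qed (use x gen0 in simp)
    moreover have "(\<Sum>i\<in>T. part i x) \<in> submodule_generated ?M ?S"
      if "finite T" "\<And>i. part i x \<in> submodule_generated ?M ?S" for T
      using that by induction (auto intro: gen0 gena)
    ultimately have "(\<Sum>i | part i x \<noteq> 0. part i x) \<in> submodule_generated ?M ?S"
      using part_props(2) by blast
    thus ?thesis by (simp add: part_props)
  qed
  ultimately show ?case
    by (auto simp: ideal_times_def)
qed simp

lemma component_basis:
  obtains S where "finite S" "S \<subseteq> A i" "independent S" "span S = A i" "card S = dim (A i)"
proof -
  obtain S where S: "S \<subseteq> A i" "independent S" "A i \<subseteq> span S" "card S = dim (A i)"
    using basis_exists by blast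
  obtain T where "finite T" "A i \<subseteq> span T"
    using component_finite_dim by blast
  hence "finite S"
    using independent_span_bound[of T S] S by blast
  moreover have "span S = A i"
    using S span_minimal[OF S(1) component_subspace] by blast
  ultimately show ?thesis using S that by blast
qed

end

section \<open>Linear maps between free modules\<close>

context vector_space
begin

text \<open>Generators of modules are indexed families, and a family with a repetition is dependent
  although its image may be an independent set; hence injectivity on the left.\<close>

lemma independent_family_iff:
  assumes I: "finite I"
  shows "inj_on u I \<and> independent (u ` I) \<longleftrightarrow>
    (\<forall>c. (\<Sum>i\<in>I. scale (c i) (u i)) = 0 \<longrightarrow> (\<forall>i\<in>I. c i = 0))" (is "?L \<longleftrightarrow> ?R")
proof
  assume L: ?L
  show ?R
  proof (intro allI impI)
    fix c assume c: "(\<Sum>i\<in>I. scale (c i) (u i)) = 0"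
    have "(\<Sum>v\<in>u ` I. scale (c (the_inv_into I u v)) v) = 0"
      using L c by (subst sum.reindex) (auto simp: the_inv_into_f_f)
    hence "\<forall>v\<in>u ` I. c (the_inv_into I u v) = 0"
      using L I dependent_finite[of "u ` I"] by auto
    thus "\<forall>i\<in>I. c i = 0"
      using L by (auto simp: the_inv_into_f_f)
  qed
next
  assume R: ?R
  have inj: "inj_on u I"
  proof (rule inj_onI, rule ccontr)
    fix i j assume ij: "i \<in> I" "j \<in> I" "u i = u j" "i \<noteq> j"
    \<comment> \<open>A repetition \<open>u i = u j\<close> gives the nontrivial relation
      \<open>u i - u j = 0\<close>.\<close>
    define c where "c = (\<lambda>l. if l = i then 1 :: 'a else if l = j then - 1 else 0)"
    have "(\<Sum>l\<in>I. scale (c l) (u l)) = (\<Sum>l\<in>{i,j}. scale (c l) (u l))"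
      using I ij by (intro sum.mono_neutral_right) (auto simp: c_def)
    also have "\<dots> = 0" using ij by (simp add: c_def)
    finally have "c i = 0" using R ij(1) by blast
    thus False by (simp add: c_def)
  qed
  have "independent (u ` I)"
  proof
    assume "dependent (u ` I)"
    then obtain w where w: "\<exists>v\<in>u ` I. w v \<noteq> 0" "(\<Sum>v\<in>u ` I. scale (w v) v) = 0"
      using I dependent_finite[of "u ` I"] by auto
    hence "(\<Sum>i\<in>I. scale (w (u i)) (u i)) = 0"
      using inj by (simp add: sum.reindex)
    thus False using R w(1) by auto
  qed
  with inj show ?L by blast
qed

lemma span_family:
  assumes "finite I"
  shows "x \<in> span (u ` I) \<longleftrightarrow> (\<exists>c. x = (\<Sum>i\<in>I. scale (c i) (u i)))"
proof
  assume "x \<in> span (u ` I)"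
  thus "\<exists>c. x = (\<Sum>i\<in>I. scale (c i) (u i))"
  proof (induction rule: span_induct_alt)
    case base
    show ?case by (rule exI[of _ "\<lambda>_. 0"]) simp
  next
    case (step c v y)
    then obtain i d where "i \<in> I" "v = u i" "y = (\<Sum>i\<in>I. scale (d i) (u i))" by auto
    moreover have "(\<Sum>j\<in>I. scale ((if j = i then c else 0) + d j) (u j))
        = (\<Sum>j\<in>I. if j = i then scale c (u i) else 0) + (\<Sum>j\<in>I. scale (d j) (u j))"
      unfolding sum.distrib[symmetric] by (intro sum.cong) (auto simp: scale_left_distrib)
    ultimately show ?case
      using assms by (intro exI[of _ "\<lambda>j. (if j = i then c else 0) + d j"]) simp
  qed
next
  assume "\<exists>c. x = (\<Sum>i\<in>I. scale (c i) (u i))"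
  thus "x \<in> span (u ` I)"
    by (auto intro!: span_sum span_scale intro: span_base)
qed

text \<open>Steinitz exchange for families. The complement of \<open>u\<close> consists of members
  of \<open>s\<close>, indexed by a subset \<open>K\<close> of the old index set, so that a quotient
  module can be generated by some of the generators of the module. Coefficients on \<open>u\<close>
  and on \<open>s\<close> are kept apart because they become the two components of a
  splitting.\<close>

lemma exchange_family:
  assumes fin: "finite I" "finite J"
    and u: "inj_on u I" "independent (u ` I)"
    and s: "inj_on s J" "independent (s ` J)"
    and us: "u ` I \<subseteq> span (s ` J)"
  obtains K where "K \<subseteq> J" "card J = card I + card K"
    "\<And>c d. (\<Sum>i\<in>I. scale (c i) (u i)) + (\<Sum>j\<in>K. scale (d j) (s j)) = 0 \<Longrightarrow>
        (\<forall>i\<in>I. c i = 0) \<and> (\<forall>j\<in>K. d j = 0)"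
    "\<And>j. j \<in> J \<Longrightarrow> \<exists>c d. s j = (\<Sum>i\<in>I. scale (c i) (u i)) + (\<Sum>j\<in>K. scale (d j) (s j))"
proof -
  obtain T where T: "u ` I \<subseteq> T" "T \<subseteq> u ` I \<union> s ` J" "independent T" "u ` I \<union> s ` J \<subseteq> span T"
    using maximal_independent_subset_extend[of "u ` I" "u ` I \<union> s ` J"] u by blast
  define K where "K = {j\<in>J. s j \<in> T - u ` I}"
  \<comment> \<open>The extended basis \<open>T\<close> as one family on a disjoint sum, since
    \<open>I\<close> and \<open>K\<close> need not be disjoint index sets.\<close>
  define w where "w = case_sum u s"
  have K: "K \<subseteq> J" "finite K" "inj_on s K"
    using fin s(1) by (auto simp: K_def inj_on_def)
  have sK: "s ` K = T - u ` I"
    using T(2) by (auto simp: K_def)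
  have wT: "w ` (I <+> K) = T"
    using T(1) sK by (auto simp: w_def image_Un Plus_def image_image)
  have winj: "inj_on w (I <+> K)"
  proof (rule inj_onI)
    fix l l' assume "l \<in> I <+> K" "l' \<in> I <+> K" "w l = w l'"
    moreover have "u i \<noteq> s j" "s j \<noteq> u i" if "i \<in> I" "j \<in> K" for i j
      using sK that by blast+
    ultimately show "l = l'"
      using inj_onD[OF u(1)] inj_onD[OF K(3)] by (cases l; cases l') (simp_all add: w_def Plus_def image_iff)
  qed
  have fT: "finite T"
    using T(2) fin by (auto intro: finite_subset)
  have "span T = span (s ` J)"
  proof
    show "span T \<subseteq> span (s ` J)"
      using T(2) us by (intro span_minimal subspace_span) (auto intro: span_base)
    show "span (s ` J) \<subseteq> span T"
      using T(4) by (intro span_minimal subspace_span) auto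
  qed
  hence "card T = card (s ` J)"
    using dim_span_eq_card_independent[OF T(3)] dim_span_eq_card_independent[OF s(2)] by simp
  moreover have "card T = card I + card K"
    using card_image[OF winj] wT fin K by (simp add: card_Plus)
  ultimately have card: "card J = card I + card K"
    using card_image[OF s(1)] by simp
  have sum_w: "(\<Sum>l\<in>I <+> K. scale (e l) (w l)) =
      (\<Sum>i\<in>I. scale (e (Inl i)) (u i)) + (\<Sum>j\<in>K. scale (e (Inr j)) (s j))" for e
    using fin K(2) by (simp add: sum.Plus w_def)
  have ind: "\<forall>e. (\<Sum>l\<in>I <+> K. scale (e l) (w l)) = 0 \<longrightarrow> (\<forall>l\<in>I <+> K. e l = 0)"
    using independent_family_iff[of "I <+> K" w] winj wT T(3) fin K(2) by auto
  show thesis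
  proof (rule that[OF K(1) card])
    fix c d assume "(\<Sum>i\<in>I. scale (c i) (u i)) + (\<Sum>j\<in>K. scale (d j) (s j)) = 0"
    thus "(\<forall>i\<in>I. c i = 0) \<and> (\<forall>j\<in>K. d j = 0)"
      using ind[rule_format, of "case_sum c d"] by (force simp: sum_w)
  next
    fix j assume "j \<in> J"
    hence "s j \<in> span (w ` (I <+> K))"
      using T(4) wT by auto
    then obtain e where "s j = (\<Sum>l\<in>I <+> K. scale (e l) (w l))"
      using span_family[of "I <+> K"] fin K(2) by auto
    thus "\<exists>c d. s j = (\<Sum>i\<in>I. scale (c i) (u i)) + (\<Sum>j\<in>K. scale (d j) (s j))"
      by (auto simp: sum_w intro!: exI[of _ "\<lambda>i. e (Inl i)"] exI[of _ "\<lambda>j. e (Inr j)"])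
  qed
qed

end

section \<open>Left linear maps given by their values on a basis\<close>

lemma lookup_free_scale [simp]: "lookup (free_scale r f) b = r * lookup f b"
  by (simp add: free_scale_def Poly_Mapping.map.rep_eq when_def)

lemma free_scale_simps [simp]:
  "free_scale r 0 = 0" "free_scale 0 f = 0" "free_scale 1 f = f"
  "free_scale r (free_scale q f) = free_scale (r * q) f"
  "free_scale r (single b q) = single b (r * q)"
  by (auto intro!: poly_mapping_eqI simp: lookup_single when_def mult.assoc)

lemma free_scale_add: "free_scale r (f + g) = free_scale r f + free_scale r g"
  by (auto intro!: poly_mapping_eqI simp: lookup_add distrib_left)

lemma free_scale_add_left: "free_scale (r + q) f = free_scale r f + free_scale q f"
  by (auto intro!: poly_mapping_eqI simp: lookup_add distrib_right)

lemma free_scale_uminus [simp]: "free_scale (- r) f = - free_scale r f"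
  by (auto intro!: poly_mapping_eqI)

lemma free_scale_sum: "free_scale r (sum f S) = (\<Sum>x\<in>S. free_scale r (f x))"
  by (auto intro!: poly_mapping_eqI simp: lookup_sum sum_distrib_left)

lemma keys_free_scale: "keys (free_scale r f) \<subseteq> keys f"
  by (auto simp: in_keys_iff)

definition free :: "nat set \<Rightarrow> 'a::ring_1 vec set" where
  "free B = {f. keys f \<subseteq> B}"

text \<open>The left linear map with value \<open>s b\<close> at the basis element \<open>b\<close>.
  It is defined on all vectors, so that composition (\<open>lmap_lmap\<close>) carries no side
  condition; the intended domain is imposed by restricting to \<open>free B\<close>.\<close>

definition lmap :: "(nat \<Rightarrow> 'a::ring_1 vec) \<Rightarrow> 'a vec \<Rightarrow> 'a vec" where
  "lmap s f = (\<Sum>b\<in>keys f. free_scale (lookup f b) (s b))"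

lemma free_iff: "f \<in> free B \<longleftrightarrow> (\<forall>b. b \<notin> B \<longrightarrow> lookup f b = 0)"
  by (auto simp: free_def in_keys_iff)

lemma free_simps [simp]: "0 \<in> free B" "b \<in> B \<Longrightarrow> single b r \<in> free B"
  by (auto simp: free_iff lookup_single when_def)

lemma free_closed:
  "f \<in> free B \<Longrightarrow> g \<in> free B \<Longrightarrow> f + g \<in> free B"
  "f \<in> free B \<Longrightarrow> g \<in> free B \<Longrightarrow> f - g \<in> free B"
  "f \<in> free B \<Longrightarrow> - f \<in> free B"
  "f \<in> free B \<Longrightarrow> free_scale r f \<in> free B"
  "(\<And>x. x \<in> S \<Longrightarrow> h x \<in> free B) \<Longrightarrow> sum h S \<in> free B"
  by (auto simp: free_iff lookup_add lookup_minus lookup_sum)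

lemma lmap_superset: "finite S \<Longrightarrow> keys f \<subseteq> S \<Longrightarrow> lmap s f = (\<Sum>b\<in>S. free_scale (lookup f b) (s b))"
  unfolding lmap_def by (rule sum.mono_neutral_left) (auto simp: in_keys_iff)

lemma lmap_zero [simp]: "lmap s 0 = 0"
  by (simp add: lmap_def)

lemma lmap_add: "lmap s (f + g) = lmap s f + lmap s g"
proof -
  let ?S = "keys f \<union> keys g"
  have "keys (f + g) \<subseteq> ?S" by (rule keys_add)
  thus ?thesis
    by (simp add: lmap_superset[of ?S] lookup_add free_scale_add_left sum.distrib)
qed

lemma lmap_scale: "lmap s (free_scale r f) = free_scale r (lmap s f)"
  by (simp add: lmap_superset[OF _ keys_free_scale] free_scale_sum, simp add: lmap_def free_scale_sum)

lemma lmap_uminus: "lmap s (- f) = - lmap s f"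
  using lmap_add[of s f "- f"] by (simp add: eq_neg_iff_add_eq_0 add.commute)

lemma lmap_diff: "lmap s (f - g) = lmap s f - lmap s g"
  using lmap_add[of s f "- g"] by (simp add: lmap_uminus)

lemma lmap_sum: "lmap s (sum h S) = (\<Sum>x\<in>S. lmap s (h x))"
  by (induction S rule: infinite_finite_induct) (auto simp: lmap_add)

lemma lmap_single [simp]: "lmap s (single b r) = free_scale r (s b)"
  by (simp add: lmap_def)

lemma lmap_lmap: "lmap s (lmap t f) = lmap (\<lambda>b. lmap s (t b)) f"
  unfolding lmap_def[of t] by (simp add: lmap_sum lmap_scale) (simp add: lmap_def)

lemma lmap_cong: "(\<And>b. b \<in> B \<Longrightarrow> s b = t b) \<Longrightarrow> f \<in> free B \<Longrightarrow> lmap s f = lmap t f"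
  unfolding lmap_def by (intro sum.cong) (auto simp: free_def)

lemma lookup_lmap: "lookup (lmap s f) c = (\<Sum>b\<in>keys f. lookup f b * lookup (s b) c)"
  by (simp add: lmap_def lookup_sum)

lemma lmap_basis [simp]: "lmap (\<lambda>b. single b 1) f = f"
proof (rule poly_mapping_eqI)
  fix c
  have "(\<Sum>b\<in>keys f. lookup f b * lookup (single b 1) c)
      = (\<Sum>b\<in>keys f. if b = c then lookup f c else 0)"
    by (intro sum.cong) (auto simp: lookup_single when_def)
  thus "lookup (lmap (\<lambda>b. single b 1) f) c = lookup f c"
    by (simp add: lookup_lmap in_keys_iff)
qed

lemma lmap_in_free: "(\<And>b. b \<in> B \<Longrightarrow> s b \<in> free C) \<Longrightarrow> f \<in> free B \<Longrightarrow> lmap s f \<in> free C"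
  unfolding lmap_def by (intro free_closed(4,5)) (auto simp: free_def)

lemma lmap_zero_family [simp]: "lmap (\<lambda>_. 0) f = 0"
  by (simp add: lmap_def)

lemma lmap_family_add: "lmap (\<lambda>b. s b + t b) f = lmap s f + lmap t f"
  by (simp add: lmap_def free_scale_add sum.distrib)

lemma lmap_family_diff: "lmap (\<lambda>b. s b - t b) f = lmap s f - lmap t f"
  using lmap_family_add[of "\<lambda>b. s b - t b" t f] by simp

section \<open>Grading vectors by the degree of their coordinates\<close>

context standard_graded_algebra
begin

abbreviation vscale :: "'k \<Rightarrow> 'a vec \<Rightarrow> 'a vec" where
  "vscale c \<equiv> free_scale (scale c 1)"

sublocale V: vector_space "\<lambda>c. free_scale (scale c 1) :: 'a vec \<Rightarrow> _"
  by unfold_locales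
    (auto intro!: poly_mapping_eqI simp: lookup_add scale_right_distrib scale_left_distrib distrib_right)

text \<open>The component of degree \<open>j\<close> of a free module all of whose basis elements
  have degree 0; other basis degrees are treated by \<open>fcomp\<close>.\<close>

definition Vec :: "nat \<Rightarrow> 'a vec set" where
  "Vec j = {f. \<forall>b. lookup f b \<in> A j}"

definition vpart :: "nat \<Rightarrow> 'a vec \<Rightarrow> 'a vec" where
  "vpart j f = Poly_Mapping.map (part j) f"

lemma lookup_vpart [simp]: "lookup (vpart j f) b = part j (lookup f b)"
  by (simp add: vpart_def Poly_Mapping.map.rep_eq when_def)

lemma Vec_closed:
  "f \<in> Vec j \<Longrightarrow> g \<in> Vec j \<Longrightarrow> f + g \<in> Vec j"
  "f \<in> Vec j \<Longrightarrow> g \<in> Vec j \<Longrightarrow> f - g \<in> Vec j"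
  "r \<in> A i \<Longrightarrow> f \<in> Vec j \<Longrightarrow> free_scale r f \<in> Vec (i + j)"
  "(\<And>x. x \<in> S \<Longrightarrow> h x \<in> Vec j) \<Longrightarrow> sum h S \<in> Vec j"
  "f \<in> Vec j \<Longrightarrow> vscale c f \<in> Vec j"
  by (auto simp: Vec_def lookup_add lookup_minus lookup_sum component_add component_diff
      component_mult component_sum component_scale)

lemma Vec_zero [simp]: "0 \<in> Vec j"
  by (simp add: Vec_def)

lemma Vec_single: "r \<in> A j \<Longrightarrow> single b r \<in> Vec j"
  by (simp add: Vec_def lookup_single when_def)

lemma vpart_in_Vec [simp]: "vpart j f \<in> Vec j"
  by (simp add: Vec_def)

lemma vpart_Vec: "f \<in> Vec j \<Longrightarrow> vpart i f = (if i = j then f else 0)"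
  by (intro poly_mapping_eqI) (simp add: Vec_def part_component[of _ j])

lemma vpart_free: "f \<in> free B \<Longrightarrow> vpart j f \<in> free B"
  by (auto simp: free_iff)

lemma lmap_in_Vec: "f \<in> Vec i \<Longrightarrow> f \<in> free B \<Longrightarrow> (\<And>b. b \<in> B \<Longrightarrow> s b \<in> Vec j) \<Longrightarrow> lmap s f \<in> Vec (i + j)"
  unfolding lmap_def by (intro Vec_closed(4) Vec_closed(3)) (auto simp: Vec_def[of i] free_def)

text \<open>Values of degree \<open>j\<close> raise degrees by \<open>j\<close>, so homogeneous
  parts can be taken before or after the map. The main use is \<open>i = 0\<close>: a lift of an
  element of degree \<open>j\<close> may be replaced by its scalar part.\<close>

lemma vpart_lmap:
  assumes "f \<in> free B" "\<And>b. b \<in> B \<Longrightarrow> s b \<in> Vec j"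
  shows "vpart (i + j) (lmap s f) = lmap s (vpart i f)"
proof (rule poly_mapping_eqI)
  fix c
  have "lookup (lmap s (vpart i f)) c = (\<Sum>b\<in>keys f. part i (lookup f b) * lookup (s b) c)"
    by (subst lmap_superset[of "keys f"]) (auto simp: in_keys_iff lookup_sum)
  also have "\<dots> = (\<Sum>b\<in>keys f. part (i + j) (lookup f b * lookup (s b) c))"
  proof (intro sum.cong refl)
    fix b assume "b \<in> keys f"
    hence "lookup (s b) c \<in> A j"
      using assms by (auto simp: free_def Vec_def)
    thus "part i (lookup f b) * lookup (s b) c = part (i + j) (lookup f b * lookup (s b) c)"
      by (simp add: part_mult_right_component)
  qed
  finally show "lookup (vpart (i + j) (lmap s f)) c = lookup (lmap s (vpart i f)) c"
    by (simp add: lookup_lmap part_sum)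
qed

lemma vpart_lmap_low:
  assumes "f \<in> free B" "\<And>b. b \<in> B \<Longrightarrow> s b \<in> Vec j" "i < j"
  shows "vpart i (lmap s f) = 0"
proof (rule poly_mapping_eqI)
  fix c
  have "part i (lookup f b * lookup (s b) c) = 0" if "b \<in> keys f" for b
  proof -
    have "lookup (s b) c \<in> A j"
      using assms that by (auto simp: free_def Vec_def)
    thus ?thesis using assms(3) by (simp add: part_mult_right_component)
  qed
  thus "lookup (vpart i (lmap s f)) c = lookup 0 c"
    by (simp add: lookup_lmap part_sum)
qed

text \<open>Because \<open>A 0 = k\<close>, the degree-0 part of \<open>free B\<close> is the space
  of scalar families on \<open>B\<close>; this identification reduces questions about minimal
  generators to linear algebra over \<open>k\<close>.\<close>

definition svec :: "nat set \<Rightarrow> (nat \<Rightarrow> 'k) \<Rightarrow> 'a vec" where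
  "svec B c = (\<Sum>b\<in>B. single b (scale (c b) 1))"

lemma svec_in: "svec B c \<in> free B" "svec B c \<in> Vec 0"
  by (auto simp: svec_def intro!: free_closed Vec_closed(4) Vec_single)

lemma lookup_svec: "finite B \<Longrightarrow> lookup (svec B c) b = (if b \<in> B then scale (c b) 1 else 0)"
  by (simp add: svec_def lookup_sum lookup_single when_def)

lemma lmap_svec: "lmap s (svec B c) = (\<Sum>b\<in>B. vscale (c b) (s b))"
  by (simp add: svec_def lmap_sum)

lemma svec_ex:
  assumes "finite B" "f \<in> free B" "f \<in> Vec 0"
  obtains c where "f = svec B c"
proof -
  have "\<forall>b. \<exists>c. lookup f b = scale c 1"
    using assms(3) by (auto simp: Vec_def component_zero)
  then obtain c where c: "\<And>b. lookup f b = scale (c b) 1" by metis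
  have "f = svec B c"
    using assms(2) by (intro poly_mapping_eqI) (auto simp: lookup_svec[OF assms(1)] c[symmetric] free_iff)
  thus thesis by (rule that)
qed

lemma svec_eq_0_iff:
  assumes "finite B"
  shows "svec B c = 0 \<longleftrightarrow> (\<forall>b\<in>B. c b = 0)"
proof
  assume 0: "svec B c = 0"
  have "scale (c b) 1 = 0" if "b \<in> B" for b
    using lookup_svec[OF assms, of c b] that by (simp add: 0)
  thus "\<forall>b\<in>B. c b = 0" by simp
qed (simp add: svec_def)

section \<open>Modules with linear syzygies\<close>

definition Syz :: "nat set \<Rightarrow> (nat \<Rightarrow> 'a vec) \<Rightarrow> 'a vec set" where
  "Syz B s = {f \<in> free B. lmap s f = 0}"

text \<open>
  \<open>lin K \<rho>\<close>: the submodule \<open>K\<close> of a free module with generators in degree \<open>0\<close> has a \<open>1\<close>-linear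
  resolution whose \<open>n\<close>-th free module has rank \<open>\<rho> n\<close>.
\<close>

coinductive lin :: "'a vec set \<Rightarrow> (nat \<Rightarrow> nat) \<Rightarrow> bool" where
  linI: "finite B \<Longrightarrow> \<rho> 0 = card B \<Longrightarrow> (\<And>b. b \<in> B \<Longrightarrow> s b \<in> Vec 1) \<Longrightarrow> K = lmap s ` free B \<Longrightarrow>
    lin (Syz B s) (\<lambda>n. \<rho> (Suc n)) \<Longrightarrow> lin K \<rho>"

text \<open>Generators of degree 1 produce nothing in degree 0, so a module with \<open>lin\<close>
  lies in \<open>\<mm>\<close> times the ambient free module. This is the source of
  minimality.\<close>

lemma lin_vpart:
  assumes "lin K \<rho>" "f \<in> K"
  shows "vpart 0 f = 0"
  using assms(1)
proof cases
  case (linI B s)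
  thus ?thesis using assms(2) vpart_lmap_low[of _ B s 1 0] by auto
qed

text \<open>A scalar relation between the generators \<open>s\<close> would be a syzygy of degree 0,
  which \<open>lin_vpart\<close> excludes.\<close>

lemma lin_independent:
  assumes "lin (Syz B s) \<rho>" "f \<in> free B" "f \<in> Vec 0" "lmap s f = 0"
  shows "f = 0"
  using lin_vpart[OF assms(1), of f] assms vpart_Vec[of f 0 0] by (simp add: Syz_def)

text \<open>\<open>\<iota>\<close> and \<open>h\<close> describe the maps of
  \<open>N' -> N -> N''\<close> on the ambient bases. Since \<open>N'\<close> injects into
  \<open>N\<close> in degree 1, exchange replaces the minimal generators of \<open>N\<close> by
  those of \<open>N'\<close> together with the \<open>s c\<close>, \<open>c\<close> in
  \<open>C\<close>; the latter generate the quotient, and \<open>free B\<close> splits into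
  \<open>free B'\<close> and \<open>free C\<close> with inclusion \<open>g\<close> (returned as
  \<open>\<iota>1\<close>) and projection \<open>p\<close> (returned as \<open>h1\<close>). The
  degree of \<open>h\<close> is left open because \<open>h\<close> will also be the family of
  generators of \<open>\<mm>\<^sup>a\<close>, of degree \<open>a\<close>.\<close>

lemma short_exact_step:
  assumes N': "lin N' \<rho>'" and N: "lin N \<rho>"
    and inj: "\<And>x. x \<in> N' \<Longrightarrow> lmap \<iota> x = 0 \<Longrightarrow> x = 0"
    and ker: "lmap \<iota> ` N' = {x \<in> N. lmap h x = 0}"
    and \<iota>0: "\<And>b. \<iota> b \<in> Vec 0"
  obtains C t \<iota>1 h1 M' M where
    "finite C" "\<rho> 0 = \<rho>' 0 + card C" "\<And>c. c \<in> C \<Longrightarrow> \<exists>x\<in>N \<inter> Vec 1. t c = lmap h x"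
    "lmap h ` N = lmap t ` free C"
    "lin M' (\<lambda>n. \<rho>' (Suc n))" "lin M (\<lambda>n. \<rho> (Suc n))"
    "\<And>x. x \<in> M' \<Longrightarrow> lmap \<iota>1 x = 0 \<Longrightarrow> x = 0"
    "lmap \<iota>1 ` M' = {x \<in> M. lmap h1 x = 0}" "lmap h1 ` M = Syz C t"
    "\<And>b. \<iota>1 b \<in> Vec 0" "\<And>b. h1 b \<in> Vec 0"
proof -
  from N' obtain B' s' where B': "finite B'" "\<rho>' 0 = card B'" "\<And>b. b \<in> B' \<Longrightarrow> s' b \<in> Vec 1"
    "N' = lmap s' ` free B'" "lin (Syz B' s') (\<lambda>n. \<rho>' (Suc n))"
    by cases blast
  from N obtain B s where B: "finite B" "\<rho> 0 = card B" "\<And>b. b \<in> B \<Longrightarrow> s b \<in> Vec 1"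
    "N = lmap s ` free B" "lin (Syz B s) (\<lambda>n. \<rho> (Suc n))"
    by cases blast
  have sN: "s b \<in> N" if "b \<in> B" for b
    unfolding B(4) by (rule image_eqI[of _ _ "single b 1"]) (use that in auto)
  have sN': "s' b \<in> N'" if "b \<in> B'" for b
    unfolding B'(4) by (rule image_eqI[of _ _ "single b 1"]) (use that in auto)
  define u where "u = (\<lambda>b. lmap \<iota> (s' b))"
  have lcu: "lmap u x = lmap \<iota> (lmap s' x)" for x
    by (simp add: lmap_lmap u_def)
  have uV: "u b \<in> Vec 1" if "b \<in> B'" for b
    using lmap_in_Vec[of "s' b" 1 UNIV \<iota> 0] B'(3)[OF that] \<iota>0 by (simp add: u_def free_def)
  have uN: "u b \<in> N" if "b \<in> B'" for b
    using ker sN'[OF that] by (auto simp: u_def)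
  have hu: "lmap h (lmap u x) = 0" if "x \<in> free B'" for x
    using ker that by (auto simp: lcu B'(4))

  have "\<exists>g. g \<in> free B \<and> g \<in> Vec 0 \<and> lmap s g = u b'" if b': "b' \<in> B'" for b'
  proof -
    obtain f where f: "f \<in> free B" "u b' = lmap s f"
      using uN[OF b'] B(4) by auto
    \<comment> \<open>\<open>u b'\<close> and the \<open>s b\<close> all have degree 1, so the
      scalar part of a lift is again a lift.\<close>
    have "lmap s (vpart 0 f) = u b'"
      using vpart_lmap[of f B s 1 0] f B(3) vpart_Vec[OF uV[OF b'], of 1] by simp
    thus ?thesis using vpart_free[OF f(1)] vpart_in_Vec by blast
  qed
  then obtain g0 where g0: "\<And>b'. b' \<in> B' \<Longrightarrow> g0 b' \<in> free B \<and> g0 b' \<in> Vec 0 \<and> lmap s (g0 b') = u b'"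
    by metis
  \<comment> \<open>The value 0 off \<open>B'\<close> keeps \<open>g b\<close> in
    \<open>Vec 0\<close> for every index, as the conclusion demands of
    \<open>\<iota>1\<close>.\<close>
  define g where "g = (\<lambda>b. if b \<in> B' then g0 b else 0)"
  have g: "g b \<in> free B" "g b \<in> Vec 0" for b
    using g0 by (auto simp: g_def)
  have sg: "lmap s (g b) = u b" if "b \<in> B'" for b
    using g0 that by (simp add: g_def)

  have s_ind: "inj_on s B \<and> V.independent (s ` B)"
    unfolding V.independent_family_iff[OF B(1)] lmap_svec[symmetric]
    using lin_independent[OF B(5) svec_in] svec_eq_0_iff[OF B(1)] by blast
  have u_ind: "inj_on u B' \<and> V.independent (u ` B')"
    unfolding V.independent_family_iff[OF B'(1)] lmap_svec[symmetric]
  proof (intro allI impI)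
    fix c assume "lmap u (svec B' c) = 0"
    hence "lmap s' (svec B' c) = 0"
      using svec_in(1)[of B' c] by - (rule inj, auto simp: lcu B'(4))
    thus "\<forall>i\<in>B'. c i = 0"
      using lin_independent[OF B'(5) svec_in] svec_eq_0_iff[OF B'(1)] by blast
  qed
  have us: "u ` B' \<subseteq> V.span (s ` B)"
  proof clarify
    fix b assume "b \<in> B'"
    then obtain c where "u b = lmap s (svec B c)"
      using svec_ex[OF B(1) g[of b]] sg by metis
    thus "u b \<in> V.span (s ` B)"
      unfolding V.span_family[OF B(1)] lmap_svec by blast
  qed
  obtain C where C: "C \<subseteq> B" "card B = card B' + card C"
    and ind0: "\<And>c d. (\<Sum>i\<in>B'. vscale (c i) (u i)) +
        (\<Sum>j\<in>C. vscale (d j) (s j)) = 0 \<Longrightarrow> (\<forall>i\<in>B'. c i = 0) \<and> (\<forall>j\<in>C. d j = 0)"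
    and spn0: "\<And>j. j \<in> B \<Longrightarrow> \<exists>c d. s j = (\<Sum>i\<in>B'. vscale (c i) (u i)) +
        (\<Sum>j\<in>C. vscale (d j) (s j))"
    by (rule V.exchange_family[OF B'(1) B(1) conjunct1[OF u_ind] conjunct2[OF u_ind]
          conjunct1[OF s_ind] conjunct2[OF s_ind] us]) (rule that)
  note ind = ind0[folded lmap_svec] and spn = spn0[folded lmap_svec]
  have finC: "finite C"
    using C(1) B(1) finite_subset by blast
  have joint: "x = 0 \<and> y = 0" if x: "x \<in> free B'" "x \<in> Vec 0" and y: "y \<in> free C" "y \<in> Vec 0"
    and 0: "lmap u x + lmap s y = 0" for x y
  proof -
    obtain c d where "x = svec B' c" "y = svec C d"
      using svec_ex[OF B'(1) x] svec_ex[OF finC y] by metis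
    thus ?thesis using ind 0 svec_eq_0_iff B'(1) finC by blast
  qed
  from spn obtain c d where cd: "\<And>j. j \<in> B \<Longrightarrow> s j = lmap u (svec B' (c j)) + lmap s (svec C (d j))"
    by metis
  \<comment> \<open>Coordinates of the old generators in the new basis: \<open>q\<close> collects
    those along \<open>u\<close>, \<open>p\<close> those along the retained
    \<open>s c\<close>.\<close>
  define q where "q = (\<lambda>b. if b \<in> B then svec B' (c b) else 0)"
  define p where "p = (\<lambda>b. if b \<in> B then svec C (d b) else 0)"
  have q: "q b \<in> free B'" "q b \<in> Vec 0" and p: "p b \<in> free C" "p b \<in> Vec 0" for b
    by (auto simp: q_def p_def svec_in)
  have sqp: "lmap s f = lmap u (lmap q f) + lmap s (lmap p f)" if "f \<in> free B" for f
  proof -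
    have "lmap s f = lmap (\<lambda>b. lmap u (q b) + lmap s (p b)) f"
      using that by (intro lmap_cong[of B]) (auto simp: cd q_def p_def)
    thus ?thesis by (simp add: lmap_family_add lmap_lmap)
  qed
  have lc0: "lmap r x \<in> free E" "x \<in> Vec 0 \<Longrightarrow> lmap r x \<in> Vec 0"
    if "\<And>b. r b \<in> free E" "\<And>b. r b \<in> Vec 0" for r x E
    using lmap_in_free[of UNIV r E x] lmap_in_Vec[of x 0 UNIV r 0] that by (auto simp: free_def)
  note lcq = lc0[of q, OF q] and lcp = lc0[of p, OF p] and lcg = lc0[of g, OF g]
  have CB: "f \<in> free B" if "f \<in> free C" for f
    using that C(1) by (auto simp: free_def)

  \<comment> \<open>The splitting of \<open>free B\<close>: uniqueness of coordinates
    (\<open>joint\<close>) gives \<open>q g = 1\<close> and \<open>p g = 0\<close>, then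
    \<open>p = 1\<close> on \<open>C\<close>; finally \<open>g q + p = 1\<close> by minimality of
    \<open>s\<close>.\<close>
  have lqg: "lmap q (g b) = single b 1" "lmap p (g b) = 0" if "b \<in> B'" for b
  proof -
    have "lmap u (lmap q (g b) - single b 1) + lmap s (lmap p (g b)) = 0"
      using sqp[OF g(1)[of b]] sg[OF that] by (simp add: lmap_diff)
    hence "lmap q (g b) - single b 1 = 0 \<and> lmap p (g b) = 0"
      using that by - (rule joint, auto intro!: free_closed(2) Vec_closed(2) lcq lcp Vec_single simp: g)
    thus "lmap q (g b) = single b 1" "lmap p (g b) = 0" by auto
  qed
  have pC: "p b = single b 1" if "b \<in> C" for b
  proof -
    have "b \<in> B" using that C by auto
    hence "lmap u (q b) + lmap s (p b - single b 1) = 0"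
      using sqp[of "single b 1"] by (simp add: lmap_diff)
    hence "q b = 0 \<and> p b - single b 1 = 0"
      using that by - (rule joint, auto intro!: free_closed(2) Vec_closed(2) q p Vec_single)
    thus ?thesis by auto
  qed
  have gqp: "lmap g (q b) + p b = single b 1" if "b \<in> B" for b
  proof -
    have "lmap s (lmap g (q b)) = lmap u (q b)"
      unfolding lmap_lmap by (rule lmap_cong[of B']) (auto simp: sg q)
    moreover have "s b = lmap u (q b) + lmap s (p b)"
      using sqp[of "single b 1"] that by simp
    ultimately have "lmap s (lmap g (q b) + p b - single b 1) = 0"
      by (simp add: lmap_diff lmap_add)
    hence "lmap g (q b) + p b - single b 1 = 0"
      using that by - (rule lin_independent[OF B(5)],
        auto intro!: free_closed(1,2) Vec_closed(1,2) lcg q p(2) CB[OF p(1)] Vec_single)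
    thus ?thesis by simp
  qed
  have lsg: "lmap s (lmap g x) = lmap u x" if "x \<in> free B'" for x
    unfolding lmap_lmap by (rule lmap_cong[OF _ that]) (rule sg)
  have lpg: "lmap p (lmap g x) = 0" if "x \<in> free B'" for x
  proof -
    have "lmap p (lmap g x) = lmap (\<lambda>_. 0) x"
      unfolding lmap_lmap by (rule lmap_cong[OF _ that]) (rule lqg(2))
    thus ?thesis by simp
  qed
  have lqg': "lmap q (lmap g x) = x" if "x \<in> free B'" for x
  proof -
    have "lmap q (lmap g x) = lmap (\<lambda>b. single b 1) x"
      unfolding lmap_lmap by (rule lmap_cong[OF _ that]) (rule lqg(1))
    thus ?thesis by simp
  qed
  have lp: "lmap p f = f" if "f \<in> free C" for f
  proof -
    have "lmap p f = lmap (\<lambda>b. single b 1) f"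
      by (rule lmap_cong[OF _ that]) (rule pC)
    thus ?thesis by simp
  qed
  define t where "t = (\<lambda>c. lmap h (s c))"
  have lt: "lmap t f = lmap h (lmap s f)" for f
    by (simp add: t_def lmap_lmap)

  show thesis
  proof (rule that[of C t "Syz B' s'" "Syz B s" g p])
    show "finite C" "\<rho> 0 = \<rho>' 0 + card C" "lin (Syz B' s') (\<lambda>n. \<rho>' (Suc n))"
      "lin (Syz B s) (\<lambda>n. \<rho> (Suc n))" "\<And>b. g b \<in> Vec 0" "\<And>b. p b \<in> Vec 0"
      using finC B(2,5) B'(2,5) C(2) g p by auto
    show "\<exists>x\<in>N \<inter> Vec 1. t c = lmap h x" if "c \<in> C" for c
      using sN B(3) C(1) that by (auto simp: t_def)
    show "lmap h ` N = lmap t ` free C"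
    proof (intro equalityI subsetI)
      fix y assume "y \<in> lmap h ` N"
      then obtain f where f: "f \<in> free B" "y = lmap h (lmap s f)"
        using B(4) by auto
      hence "y = lmap t (lmap p f)"
        using sqp[OF f(1)] hu[OF lcq(1)] by (simp add: lmap_add lt)
      thus "y \<in> lmap t ` free C" using lcp by blast
    qed (use CB in \<open>auto simp: lt B(4)\<close>)
    show "x = 0" if "x \<in> Syz B' s'" "lmap g x = 0" for x
      using lqg'[of x] that by (simp add: Syz_def)
    show "lmap g ` Syz B' s' = {x \<in> Syz B s. lmap p x = 0}"
    proof (intro equalityI subsetI)
      fix f assume "f \<in> {x \<in> Syz B s. lmap p x = 0}"
      hence f: "f \<in> free B" "lmap s f = 0" "lmap p f = 0" by (auto simp: Syz_def)
      have "lmap (\<lambda>b. lmap g (q b) + p b) f = lmap (\<lambda>b. single b 1) f"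
        by (rule lmap_cong[OF _ f(1)]) (rule gqp)
      hence eq: "f = lmap g (lmap q f)"
        using f(3) by (simp add: lmap_family_add lmap_lmap)
      have "lmap \<iota> (lmap s' (lmap q f)) = 0"
        using lsg[OF lcq(1), of f] f(2) by (simp add: eq[symmetric] lcu)
      hence "lmap s' (lmap q f) = 0"
        using inj lcq(1) B'(4) by blast
      thus "f \<in> lmap g ` Syz B' s'"
        using eq lcq(1) by (auto simp: Syz_def)
    qed (auto simp: Syz_def lcg lsg lpg lcu)
    show "lmap p ` Syz B s = Syz C t"
    proof (intro equalityI subsetI)
      fix y assume "y \<in> lmap p ` Syz B s"
      then obtain f where f: "f \<in> free B" "lmap s f = 0" "y = lmap p f" by (auto simp: Syz_def)
      have "lmap s y = - lmap u (lmap q f)"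
        using sqp[OF f(1)] f by (simp add: eq_neg_iff_add_eq_0 add.commute)
      thus "y \<in> Syz C t"
        using f(3) lcp hu[OF lcq(1)] by (simp add: Syz_def lt lmap_uminus)
    next
      fix f assume "f \<in> Syz C t"
      hence f: "f \<in> free C" "lmap h (lmap s f) = 0" by (auto simp: Syz_def lt)
      \<comment> \<open>Exactness at \<open>N\<close> puts \<open>s f\<close> into the image of
        \<open>N'\<close>; subtracting the corresponding element \<open>g x\<close> turns
        \<open>f\<close> into a syzygy of \<open>s\<close> without changing its projection.\<close>
      have "lmap s f \<in> N"
        unfolding B(4) using CB[OF f(1)] by (rule imageI)
      hence "lmap s f \<in> lmap \<iota> ` N'"
        using f(2) by (simp add: ker)
      then obtain x where x: "x \<in> free B'" "lmap s f = lmap u x"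
        using B'(4) by (auto simp: lcu)
      have "f - lmap g x \<in> Syz B s"
        using x f CB by (auto simp: Syz_def lmap_diff lsg intro!: free_closed(2) lcg)
      moreover have "f = lmap p (f - lmap g x)"
        using x f by (simp add: lmap_diff lpg lp)
      ultimately show "f \<in> lmap p ` Syz B s" by blast
    qed
  qed
qed

text \<open>Coinduction over all quotients in short exact sequences of this kind:
  \<open>short_exact_step\<close> yields the generators and exhibits their syzygies as another such
  quotient. \<open>\<rho>''\<close> is fixed by an additive hypothesis because a difference of
  natural numbers would be truncated; \<open>lin_quotient_rank_le\<close> later supplies it.\<close>

lemma lin_quotient:
  assumes "lin N' \<rho>'" "lin N \<rho>"
    "\<And>x. x \<in> N' \<Longrightarrow> lmap \<iota> x = 0 \<Longrightarrow> x = 0"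
    "lmap \<iota> ` N' = {x \<in> N. lmap h x = 0}"
    "\<And>b. \<iota> b \<in> Vec 0" "\<And>b. h b \<in> Vec 0"
    "\<And>n. \<rho> n = \<rho>' n + \<rho>'' n"
  shows "lin (lmap h ` N) \<rho>''"
proof -
  define H where "H = (\<lambda>N' \<rho>' N \<rho> \<iota> h \<rho>''. lin N' \<rho>' \<and> lin N \<rho> \<and>
    (\<forall>x\<in>N'. lmap \<iota> x = 0 \<longrightarrow> x = 0) \<and> lmap \<iota> ` N' = {x \<in> N. lmap h x = 0} \<and>
    (\<forall>b. \<iota> b \<in> Vec 0) \<and> (\<forall>b. h b \<in> Vec 0) \<and> (\<forall>n. \<rho> n = \<rho>' n + \<rho>'' n))"
  define X where "X = (\<lambda>K \<rho>''. \<exists>N' \<rho>' N \<rho> \<iota> h. H N' \<rho>' N \<rho> \<iota> h \<rho>'' \<and> K = lmap h ` N)"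
  have XI: "X (lmap h ` N) \<rho>''" if "H N' \<rho>' N \<rho> \<iota> h \<rho>''" for N' \<rho>' N \<rho> \<iota> h \<rho>''
    unfolding X_def
    by (rule exI[of _ N'], rule exI[of _ \<rho>'], rule exI[of _ N], rule exI[of _ \<rho>],
        rule exI[of _ \<iota>], rule exI[of _ h]) (use that in simp)
  have "X (lmap h ` N) \<rho>''"
    by (rule XI[of N' \<rho>' N \<rho> \<iota>]) (use assms in \<open>simp add: H_def\<close>)
  thus ?thesis
  proof (rule lin.coinduct[of X])
    fix K \<rho>'' assume "X K \<rho>''"
    then obtain N' \<rho>' N \<rho> \<iota> h where H: "H N' \<rho>' N \<rho> \<iota> h \<rho>''" and K: "K = lmap h ` N"
      unfolding X_def by (elim exE conjE)
    from H have N: "lin N' \<rho>'" "lin N \<rho>"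
      and inj: "\<And>x. x \<in> N' \<Longrightarrow> lmap \<iota> x = 0 \<Longrightarrow> x = 0"
      and ker: "lmap \<iota> ` N' = {x \<in> N. lmap h x = 0}" and \<iota>0: "\<And>b. \<iota> b \<in> Vec 0"
      and h0: "\<And>b. h b \<in> Vec 0" and \<rho>: "\<And>n. \<rho> n = \<rho>' n + \<rho>'' n"
      by (simp_all add: H_def)
    obtain C t \<iota>1 h1 M' M where *:
      "finite C" "\<rho> 0 = \<rho>' 0 + card C" "\<And>c. c \<in> C \<Longrightarrow> \<exists>x\<in>N \<inter> Vec 1. t c = lmap h x"
      "lmap h ` N = lmap t ` free C"
      "lin M' (\<lambda>n. \<rho>' (Suc n))" "lin M (\<lambda>n. \<rho> (Suc n))"
      "\<And>x. x \<in> M' \<Longrightarrow> lmap \<iota>1 x = 0 \<Longrightarrow> x = 0"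
      "lmap \<iota>1 ` M' = {x \<in> M. lmap h1 x = 0}" "lmap h1 ` M = Syz C t"
      "\<And>b. \<iota>1 b \<in> Vec 0" "\<And>b. h1 b \<in> Vec 0"
      by (rule short_exact_step[OF N _ ker \<iota>0]) (erule (1) inj, rule that)
    have "X (Syz C t) (\<lambda>n. \<rho>'' (Suc n))"
      unfolding *(9)[symmetric] by (rule XI[of M' "\<lambda>n. \<rho>' (Suc n)" M "\<lambda>n. \<rho> (Suc n)" \<iota>1])
        (use *(5-11) \<rho> in \<open>simp add: H_def\<close>)
    moreover have "t b \<in> Vec 1" if "b \<in> C" for b
      using *(3)[OF that] lmap_in_Vec[of _ 1 UNIV h 0] h0 by (auto simp: free_def)
    moreover have "\<rho>'' 0 = card C"
      using *(2) \<rho>[of 0] by simp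
    ultimately show "\<exists>B \<rho> s K'. K = K' \<and> \<rho>'' = \<rho> \<and> finite B \<and> \<rho> 0 = card B \<and>
        (\<forall>b. b \<in> B \<longrightarrow> s b \<in> Vec 1) \<and> K' = lmap s ` free B \<and>
        (X (Syz B s) (\<lambda>n. \<rho> (Suc n)) \<or> lin (Syz B s) (\<lambda>n. \<rho> (Suc n)))"
      using *(1,4) K by blast
  qed
qed

section \<open>Direct sums of linear modules\<close>

lemma lin_zero: "lin {0} (\<lambda>_. 0)"
proof -
  define X where "X = (\<lambda>(K :: 'a vec set) (\<rho> :: nat \<Rightarrow> nat). K = {0} \<and> \<rho> = (\<lambda>_. 0))"
  have free0: "free {} = {0 :: 'a vec}"
    by (auto simp: free_def)
  have "X {0} (\<lambda>_. 0)" by (simp add: X_def)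
  thus ?thesis
  proof (rule lin.coinduct[of X])
    fix K \<rho> assume "X K \<rho>"
    thus "\<exists>B \<rho>' s K'. K = K' \<and> \<rho> = \<rho>' \<and> finite B \<and> \<rho>' 0 = card B \<and>
        (\<forall>b. b \<in> B \<longrightarrow> s b \<in> Vec 1) \<and> K' = lmap s ` free B \<and>
        (X (Syz B s) (\<lambda>n. \<rho>' (Suc n)) \<or> lin (Syz B s) (\<lambda>n. \<rho>' (Suc n)))"
      by (intro exI[of _ "{}"] exI[of _ \<rho>] exI[of _ "\<lambda>_. 0"] exI[of _ K])
        (auto simp: X_def free0 Syz_def)
  qed
qed

text \<open>The summands may live on the same ambient basis, so \<open>\<phi>\<close> and
  \<open>\<psi>\<close> first move them to independent positions. The syzygies of the sum are again
  a direct sum of this form, which closes the coinduction.\<close>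

lemma lin_direct_sum:
  assumes "lin K1 \<rho>1" "lin K2 \<rho>2" "\<And>b. \<phi> b \<in> Vec 0" "\<And>b. \<psi> b \<in> Vec 0"
    "\<And>x y. x \<in> K1 \<Longrightarrow> y \<in> K2 \<Longrightarrow> lmap \<phi> x + lmap \<psi> y = 0 \<Longrightarrow> x = 0 \<and> y = 0"
  shows "lin {lmap \<phi> x + lmap \<psi> y | x y. x \<in> K1 \<and> y \<in> K2} (\<lambda>n. \<rho>1 n + \<rho>2 n)"
proof -
  define H where "H = (\<lambda>K1 \<rho>1 K2 \<rho>2 \<phi> \<psi>. lin K1 \<rho>1 \<and> lin K2 \<rho>2 \<and>
     (\<forall>b. \<phi> b \<in> Vec 0) \<and> (\<forall>b. \<psi> b \<in> Vec 0) \<and>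
     (\<forall>x\<in>K1. \<forall>y\<in>K2. lmap \<phi> x + lmap \<psi> y = 0 \<longrightarrow> x = 0 \<and> y = 0))"
  define X where "X = (\<lambda>K \<rho>. \<exists>K1 \<rho>1 K2 \<rho>2 \<phi> \<psi>. H K1 \<rho>1 K2 \<rho>2 \<phi> \<psi> \<and>
     K = {lmap \<phi> x + lmap \<psi> y | x y. x \<in> K1 \<and> y \<in> K2} \<and> \<rho> = (\<lambda>n. \<rho>1 n + \<rho>2 n :: nat))"
  have XI: "X {lmap \<phi> x + lmap \<psi> y | x y. x \<in> K1 \<and> y \<in> K2} (\<lambda>n. \<rho>1 n + \<rho>2 n)"
    if "H K1 \<rho>1 K2 \<rho>2 \<phi> \<psi>" for K1 \<rho>1 K2 \<rho>2 \<phi> \<psi>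
    unfolding X_def
    by (rule exI[of _ K1], rule exI[of _ \<rho>1], rule exI[of _ K2], rule exI[of _ \<rho>2],
        rule exI[of _ \<phi>], rule exI[of _ \<psi>]) (use that in simp)
  have "X {lmap \<phi> x + lmap \<psi> y | x y. x \<in> K1 \<and> y \<in> K2} (\<lambda>n. \<rho>1 n + \<rho>2 n)"
    by (rule XI[of K1 \<rho>1 K2 \<rho>2 \<phi> \<psi>]) (use assms in \<open>simp add: H_def\<close>)
  thus ?thesis
  proof (rule lin.coinduct[of X])
    fix K \<rho> assume "X K \<rho>"
    then obtain K1 \<rho>1 K2 \<rho>2 \<phi> \<psi> where H: "H K1 \<rho>1 K2 \<rho>2 \<phi> \<psi>"
      and K: "K = {lmap \<phi> x + lmap \<psi> y | x y. x \<in> K1 \<and> y \<in> K2}" and \<rho>: "\<rho> = (\<lambda>n. \<rho>1 n + \<rho>2 n)"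
      unfolding X_def by (elim exE conjE)
    from H have K1: "lin K1 \<rho>1" and K2: "lin K2 \<rho>2"
      and \<phi>: "\<And>b. \<phi> b \<in> Vec 0" and \<psi>: "\<And>b. \<psi> b \<in> Vec 0"
      and inj: "\<And>x y. x \<in> K1 \<Longrightarrow> y \<in> K2 \<Longrightarrow> lmap \<phi> x + lmap \<psi> y = 0 \<Longrightarrow> x = 0 \<and> y = 0"
      by (simp_all add: H_def)
    from K1 obtain B1 s1 where B1: "finite B1" "\<rho>1 0 = card B1" "\<And>b. b \<in> B1 \<Longrightarrow> s1 b \<in> Vec 1"
      "K1 = lmap s1 ` free B1" "lin (Syz B1 s1) (\<lambda>n. \<rho>1 (Suc n))"
      by cases blast
    from K2 obtain B2 s2 where B2: "finite B2" "\<rho>2 0 = card B2" "\<And>b. b \<in> B2 \<Longrightarrow> s2 b \<in> Vec 1"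
      "K2 = lmap s2 ` free B2" "lin (Syz B2 s2) (\<lambda>n. \<rho>2 (Suc n))"
      by cases blast
    \<comment> \<open>Even and odd indices encode the disjoint union of the two bases;
      \<open>P\<close>, \<open>Q\<close> below are the inclusions and \<open>E\<close>,
      \<open>F\<close> the projections.\<close>
    define D where "D = (\<lambda>b. 2 * b) ` B1 \<union> (\<lambda>b. 2 * b + 1) ` B2"
    define t where "t = (\<lambda>d. if even d then lmap \<phi> (s1 (d div 2)) else lmap \<psi> (s2 (d div 2)))"
    define P Q :: "nat \<Rightarrow> 'a vec"
      where "P = (\<lambda>b. single (2 * b) 1)" and "Q = (\<lambda>b. single (2 * b + 1) 1)"
    define E F :: "nat \<Rightarrow> 'a vec" where "E = (\<lambda>d. if even d then single (d div 2) 1 else 0)"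
      and "F = (\<lambda>d. if even d then 0 else single (d div 2) 1)"
    have EF: "lmap E (lmap P x) = x" "lmap E (lmap Q x) = 0" "lmap F (lmap P x) = 0" "lmap F (lmap Q x) = x" for x
      by (simp_all add: lmap_lmap P_def Q_def E_def F_def)
    have dec: "f = lmap P (lmap E f) + lmap Q (lmap F f)" for f
    proof -
      have "lmap (\<lambda>d. lmap P (E d) + lmap Q (F d)) f = lmap (\<lambda>d. single d 1) f"
        by (intro lmap_cong[of UNIV]) (auto simp: P_def Q_def E_def F_def free_def)
      thus ?thesis by (simp add: lmap_family_add lmap_lmap)
    qed
    have tP: "lmap t (lmap P x) = lmap \<phi> (lmap s1 x)" and tQ: "lmap t (lmap Q x) = lmap \<psi> (lmap s2 x)" for x
      by (simp_all add: lmap_lmap P_def Q_def t_def)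
    have EB: "lmap E f \<in> free B1" and FB: "lmap F f \<in> free B2" if "f \<in> free D" for f
      using that by (auto intro!: lmap_in_free[of D] simp: D_def E_def F_def)
    have PB: "lmap P x \<in> free D" if "x \<in> free B1" for x
      using that by (auto intro!: lmap_in_free[of B1] simp: D_def P_def)
    have QB: "lmap Q x \<in> free D" if "x \<in> free B2" for x
      using that by (auto intro!: lmap_in_free[of B2] simp: D_def Q_def)
    have "finite D" using B1 B2 by (simp add: D_def)
    moreover have "\<rho> 0 = card D"
    proof -
      have "card D = card ((\<lambda>b. 2 * b) ` B1) + card ((\<lambda>b. 2 * b + 1) ` B2)"
        unfolding D_def using B1 B2 by (intro card_Un_disjoint) (auto, presburger)
      thus ?thesis using B1 B2 \<rho> by (simp add: card_image inj_on_def)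
    qed
    moreover have "t b \<in> Vec 1" if "b \<in> D" for b
    proof -
      have "lmap \<phi> x \<in> Vec 1" "lmap \<psi> x \<in> Vec 1" if "x \<in> Vec 1" for x
        using lmap_in_Vec[of x 1 UNIV \<phi> 0] lmap_in_Vec[of x 1 UNIV \<psi> 0] \<phi> \<psi> that by (auto simp: free_def)
      thus ?thesis using that B1(3) B2(3) by (auto simp: D_def t_def)
    qed
    moreover have "K = lmap t ` free D"
    proof (intro equalityI subsetI)
      fix z assume "z \<in> K"
      then obtain x y where "x \<in> free B1" "y \<in> free B2" "z = lmap t (lmap P x + lmap Q y)"
        unfolding K B1(4) B2(4) by (auto simp: lmap_add tP tQ)
      thus "z \<in> lmap t ` free D" by (auto intro!: imageI free_closed PB QB)
    next
      fix z assume "z \<in> lmap t ` free D"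
      then obtain f where f: "f \<in> free D" "z = lmap t (lmap P (lmap E f) + lmap Q (lmap F f))"
        using dec by auto
      hence "z = lmap \<phi> (lmap s1 (lmap E f)) + lmap \<psi> (lmap s2 (lmap F f))"
        by (simp add: lmap_add tP tQ)
      moreover have "lmap s1 (lmap E f) \<in> K1" "lmap s2 (lmap F f) \<in> K2"
        unfolding B1(4) B2(4) using EB[OF f(1)] FB[OF f(1)] by (auto intro: imageI)
      ultimately show "z \<in> K" unfolding K by blast
    qed
    moreover have "X (Syz D t) (\<lambda>n. \<rho> (Suc n))"
    proof -
      have OmD: "Syz D t = {lmap P x + lmap Q y | x y. x \<in> Syz B1 s1 \<and> y \<in> Syz B2 s2}"
      proof (intro equalityI subsetI)
        fix f assume "f \<in> Syz D t"
        hence f: "f \<in> free D" "lmap t f = 0" by (auto simp: Syz_def)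
        hence "lmap \<phi> (lmap s1 (lmap E f)) + lmap \<psi> (lmap s2 (lmap F f)) = 0"
          using dec[of f] by (metis lmap_add tP tQ)
        hence "lmap s1 (lmap E f) = 0 \<and> lmap s2 (lmap F f) = 0"
          using EB[OF f(1)] FB[OF f(1)] by - (rule inj, auto simp: B1(4) B2(4))
        hence "lmap E f \<in> Syz B1 s1 \<and> lmap F f \<in> Syz B2 s2"
          using EB[OF f(1)] FB[OF f(1)] by (simp add: Syz_def)
        thus "f \<in> {lmap P x + lmap Q y | x y. x \<in> Syz B1 s1 \<and> y \<in> Syz B2 s2}"
          using dec[of f] by blast
      qed (auto simp: Syz_def lmap_add tP tQ intro!: free_closed PB QB)
      have injPQ: "x = 0 \<and> y = 0" if "lmap P x + lmap Q y = 0" for x y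
        using arg_cong[OF that, of "lmap E"] arg_cong[OF that, of "lmap F"] by (simp add: lmap_add EF)
      have PQ0: "P b \<in> Vec 0" "Q b \<in> Vec 0" for b
        by (auto simp: P_def Q_def intro!: Vec_single)
      have "H (Syz B1 s1) (\<lambda>n. \<rho>1 (Suc n)) (Syz B2 s2) (\<lambda>n. \<rho>2 (Suc n)) P Q"
        unfolding H_def using B1(5) B2(5) PQ0 injPQ by (intro conjI ballI allI impI) blast+
      from XI[OF this] show ?thesis by (simp only: OmD \<rho>)
    qed
    ultimately show "\<exists>B \<rho>' s K'. K = K' \<and> \<rho> = \<rho>' \<and> finite B \<and> \<rho>' 0 = card B \<and>
        (\<forall>b. b \<in> B \<longrightarrow> s b \<in> Vec 1) \<and> K' = lmap s ` free B \<and>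
        (X (Syz B s) (\<lambda>n. \<rho>' (Suc n)) \<or> lin (Syz B s) (\<lambda>n. \<rho>' (Suc n)))"
      by blast
  qed
qed

text \<open>\<open>\<mm>\<close> times the free module, in closed form;
  \<open>ideal_times_free_module\<close> proves the agreement. On a one-element basis it is a copy
  of \<open>\<mm>\<close> itself.\<close>

definition mfree :: "nat set \<Rightarrow> 'a vec set" where
  "mfree B = {f \<in> free B. vpart 0 f = 0}"

lemma mfree_iff: "f \<in> mfree B \<longleftrightarrow> f \<in> free B \<and> (\<forall>b. part 0 (lookup f b) = 0)"
  by (auto simp: mfree_def poly_mapping_eq_iff fun_eq_iff)

text \<open>\<open>\<mm> \<otimes> k^B\<close> is a direct sum of \<open>card B\<close> copies of
  \<open>\<mm>\<close>, split off one basis element at a time.\<close>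

lemma lin_mfree:
  assumes "lin (mfree {b0}) \<omega>" "finite B"
  shows "lin (mfree B) (\<lambda>n. card B * \<omega> n)"
  using assms(2)
proof induction
  case empty
  have "mfree {} = {0}" by (auto simp: mfree_iff free_def)
  thus ?case using lin_zero by simp
next
  case (insert b B)
  let ?\<phi> = "\<lambda>_. single b 1 :: 'a vec" and ?\<psi> = "\<lambda>c. single c 1 :: 'a vec"
  have phi: "lmap ?\<phi> x = single b (lookup x b0)" if "x \<in> free {b0}" for x
    using that by (subst lmap_superset[of "{b0}"]) (auto simp: free_def)
  have "lin {lmap ?\<phi> x + lmap ?\<psi> y | x y. x \<in> mfree {b0} \<and> y \<in> mfree B} (\<lambda>n. \<omega> n + card B * \<omega> n)"
  proof (rule lin_direct_sum[OF assms(1) insert.IH])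
    fix x y assume xy: "x \<in> mfree {b0}" "y \<in> mfree B" "lmap ?\<phi> x + lmap ?\<psi> y = 0"
    hence x: "x \<in> free {b0}" and y: "lookup y b = 0"
      using insert.hyps by (auto simp: mfree_iff free_iff)
    have eq: "single b (lookup x b0) + y = 0"
      using xy(3) by (simp add: phi[OF x])
    have "lookup (single b (lookup x b0) + y) b = lookup x b0"
      by (simp add: lookup_add y)
    hence "lookup x b0 = 0" by (simp add: eq)
    hence "x = 0" using x by (intro poly_mapping_eqI) (auto simp: free_iff)
    thus "x = 0 \<and> y = 0" using eq by simp
  qed (auto intro: Vec_single)
  moreover have "{lmap ?\<phi> x + lmap ?\<psi> y | x y. x \<in> mfree {b0} \<and> y \<in> mfree B} = mfree (insert b B)"
  proof (intro equalityI subsetI)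
    fix z assume "z \<in> {lmap ?\<phi> x + lmap ?\<psi> y | x y. x \<in> mfree {b0} \<and> y \<in> mfree B}"
    then obtain x y where "x \<in> mfree {b0}" "y \<in> mfree B" "z = lmap ?\<phi> x + lmap ?\<psi> y" by blast
    thus "z \<in> mfree (insert b B)"
      using phi[of x] by (auto simp: mfree_iff free_iff lookup_add lookup_single when_def part_add)
  next
    fix z assume z: "z \<in> mfree (insert b B)"
    let ?x = "single b0 (lookup z b)" and ?y = "z - single b (lookup z b)"
    have "?x \<in> mfree {b0}" "?y \<in> mfree B"
      using z by (auto simp: mfree_iff free_iff lookup_minus lookup_single when_def part_diff)
    moreover have "z = lmap ?\<phi> ?x + lmap ?\<psi> ?y" by simp
    ultimately show "z \<in> {lmap ?\<phi> x + lmap ?\<psi> y | x y. x \<in> mfree {b0} \<and> y \<in> mfree B}" by blast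
  qed
  ultimately show ?case using insert.hyps by simp
qed

text \<open>Each unfolding of \<open>lin\<close> only asserts that a next basis exists; dependent
  choice fixes a coherent sequence. The shifted \<open>\<rho>\<close> records at stage
  \<open>n\<close> the ranks still to come.\<close>

lemma lin_resolution:
  assumes "lin K \<rho>"
  obtains B s where "\<And>n. finite (B n)" "\<And>n. card (B n) = \<rho> n"
    "\<And>n b. b \<in> B n \<Longrightarrow> s n b \<in> Vec 1" "K = lmap (s 0) ` free (B 0)"
    "\<And>n. Syz (B n) (s n) = lmap (s (Suc n)) ` free (B (Suc n))"
proof -
  define P where "P = (\<lambda>n (B, s). finite B \<and> card B = \<rho> n \<and> (\<forall>b\<in>B. s b \<in> Vec 1) \<and>
    (n = 0 \<longrightarrow> K = lmap s ` free B) \<and> lin (Syz B s) (\<lambda>m. \<rho> (Suc n + m)))"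
  have "\<exists>f. \<forall>n. P n (f n) \<and> Syz (fst (f n)) (snd (f n)) = lmap (snd (f (Suc n))) ` free (fst (f (Suc n)))"
  proof (rule dependent_nat_choice)
    from assms obtain B s where "finite B" "\<rho> 0 = card B" "\<And>b. b \<in> B \<Longrightarrow> s b \<in> Vec 1"
      "K = lmap s ` free B" "lin (Syz B s) (\<lambda>n. \<rho> (Suc n))"
      by cases blast
    thus "\<exists>x. P 0 x" by (intro exI[of _ "(B, s)"]) (auto simp: P_def)
  next
    fix x n assume "P n x"
    hence "lin (Syz (fst x) (snd x)) (\<lambda>m. \<rho> (Suc n + m))"
      by (auto simp: P_def)
    then obtain B s where "finite B" "\<rho> (Suc n + 0) = card B" "\<And>b. b \<in> B \<Longrightarrow> s b \<in> Vec 1"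
      "Syz (fst x) (snd x) = lmap s ` free B" "lin (Syz B s) (\<lambda>m. \<rho> (Suc n + Suc m))"
      by cases blast
    thus "\<exists>y. P (Suc n) y \<and> Syz (fst x) (snd x) = lmap (snd y) ` free (fst y)"
      by (intro exI[of _ "(B, s)"]) (auto simp: P_def)
  qed
  then obtain f where f: "\<And>n. P n (f n)"
    "\<And>n. Syz (fst (f n)) (snd (f n)) = lmap (snd (f (Suc n))) ` free (fst (f (Suc n)))"
    by blast
  show thesis
    by (rule that[of "\<lambda>n. fst (f n)" "\<lambda>n. snd (f n)"])
      (use f in \<open>auto simp: P_def case_prod_beta\<close>)
qed

lemma lin_of_resolution:
  assumes "\<And>n. finite (B n)" "\<And>n b. b \<in> B n \<Longrightarrow> s n b \<in> Vec 1"
    "\<And>n. Syz (B n) (s n) = lmap (s (Suc n)) ` free (B (Suc n))"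
  shows "lin (lmap (s 0) ` free (B 0)) (\<lambda>n. card (B n))"
proof -
  define X where "X = (\<lambda>K \<rho>. \<exists>n. K = lmap (s n) ` free (B n) \<and> \<rho> = (\<lambda>m. card (B (n + m))))"
  have "X (lmap (s 0) ` free (B 0)) (\<lambda>n. card (B n))"
    unfolding X_def by (rule exI[of _ 0]) simp
  thus ?thesis
  proof (rule lin.coinduct[of X])
    fix K \<rho> assume "X K \<rho>"
    then obtain n where n: "K = lmap (s n) ` free (B n)" "\<rho> = (\<lambda>m. card (B (n + m)))"
      unfolding X_def by blast
    have "X (Syz (B n) (s n)) (\<lambda>m. \<rho> (Suc m))"
      unfolding X_def using assms(3) n(2) by (intro exI[of _ "Suc n"]) auto
    thus "\<exists>B \<rho>' s K'. K = K' \<and> \<rho> = \<rho>' \<and> finite B \<and> \<rho>' 0 = card B \<and>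
        (\<forall>b. b \<in> B \<longrightarrow> s b \<in> Vec 1) \<and> K' = lmap s ` free B \<and>
        (X (Syz B s) (\<lambda>n. \<rho>' (Suc n)) \<or> lin (Syz B s) (\<lambda>n. \<rho>' (Suc n)))"
      using n assms(1,2) by (intro exI[of _ "B n"] exI[of _ \<rho>] exI[of _ "s n"] exI[of _ K]) auto
  qed
qed

text \<open>After \<open>n\<close> short exact steps the syzygies again form a short exact sequence,
  and there the generators of the submodule are counted among those of the module. This makes the
  differences of ranks in the induction on \<open>a\<close> genuine.\<close>

lemma lin_quotient_rank_le:
  assumes "lin N' \<rho>'" "lin N \<rho>"
    "\<And>x. x \<in> N' \<Longrightarrow> lmap \<iota> x = 0 \<Longrightarrow> x = 0"
    "lmap \<iota> ` N' = {x \<in> N. lmap h x = 0}"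
    "\<And>b. \<iota> b \<in> Vec 0"
  shows "\<rho>' n \<le> \<rho> n"
  using assms
proof (induction n arbitrary: N' \<rho>' N \<rho> \<iota> h)
  case 0
  obtain C where "\<rho> 0 = \<rho>' 0 + card (C :: nat set)"
    by (rule short_exact_step[OF 0(1,2) _ 0(4,5)]) (erule (1) 0(3), rule that)
  thus ?case by simp
next
  case (Suc n)
  obtain M' M \<iota>1 h1 where *:
      "lin M' (\<lambda>n. \<rho>' (Suc n))" "lin M (\<lambda>n. \<rho> (Suc n))"
      "\<And>x. x \<in> M' \<Longrightarrow> lmap \<iota>1 x = 0 \<Longrightarrow> x = 0"
      "lmap \<iota>1 ` M' = {x \<in> M. lmap h1 x = 0}" "\<And>b. \<iota>1 b \<in> Vec 0"
    by (rule short_exact_step[OF Suc(2,3) _ Suc(5,6)]) (erule (1) Suc(4), rule that)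
  show ?case by (rule Suc.IH[OF *])
qed

section \<open>Powers of the maximal ideal\<close>

text \<open>\<open>\<mm>\<^sup>a\<close> as a submodule of the free module of rank one on the index
  0, which makes its generators a family for \<open>lmap\<close>.\<close>

definition Ivec :: "nat \<Rightarrow> 'a vec set" where
  "Ivec a = {f \<in> free {0}. \<forall>i<a. part i (lookup f 0) = 0}"

text \<open>\<open>\<mm>\<close> times \<open>\<mm>\<^sup>a\<close> is the next power, read off from
  generators: a component of degree \<open>Suc j\<close> with \<open>a \<le> j\<close> is a sum of
  products \<open>v * z\<close> with \<open>v\<close> of degree 1, and a preimage of
  \<open>z\<close> multiplied by \<open>v\<close> has its coefficients in
  \<open>\<mm>\<close>.\<close>

lemma lmap_mfree_eq_Ivec:
  assumes t: "\<And>b. b \<in> B \<Longrightarrow> t b \<in> Vec a" "\<And>b. b \<in> B \<Longrightarrow> t b \<in> free {0}"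
    and gen: "lmap t ` free B = Ivec a"
  shows "lmap t ` mfree B = Ivec (Suc a)"
proof (intro equalityI subsetI)
  fix y assume "y \<in> lmap t ` mfree B"
  then obtain f where f: "f \<in> free B" "vpart 0 f = 0" "y = lmap t f"
    by (auto simp: mfree_def)
  have "vpart i y = 0" if "i < Suc a" for i
    using vpart_lmap[OF f(1) t(1), where i=0] vpart_lmap_low[OF f(1) t(1), where i=i] f that by (cases "i = a") auto
  hence "part i (lookup y 0) = 0" if "i < Suc a" for i
    using that by (metis lookup_vpart lookup_zero)
  moreover have "y \<in> free {0}"
    using lmap_in_free[OF t(2) f(1)] f(3) by simp
  ultimately show "y \<in> Ivec (Suc a)" by (simp add: Ivec_def)
next
  fix y assume y: "y \<in> Ivec (Suc a)"
  define x where "x = lookup y 0"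
  have yx: "y = single 0 x"
    using y by (intro poly_mapping_eqI) (auto simp: Ivec_def free_iff lookup_single when_def x_def)
  define Q where "Q = (\<lambda>z. single 0 z \<in> lmap t ` mfree B)"
  have Q0: "Q 0"
    unfolding Q_def by (rule image_eqI[of _ _ 0]) (auto simp: mfree_iff)
  have Qadd: "Q (z + z')" if "Q z" "Q z'" for z z'
  proof -
    from that obtain f f' where "f \<in> mfree B" "f' \<in> mfree B" "single 0 z = lmap t f" "single 0 z' = lmap t f'"
      unfolding Q_def by auto
    thus ?thesis unfolding Q_def single_add
      by (intro image_eqI[of _ _ "f + f'"]) (auto simp: lmap_add mfree_iff free_closed lookup_add part_add)
  qed
  have "Q (part i x)" for i
  proof (cases "i < Suc a")
    case True
    thus ?thesis using y Q0 by (simp add: Ivec_def x_def)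
  next
    case False
    then obtain j where i: "i = Suc j" "a \<le> j" by (cases i) auto
    have "part i x \<in> A (Suc j)" by (simp add: i)
    thus ?thesis
    proof (induction rule: component_Suc_induct)
      case (mult v z)
      hence "single 0 z \<in> Ivec a"
        using i by (auto simp: Ivec_def part_component)
      then obtain f where f: "f \<in> free B" "single 0 z = lmap t f"
        using gen by auto
      have "single 0 (v * z) = lmap t (free_scale v f)"
        using f(2) by (simp add: lmap_scale flip: free_scale_simps(5))
      moreover have "free_scale v f \<in> mfree B"
        using f(1) mult(1) by (auto simp: mfree_iff free_closed part_mult part_component)
      ultimately show ?case unfolding Q_def by blast
    qed (auto intro: Q0 Qadd)
  qed
  note Qpr = this
  have "Q (\<Sum>i\<in>S. part i x)" if "finite S" for S
    using that by induction (auto intro: Q0 Qadd Qpr)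
  hence "Q x" using part_props(2,3)[of x] by metis
  thus "y \<in> lmap t ` mfree B" by (simp add: Q_def yx)
qed

text \<open>In degree \<open>a\<close> only scalar combinations of the generators occur, so they
  span \<open>A a\<close>; minimality makes them independent.\<close>

lemma card_generators:
  assumes B: "finite B" and t: "\<And>b. b \<in> B \<Longrightarrow> t b \<in> Vec a"
    "\<And>b. b \<in> B \<Longrightarrow> t b \<in> free {0}" and gen: "lmap t ` free B = Ivec a" and lin: "lin (Syz B t) \<rho>"
  shows "card B = dim (A a)"
proof -
  define u where "u = (\<lambda>b. lookup (t b) 0)"
  have tu: "t b = single 0 (u b)" if "b \<in> B" for b
    using t(2)[OF that] by (intro poly_mapping_eqI) (auto simp: free_iff lookup_single when_def u_def)
  have lck: "lmap t (svec B c) = single 0 (\<Sum>b\<in>B. scale (c b) (u b))" for c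
  proof -
    have "lmap t (svec B c) = (\<Sum>b\<in>B. single 0 (scale (c b) (u b)))"
      unfolding lmap_svec by (intro sum.cong) (auto simp: tu)
    also have "\<dots> = single 0 (\<Sum>b\<in>B. scale (c b) (u b))"
      by (induction B rule: infinite_finite_induct) (auto simp: single_add)
    finally show ?thesis .
  qed
  have ind: "inj_on u B \<and> independent (u ` B)"
    unfolding independent_family_iff[OF B]
  proof (intro allI impI)
    fix c assume "(\<Sum>i\<in>B. scale (c i) (u i)) = 0"
    hence "svec B c = 0"
      using lin_independent[OF lin svec_in] by (simp add: lck)
    thus "\<forall>i\<in>B. c i = 0" using svec_eq_0_iff[OF B] by blast
  qed
  have "A a \<subseteq> span (u ` B)"
  proof
    fix x assume x: "x \<in> A a"
    hence "single 0 x \<in> Ivec a" by (auto simp: Ivec_def part_component)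
    then obtain f where f: "f \<in> free B" "single 0 x = lmap t f"
      using gen by auto
    have "lmap t (vpart 0 f) = vpart a (single 0 x)"
      using vpart_lmap[OF f(1) t(1), where i=0] f(2) by simp
    also have "\<dots> = single 0 x"
      using vpart_Vec[OF Vec_single[OF x]] by simp
    finally have hcf: "lmap t (vpart 0 f) = single 0 x" .
    obtain c where "vpart 0 f = svec B c"
      using svec_ex[OF B vpart_free[OF f(1)] vpart_in_Vec] by blast
    hence "single 0 (\<Sum>b\<in>B. scale (c b) (u b)) = (single 0 x :: 'a vec)"
      using hcf by (simp only: lck)
    hence "x = (\<Sum>b\<in>B. scale (c b) (u b))"
      by (metis lookup_single_eq)
    thus "x \<in> span (u ` B)" by (auto intro!: span_sum span_scale intro: span_base)
  qed
  moreover have "u ` B \<subseteq> A a" using t(1) by (auto simp: u_def Vec_def)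
  ultimately have "dim (A a) = card (u ` B)"
    using ind by (intro dim_unique) auto
  thus ?thesis using card_image ind by metis
qed

text \<open>The ranks in the linear resolution of \<open>\<mm>\<^sup>a\<close> in terms of the ranks \<open>w\<close> in that of \<open>k\<close>.\<close>

primrec power_rank :: "(nat \<Rightarrow> nat) \<Rightarrow> nat \<Rightarrow> nat \<Rightarrow> int" where
  "power_rank w 0 n = (if n = 0 then 1 else 0)"
| "power_rank w (Suc a) n = int (dim (A a)) * int (w (Suc n)) - power_rank w a (Suc n)"

text \<open>Each step of the recursion shifts \<open>n\<close> by one and flips the sign, so the
  term created at the \<open>i\<close>-th unrolling carries \<open>w (n + i)\<close> and
  \<open>A (Suc a - i)\<close>.\<close>

lemma power_rank_eq:
  "power_rank w (Suc a) n = (\<Sum>i=1..Suc a. (-1) ^ (i + 1) * int (w (n + i)) * int (dim (A (Suc a - i))))"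
proof (induction a arbitrary: n)
  case 0
  thus ?case by simp
next
  case (Suc a)
  have "power_rank w (Suc (Suc a)) n = int (dim (A (Suc a))) * int (w (Suc n)) -
      (\<Sum>i=1..Suc a. (-1) ^ (i + 1) * int (w (Suc n + i)) * int (dim (A (Suc a - i))))"
    by (subst power_rank.simps(2), subst Suc.IH) simp
  also have "\<dots> = (\<Sum>i=1..Suc (Suc a). (-1) ^ (i + 1) * int (w (n + i)) * int (dim (A (Suc (Suc a) - i))))"
    by (subst sum.atLeast_Suc_atMost, simp, subst sum.shift_bounds_cl_Suc_ivl)
      (simp add: sum_negf[symmetric])
  finally show ?case .
qed

text \<open>The generators \<open>t\<close> are kept apart from their syzygies because they have
  degree \<open>a\<close>, whereas \<open>lin\<close> knows only modules generated in degree 1. The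
  induction step is the sequence formed by \<open>Syz B t\<close>, \<open>mfree B\<close> and
  \<open>Ivec (Suc a)\<close>.\<close>

lemma max_ideal_power_linear:
  assumes \<omega>: "lin (mfree {b0}) \<omega>" and w: "w 0 = 1" "\<And>n. w (Suc n) = \<omega> n"
  shows "\<exists>B t \<rho>. finite B \<and> (\<forall>b\<in>B. t b \<in> Vec a \<and> t b \<in> free {0}) \<and> lmap t ` free B = Ivec a \<and>
    lin (Syz B t) \<rho> \<and> int (card B) = power_rank w a 0 \<and> (\<forall>n. int (\<rho> n) = power_rank w a (Suc n))"
proof (induction a)
  case 0
  let ?t = "\<lambda>b. single b 1 :: 'a vec"
  \<comment> \<open>The zeroth power is \<open>A\<close> itself, free on one generator and without
    syzygies.\<close>
  have "Syz {0} ?t = {0}" by (auto simp: Syz_def)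
  thus ?case
    by (intro exI[of _ "{0}"] exI[of _ ?t] exI[of _ "\<lambda>_. 0"])
      (auto simp: Ivec_def lin_zero simp del: single_one intro: Vec_single)
next
  case (Suc a)
  then obtain B t \<rho> where B: "finite B" and t: "\<And>b. b \<in> B \<Longrightarrow> t b \<in> Vec a"
      "\<And>b. b \<in> B \<Longrightarrow> t b \<in> free {0}" and gen: "lmap t ` free B = Ivec a" and lin: "lin (Syz B t) \<rho>"
      and rank: "int (card B) = power_rank w a 0" "\<And>n. int (\<rho> n) = power_rank w a (Suc n)"
    by metis
  let ?e = "\<lambda>b. single b 1 :: 'a vec"
  have mfree: "lin (mfree B) (\<lambda>n. card B * \<omega> n)"
    by (rule lin_mfree[OF \<omega> B])
  \<comment> \<open>The map \<open>\<iota>\<close> is the inclusion here: syzygies have no degree-0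
    part and hence lie in \<open>mfree B\<close>.\<close>
  have ker: "lmap ?e ` Syz B t = {x \<in> mfree B. lmap t x = 0}"
    using lin_vpart[OF lin] by (auto simp: Syz_def mfree_def)
  have e0: "?e b \<in> Vec 0" for b by (simp add: Vec_single)
  \<comment> \<open>The first step is taken by hand, since \<open>t\<close> has degree
    \<open>a\<close> and \<open>lin_quotient\<close> expects a map of degree 0. The induced map
    \<open>h1\<close> on syzygies has degree 0, and coinduction takes over there.\<close>
  obtain C t' \<iota>1 h1 M' M where *:
      "finite C" "card B * \<omega> 0 = \<rho> 0 + card C" "\<And>c. c \<in> C \<Longrightarrow> \<exists>x\<in>mfree B \<inter> Vec 1. t' c = lmap t x"
      "lmap t ` mfree B = lmap t' ` free C"
      "lin M' (\<lambda>n. \<rho> (Suc n))" "lin M (\<lambda>n. card B * \<omega> (Suc n))"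
      "\<And>x. x \<in> M' \<Longrightarrow> lmap \<iota>1 x = 0 \<Longrightarrow> x = 0"
      "lmap \<iota>1 ` M' = {x \<in> M. lmap h1 x = 0}" "lmap h1 ` M = Syz C t'"
      "\<And>b. \<iota>1 b \<in> Vec 0" "\<And>b. h1 b \<in> Vec 0"
    by (rule short_exact_step[OF lin mfree _ ker e0]) (simp, rule that)
  define \<rho>1 where "\<rho>1 = (\<lambda>n. card B * \<omega> (Suc n) - \<rho> (Suc n))"
  have \<rho>1: "card B * \<omega> (Suc n) = \<rho> (Suc n) + \<rho>1 n" for n
    using lin_quotient_rank_le[OF *(5,6,7,8,10), of n] by (simp add: \<rho>1_def)
  have "lin (lmap h1 ` M) \<rho>1"
    by (rule lin_quotient[OF *(5,6,7,8,10,11) \<rho>1])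
  hence "lin (Syz C t') \<rho>1" by (simp only: *(9))
  moreover have "t' c \<in> Vec (Suc a) \<and> t' c \<in> free {0}" if "c \<in> C" for c
  proof -
    obtain x where x: "x \<in> free B" "x \<in> Vec 1" "t' c = lmap t x"
      using *(3)[OF \<open>c \<in> C\<close>] by (auto simp: mfree_def)
    show ?thesis using lmap_in_Vec[OF x(2,1) t(1)] lmap_in_free[OF t(2) x(1)] x(3) by simp
  qed
  moreover have "lmap t' ` free C = Ivec (Suc a)"
    using lmap_mfree_eq_Ivec[OF t gen] *(4) by simp
  moreover have "int (card C) = power_rank w (Suc a) 0"
  proof -
    have "int (card B) * int (\<omega> 0) = int (\<rho> 0) + int (card C)"
      using *(2) by (metis of_nat_add of_nat_mult)
    thus ?thesis using rank w card_generators[OF B t gen lin] by simp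
  qed
  moreover have "int (\<rho>1 n) = power_rank w (Suc a) (Suc n)" for n
  proof -
    have "int (card B) * int (\<omega> (Suc n)) = int (\<rho> (Suc n)) + int (\<rho>1 n)"
      using \<rho>1[of n] by (metis of_nat_add of_nat_mult)
    thus ?thesis using rank w card_generators[OF B t gen lin] by simp
  qed
  ultimately show ?case using *(1) by blast
qed

section \<open>Graded free modules\<close>

definition fcomp :: "nat set \<Rightarrow> (nat \<Rightarrow> nat) \<Rightarrow> nat \<Rightarrow> 'a vec set" where
  "fcomp B dg j = {f \<in> free B. \<forall>b\<in>keys f. dg b \<le> j \<and> lookup f b \<in> A (j - dg b)}"

lemma free_module_simps [simp]:
  "carr (free_module A B dg) = free B" "zero_of (free_module A B dg) = 0"
  "add_of (free_module A B dg) = (+)" "act (free_module A B dg) = free_scale"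
  by (auto simp: free_module_def free_def)

lemma comp_free_module [simp]: "comp_of (free_module A B dg) j = fcomp B dg j"
proof -
  have "(\<exists>i. dg b + i = j \<and> x \<in> A i) \<longleftrightarrow> dg b \<le> j \<and> x \<in> A (j - dg b)" for b x
    by (auto simp: le_iff_add)
  thus ?thesis by (auto simp: free_module_def fcomp_def free_def)
qed

lemma fcomp_iff:
  "f \<in> fcomp B dg j \<longleftrightarrow>
     f \<in> free B \<and> (\<forall>b. if dg b \<le> j then lookup f b \<in> A (j - dg b) else lookup f b = 0)"
  by (auto simp: fcomp_def in_keys_iff)

lemma fcomp_closed:
  "0 \<in> fcomp B dg j"
  "f \<in> fcomp B dg j \<Longrightarrow> g \<in> fcomp B dg j \<Longrightarrow> f + g \<in> fcomp B dg j"
  "f \<in> fcomp B dg j \<Longrightarrow> g \<in> fcomp B dg j \<Longrightarrow> f - g \<in> fcomp B dg j"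
  "f \<in> fcomp B dg j \<Longrightarrow> f \<in> free B"
  by (auto simp: fcomp_iff free_closed lookup_add lookup_minus component_add component_diff
      split: if_splits)

lemma free_scale_in_fcomp:
  assumes f: "f \<in> fcomp B dg j" and r: "r \<in> A i"
  shows "free_scale r f \<in> fcomp B dg (i + j)"
proof -
  have "if dg b \<le> i + j then r * lookup f b \<in> A (i + j - dg b) else r * lookup f b = 0" for b
  proof (cases "dg b \<le> j")
    case True
    hence "lookup f b \<in> A (j - dg b)" using f by (auto simp: fcomp_iff)
    thus ?thesis using component_mult[OF r, of _ "j - dg b"] True by auto
  next
    case False
    hence "lookup f b = 0" using f by (auto simp: fcomp_iff)
    thus ?thesis by simp
  qed
  thus ?thesis using f by (auto simp: fcomp_iff free_closed)
qed

lemma fcomp_sum: "(\<And>x. x \<in> S \<Longrightarrow> h x \<in> fcomp B dg j) \<Longrightarrow> sum h S \<in> fcomp B dg j"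
  by (induction S rule: infinite_finite_induct) (auto intro: fcomp_closed)

lemma single_in_fcomp: "b \<in> B \<Longrightarrow> r \<in> A i \<Longrightarrow> single b r \<in> fcomp B dg (dg b + i)"
  by (auto simp: fcomp_iff lookup_single when_def)

lemma lmap_in_fcomp:
  assumes "f \<in> fcomp B dg j" "\<And>b. b \<in> B \<Longrightarrow> s b \<in> fcomp C dg' (dg b)"
  shows "lmap s f \<in> fcomp C dg' j"
  unfolding lmap_def
proof (rule fcomp_sum)
  fix b assume b: "b \<in> keys f"
  hence "b \<in> B" "dg b \<le> j" "lookup f b \<in> A (j - dg b)"
    using assms(1) by (auto simp: fcomp_def free_def)
  thus "free_scale (lookup f b) (s b) \<in> fcomp C dg' j"
    using free_scale_in_fcomp[OF assms(2)[of b], of "lookup f b" "j - dg b"] by simp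
qed

lemma mfree_closed:
  "0 \<in> mfree B"
  "f \<in> mfree B \<Longrightarrow> g \<in> mfree B \<Longrightarrow> f + g \<in> mfree B"
  "f \<in> mfree B \<Longrightarrow> g \<in> mfree B \<Longrightarrow> f - g \<in> mfree B"
  "f \<in> mfree B \<Longrightarrow> free_scale r f \<in> mfree B"
  "f \<in> free B \<Longrightarrow> part 0 r = 0 \<Longrightarrow> free_scale r f \<in> mfree B"
  "f \<in> mfree B \<Longrightarrow> f \<in> free B"
  by (auto simp: mfree_iff free_closed lookup_add lookup_minus part_add part_diff part_zero_mult)

lemma mfree_sum: "(\<And>x. x \<in> S \<Longrightarrow> h x \<in> mfree B) \<Longrightarrow> sum h S \<in> mfree B"
  by (induction S rule: infinite_finite_induct) (auto intro: mfree_closed)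

lemma lmap_in_mfree:
  "f \<in> mfree B \<Longrightarrow> (\<And>b. b \<in> B \<Longrightarrow> s b \<in> free C) \<Longrightarrow> lmap s f \<in> mfree C"
  unfolding lmap_def by (rule mfree_sum) (auto intro!: mfree_closed(5) simp: mfree_iff[of f] free_def)

lemma lmap_family_in_mfree:
  "f \<in> free B \<Longrightarrow> (\<And>b. b \<in> B \<Longrightarrow> s b \<in> mfree C) \<Longrightarrow> lmap s f \<in> mfree C"
  unfolding lmap_def by (rule mfree_sum) (auto intro!: mfree_closed(4) simp: free_def)

lemma sum_keys_single: "(\<Sum>b\<in>keys f. single b (lookup f b)) = (f :: 'a vec)"
  using lmap_basis[of f] by (simp only: lmap_def free_scale_simps mult_1_right)

lemma ideal_times_free_module:
  "ideal_times (irrelevant_ideal scale A) (free_module A B dg) = mfree B"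
proof -
  let ?M = "free_module A B dg"
  let ?S = "{act ?M r x | r x. r \<in> irrelevant_ideal scale A \<and> x \<in> carr ?M}"
  have "x \<in> mfree B" if "x \<in> submodule_generated ?M ?S" for x
    using that
    by induction (auto intro: mfree_closed simp: irrelevant_ideal_eq)
  moreover have "f \<in> submodule_generated ?M ?S" if f: "f \<in> mfree B" for f
  proof -
    have *: "single b (lookup f b) \<in> submodule_generated ?M ?S" if "b \<in> keys f" for b
    proof -
      have "single b (lookup f b) = act ?M (lookup f b) (single b 1)" by simp
      moreover have "lookup f b \<in> irrelevant_ideal scale A" "single b 1 \<in> carr ?M"
        using f that by (auto simp: irrelevant_ideal_eq mfree_iff free_def)
      ultimately show ?thesis by (intro gen_incl) blast
    qed
    have "(\<Sum>b\<in>S. single b (lookup f b)) \<in> submodule_generated ?M ?S" if "S \<subseteq> keys f" for S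
      using finite_subset[OF that finite_keys] that
    proof (induction S)
      case empty
      show ?case using gen_zero[of ?M ?S] by simp
    next
      case (insert b S)
      thus ?case using gen_add[of _ ?M ?S] * by simp
    qed
    from this[of "keys f"] show ?thesis by (simp add: sum_keys_single)
  qed
  ultimately show ?thesis unfolding ideal_times_def by blast
qed

text \<open>If \<open>dg b\<close> differs from \<open>d\<close>, the coordinate at \<open>b\<close>
  of everything generated in degree \<open>d\<close> has no scalar part, so the basis element
  \<open>b\<close> itself is missed.\<close>

lemma generated_in_degree_free_module:
  "generated_in_degree (free_module A B dg) d \<longleftrightarrow> (\<forall>b\<in>B. dg b = d)"
proof
  let ?M = "free_module A B dg"
  assume "generated_in_degree ?M d"
  hence gen: "submodule_generated ?M (fcomp B dg d) = free B"
    by (simp add: generated_in_degree_def)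
  show "\<forall>b\<in>B. dg b = d"
  proof (rule ballI, rule ccontr)
    fix b assume b: "b \<in> B" "dg b \<noteq> d"
    have "part 0 (lookup x b) = 0" if "x \<in> submodule_generated ?M (fcomp B dg d)" for x
      using that
    proof induction
      case (gen_incl s)
      hence "if dg b \<le> d then lookup s b \<in> A (d - dg b) else lookup s b = 0"
        unfolding fcomp_iff by blast
      thus ?case using b by (auto simp: part_component split: if_splits)
    qed (auto simp: lookup_add part_add part_zero_mult)
    from this[of "single b 1"] show False
      using gen b by (simp add: part_component[of _ 0])
  qed
next
  let ?M = "free_module A B dg"
  assume dg: "\<forall>b\<in>B. dg b = d"
  have sub: "x \<in> free B" if "x \<in> submodule_generated ?M (fcomp B dg d)" for x
    using that by induction (auto intro: free_closed fcomp_closed)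
  have "f \<in> submodule_generated ?M (fcomp B dg d)" if f: "f \<in> free B" for f
  proof -
    have *: "single b (lookup f b) \<in> submodule_generated ?M (fcomp B dg d)" if "b \<in> keys f" for b
    proof -
      have "b \<in> B" using f that by (auto simp: free_def)
      hence "single b 1 \<in> fcomp B dg d"
        using single_in_fcomp[of b B 1 0 dg] dg by simp
      from gen_act[OF gen_incl[OF this], of ?M "lookup f b"] show ?thesis by simp
    qed
    have "(\<Sum>b\<in>S. single b (lookup f b)) \<in> submodule_generated ?M (fcomp B dg d)" if "S \<subseteq> keys f" for S
      using finite_subset[OF that finite_keys] that
    proof (induction S)
      case empty
      show ?case using gen_zero[of ?M "fcomp B dg d"] by simp
    next
      case (insert b S)
      thus ?case using gen_add[of _ ?M "fcomp B dg d"] * by simp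
    qed
    from this[of "keys f"] show ?thesis by (simp add: sum_keys_single)
  qed
  with sub show "generated_in_degree ?M d"
    by (auto simp: generated_in_degree_def)
qed

text \<open>The maps of a \<open>resolution\<close> are arbitrary functions constrained only on
  carriers. There a differential is determined by its basis values, and from here on it is handled
  as \<open>lmap (dmap F n)\<close>.\<close>

lemma linear_eq_lmap:
  fixes h :: "'a vec \<Rightarrow> 'a vec"
  assumes add: "\<And>x y. x \<in> free B \<Longrightarrow> y \<in> free B \<Longrightarrow> h (x + y) = h x + h y"
    and act: "\<And>r x. x \<in> free B \<Longrightarrow> h (free_scale r x) = free_scale r (h x)"
    and f: "f \<in> free B"
  shows "h f = lmap (\<lambda>b. h (single b 1)) f"
proof -
  have h0: "h 0 = 0" using act[of 0 0] by simp
  have "h (\<Sum>b\<in>S. single b (lookup f b)) = (\<Sum>b\<in>S. free_scale (lookup f b) (h (single b 1)))"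
    if "S \<subseteq> keys f" for S
    using finite_subset[OF that finite_keys] that
  proof (induction S)
    case (insert b S)
    have "b \<in> B" "S \<subseteq> B" using insert.prems f by (auto simp: free_def)
    hence "(\<Sum>b\<in>S. single b (lookup f b)) \<in> free B" "single b 1 \<in> free B" "single b (lookup f b) \<in> free B"
      by (auto intro!: free_closed(5))
    moreover have "h (single b (lookup f b)) = free_scale (lookup f b) (h (single b 1))"
      using act[of "single b 1" "lookup f b"] \<open>b \<in> B\<close> by simp
    ultimately show ?case using insert by (simp add: add)
  qed (simp add: h0)
  from this[of "keys f"] show ?thesis by (simp add: sum_keys_single lmap_def)
qed

section \<open>Graded free resolutions\<close>

abbreviation rfree where "rfree F n \<equiv> free (basis F n)"
abbreviation rmfree where "rmfree F n \<equiv> mfree (basis F n)"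
abbreviation rcomp where "rcomp F n \<equiv> fcomp (basis F n) (bdeg F n)"

definition dmap :: "('a, 'm) resolution \<Rightarrow> nat \<Rightarrow> nat \<Rightarrow> 'a vec" where
  "dmap F n b = diff F n (single b 1)"

lemma resolutionD:
  assumes "graded_free_resolution A M F"
  shows diff_eq_lmap: "\<And>n x. x \<in> rfree F (Suc n) \<Longrightarrow> diff F n x = lmap (dmap F n) x"
    and dmap_in: "\<And>n b. b \<in> basis F (Suc n) \<Longrightarrow> dmap F n b \<in> rcomp F n (bdeg F (Suc n) b)"
    and aug_carr: "\<And>x. x \<in> rfree F 0 \<Longrightarrow> aug F x \<in> carr M"
    and aug_add: "\<And>x y. x \<in> rfree F 0 \<Longrightarrow> y \<in> rfree F 0 \<Longrightarrow>
      aug F (x + y) = add_of M (aug F x) (aug F y)"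
    and aug_act: "\<And>r x. x \<in> rfree F 0 \<Longrightarrow> aug F (free_scale r x) = act M r (aug F x)"
    and aug_comp: "\<And>j x. x \<in> rcomp F 0 j \<Longrightarrow> aug F x \<in> comp_of M j"
    and aug_surj: "aug F ` rfree F 0 = carr M"
    and aug_ker: "{x \<in> rfree F 0. aug F x = zero_of M} = lmap (dmap F 0) ` rfree F 1"
    and res_exact: "\<And>n. {x \<in> rfree F (Suc n). lmap (dmap F n) x = 0} =
      lmap (dmap F (Suc n)) ` rfree F (Suc (Suc n))"
proof -
  note * = assms[unfolded graded_free_resolution_def graded_hom_def res_module_def free_module_simps
      comp_free_module]
  show d: "diff F n x = lmap (dmap F n) x" if "x \<in> rfree F (Suc n)" for n x
    unfolding dmap_def using * that by (intro linear_eq_lmap[of "basis F (Suc n)"]) auto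
  show "dmap F n b \<in> rcomp F n (bdeg F (Suc n) b)" if "b \<in> basis F (Suc n)" for n b
    unfolding dmap_def using * single_in_fcomp[OF that one_in_component_zero, of "bdeg F (Suc n)"]
      fcomp_closed(4) by (simp add: that)
  show "\<And>x. x \<in> rfree F 0 \<Longrightarrow> aug F x \<in> carr M"
    "\<And>x y. x \<in> rfree F 0 \<Longrightarrow> y \<in> rfree F 0 \<Longrightarrow>
      aug F (x + y) = add_of M (aug F x) (aug F y)"
    "\<And>r x. x \<in> rfree F 0 \<Longrightarrow> aug F (free_scale r x) = act M r (aug F x)"
    "\<And>j x. x \<in> rcomp F 0 j \<Longrightarrow> aug F x \<in> comp_of M j"
    "aug F ` rfree F 0 = carr M"
    using * fcomp_closed(4) by auto
  have im: "diff F n ` rfree F (Suc n) = lmap (dmap F n) ` rfree F (Suc n)" for n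
    using d by (intro image_cong) auto
  show "{x \<in> rfree F 0. aug F x = zero_of M} = lmap (dmap F 0) ` rfree F 1"
    using * im[of 0] by simp
  have "{x \<in> rfree F (Suc n). diff F n x = 0} = {x \<in> rfree F (Suc n). lmap (dmap F n) x = 0}" for n
    using d by auto
  thus "{x \<in> rfree F (Suc n). lmap (dmap F n) x = 0} =
      lmap (dmap F (Suc n)) ` rfree F (Suc (Suc n))" for n
    using * im[of "Suc n"] by simp
qed

section \<open>Powers of \<open>\<mm>\<close> as an order filtration, and their cosets\<close>

definition Ipow :: "nat \<Rightarrow> 'a set" where
  "Ipow a = {x. \<forall>i<a. part i x = 0}"

lemma Ipow_closed:
  "0 \<in> Ipow a" "x \<in> Ipow a \<Longrightarrow> y \<in> Ipow a \<Longrightarrow> x + y \<in> Ipow a" "x \<in> Ipow a \<Longrightarrow> y \<in> Ipow a \<Longrightarrow> x - y \<in> Ipow a"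
  "x \<in> Ipow a \<Longrightarrow> r * x \<in> Ipow a" "x \<in> Ipow a \<Longrightarrow> - x \<in> Ipow a"
  by (auto simp: Ipow_def part_add part_diff part_mult part_uminus)

lemma coset_eq_iff: "x +o Ipow a = y +o Ipow a \<longleftrightarrow> x - y \<in> Ipow a"
proof
  assume "x +o Ipow a = y +o Ipow a"
  hence "x \<in> y +o Ipow a"
    using Ipow_closed(1)[of a] by (auto simp: elt_set_plus_def)
  thus "x - y \<in> Ipow a" by (auto simp: elt_set_plus_def)
next
  assume xy: "x - y \<in> Ipow a"
  show "x +o Ipow a = y +o Ipow a"
  proof (intro equalityI subsetI)
    fix z assume "z \<in> x +o Ipow a"
    then obtain w where "w \<in> Ipow a" "z = x + w" by (auto simp: elt_set_plus_def)
    hence "z = y + ((x - y) + w)" "(x - y) + w \<in> Ipow a"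
      using xy by (auto intro: Ipow_closed)
    thus "z \<in> y +o Ipow a" unfolding elt_set_plus_def by blast
  next
    fix z assume "z \<in> y +o Ipow a"
    then obtain w where "w \<in> Ipow a" "z = y + w" by (auto simp: elt_set_plus_def)
    hence "z = x + (w - (x - y))" "w - (x - y) \<in> Ipow a"
      using xy by (auto intro: Ipow_closed)
    thus "z \<in> x +o Ipow a" unfolding elt_set_plus_def by blast
  qed
qed

lemma coset_zero: "0 +o Ipow a = Ipow a"
  by (auto simp: elt_set_plus_def)

lemma coset_add: "(x +o Ipow a) + (y +o Ipow a) = (x + y) +o Ipow a"
proof (intro equalityI subsetI)
  fix z assume "z \<in> (x + y) +o Ipow a"
  then obtain w where "w \<in> Ipow a" "z = (x + w) + (y + 0)" by (auto simp: elt_set_plus_def algebra_simps)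
  thus "z \<in> (x +o Ipow a) + (y +o Ipow a)"
    unfolding elt_set_plus_def set_plus_def using Ipow_closed(1)[of a] by blast
next
  fix z assume "z \<in> (x +o Ipow a) + (y +o Ipow a)"
  then obtain v w where "v \<in> Ipow a" "w \<in> Ipow a" "z = (x + v) + (y + w)"
    unfolding elt_set_plus_def set_plus_def by blast
  hence "z = (x + y) + (v + w)" "v + w \<in> Ipow a"
    by (auto simp: algebra_simps intro: Ipow_closed)
  thus "z \<in> (x + y) +o Ipow a" unfolding elt_set_plus_def by blast
qed

lemma coset_act: "(*) r ` (x +o Ipow a) + Ipow a = (r * x) +o Ipow a"
proof (intro equalityI subsetI)
  fix z assume "z \<in> (r * x) +o Ipow a"
  then obtain w where "w \<in> Ipow a" "z = r * (x + 0) + w" by (auto simp: elt_set_plus_def)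
  thus "z \<in> (*) r ` (x +o Ipow a) + Ipow a"
    unfolding elt_set_plus_def set_plus_def using Ipow_closed(1)[of a] by blast
next
  fix z assume "z \<in> (*) r ` (x +o Ipow a) + Ipow a"
  then obtain v w where "v \<in> Ipow a" "w \<in> Ipow a" "z = r * (x + v) + w"
    unfolding elt_set_plus_def set_plus_def by blast
  hence "z = r * x + (r * v + w)" "r * v + w \<in> Ipow a"
    by (auto simp: algebra_simps intro: Ipow_closed)
  thus "z \<in> (r * x) +o Ipow a" unfolding elt_set_plus_def by blast
qed

lemma quotient_simps:
  "carr (quotient_module A (Ipow a)) = range (\<lambda>x. x +o Ipow a)"
  "zero_of (quotient_module A (Ipow a)) = Ipow a"
  "add_of (quotient_module A (Ipow a)) = (+)"
  "act (quotient_module A (Ipow a)) r (x +o Ipow a) = (r * x) +o Ipow a"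
  "comp_of (quotient_module A (Ipow a)) j = (\<lambda>x. x +o Ipow a) ` A j"
  by (auto simp: quotient_module_def coset_act)

lemma ideal_power_Ipow: "ideal_power A (irrelevant_ideal scale A) a = Ipow a"
  by (simp add: ideal_power_eq Ipow_def)

lemma irrelevant_ideal_Ipow: "irrelevant_ideal scale A = Ipow 1"
  by (simp add: irrelevant_ideal_eq Ipow_def)

text \<open>\<open>koszul\<close> does not ask for finite ranks. Minimal generators of degree 1 in a
  free module of finite rank are independent vectors in the span of the finitely many
  \<open>single c v\<close>, with \<open>v\<close> from a basis of \<open>A 1\<close>; this bounds
  every finite subset of \<open>B\<close>.\<close>

lemma finite_generators:
  assumes C: "finite C" and s: "\<And>b. b \<in> B \<Longrightarrow> s b \<in> Vec 1" "\<And>b. b \<in> B \<Longrightarrow> s b \<in> free C"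
    and ind: "\<And>f. f \<in> free B \<Longrightarrow> f \<in> Vec 0 \<Longrightarrow> lmap s f = 0 \<Longrightarrow> f = 0"
  shows "finite B"
proof -
  obtain T where T: "finite T" "span T = A 1"
    using component_basis[of 1] by metis
  define S where "S = (\<lambda>(c, v). single c v) ` (C \<times> T)"
  have fS: "finite S" using C T by (simp add: S_def)
  have single_in: "single c v \<in> V.span S" if "c \<in> C" "v \<in> A 1" for c v
  proof -
    have "v \<in> span T" using that T by simp
    thus ?thesis
    proof (induction rule: span_induct_alt)
      case base
      show ?case using V.span_zero by simp
    next
      case (step r x y)
      have "single c x \<in> V.span S"
        using step(1) that by (intro V.span_base) (auto simp: S_def)
      hence "vscale r (single c x) + single c y \<in> V.span S"
        by (intro V.span_add V.span_scale step)
      thus ?case by (simp add: single_add)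
    qed
  qed
  have sub: "s b \<in> V.span S" if "b \<in> B" for b
  proof -
    have "single c (lookup (s b) c) \<in> V.span S" if "c \<in> keys (s b)" for c
      using s[OF \<open>b \<in> B\<close>] that by (intro single_in) (auto simp: Vec_def free_def)
    hence "(\<Sum>c\<in>keys (s b). single c (lookup (s b) c)) \<in> V.span S"
      by (intro V.span_sum)
    thus ?thesis by (simp add: sum_keys_single)
  qed
  show "finite B"
  proof (rule conjunct1[OF finite_if_finite_subsets_card_bdd[of B "card S"]])
    fix D assume D: "D \<subseteq> B" "finite D"
    have "inj_on s D \<and> V.independent (s ` D)"
      unfolding V.independent_family_iff[OF D(2)] lmap_svec[symmetric]
    proof (intro allI impI)
      fix c assume "lmap s (svec D c) = 0"
      moreover have "svec D c \<in> free B" using svec_in(1)[of D c] D by (auto simp: free_def)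
      ultimately have "svec D c = 0" using ind svec_in(2) by blast
      thus "\<forall>i\<in>D. c i = 0" using svec_eq_0_iff[OF D(2)] by blast
    qed
    moreover have "s ` D \<subseteq> V.span S" using sub D by auto
    ultimately show "card D \<le> card S"
      using V.independent_span_bound[OF fS, of "s ` D"] card_image[of s D] by auto
  qed
qed

text \<open>Linearity puts all differentials in degree 1. The kernel of the augmentation is then
  generated in degree 1, so the degree-0 part of the first module injects into the one-dimensional
  \<open>A/\<mm>\<close>: there is exactly one generator \<open>b0\<close>, and the first boundaries
  are \<open>\<mm>\<close> times it.\<close>

lemma koszul_resolution:
  assumes "koszul scale A"
  obtains B s b0 where "\<And>n. finite (B n)" "B 0 = {b0}"
    "\<And>n b. b \<in> B (Suc n) \<Longrightarrow> s n b \<in> Vec 1" "\<And>n b. b \<in> B (Suc n) \<Longrightarrow> s n b \<in> free (B n)"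
    "lmap (s 0) ` free (B 1) = mfree {b0}"
    "\<And>n. Syz (B (Suc n)) (s n) = lmap (s (Suc n)) ` free (B (Suc (Suc n)))"
proof -
  from assms obtain F where F: "graded_free_resolution A (quotient_module A (Ipow 1)) F"
    and linear: "linear_resolution A 0 F"
    unfolding koszul_def irrelevant_ideal_Ipow by blast
  note R = resolutionD[OF F, unfolded quotient_simps]
  define B where "B = basis F"
  define s where "s = dmap F"
  have deg: "bdeg F n b = n" if "b \<in> B n" for n b
    using linear that unfolding linear_resolution_def res_module_def generated_in_degree_free_module B_def
    by auto
  have sfree: "s n b \<in> free (B n)" if "b \<in> B (Suc n)" for n b
    using R(2) fcomp_closed(4) that unfolding B_def s_def by blast
  have sV: "s n b \<in> Vec 1" if "b \<in> B (Suc n)" for n b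
  proof -
    have f: "s n b \<in> fcomp (B n) (bdeg F n) (Suc n)"
      using R(2)[of b n] that deg[OF that] by (simp add: B_def s_def)
    have "lookup (s n b) c \<in> A 1" for c
    proof (cases "c \<in> B n")
      case True
      thus ?thesis using f deg[OF True] by (auto simp: fcomp_iff dest!: spec[of _ c])
    next
      case False
      thus ?thesis using sfree[OF that] by (auto simp: free_iff)
    qed
    thus ?thesis by (simp add: Vec_def)
  qed
  have Syz: "Syz (B (Suc n)) (s n) = lmap (s (Suc n)) ` free (B (Suc (Suc n)))" for n
    using R(9)[of n] by (simp add: Syz_def B_def s_def)
  have ker0: "{x \<in> free (B 0). aug F x = Ipow 1} = lmap (s 0) ` free (B 1)"
    using R(8) by (simp add: B_def s_def)

  have "\<exists>c. aug F (single b 1) = scale c 1 +o Ipow 1" if "b \<in> B 0" for b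
  proof -
    have "aug F (single b 1) \<in> (\<lambda>x. x +o Ipow 1) ` A 0"
      using R(6)[OF single_in_fcomp[OF _ one_in_component_zero, of b]] that deg[OF that]
      by (simp add: B_def)
    thus ?thesis by (auto simp: component_zero)
  qed
  then obtain c where c: "\<And>b. b \<in> B 0 \<Longrightarrow> aug F (single b 1) = scale (c b) 1 +o Ipow 1"
    by metis
  have aug_single: "aug F (single b r) = (r * scale (c b) 1) +o Ipow 1" if "b \<in> B 0" for b r
    using R(5)[of "single b 1" r] that c[OF that] by (simp add: B_def quotient_simps)
  have ker_hc: "vpart 0 x = 0" if "x \<in> free (B 0)" "aug F x = Ipow 1" for x
  proof -
    have "x \<in> lmap (s 0) ` free (B 1)" using ker0 that by blast
    thus ?thesis using vpart_lmap_low[of _ "B 1" "s 0" 1 0] sV by auto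
  qed
  have c_ne: "c b \<noteq> 0" if "b \<in> B 0" for b
  proof
    assume "c b = 0"
    hence "aug F (single b 1) = Ipow 1" using c[OF that] coset_zero by simp
    hence "vpart 0 (single b 1) = 0" using ker_hc that by simp
    hence "lookup (single b (1 :: 'a)) b = lookup 0 b"
      using vpart_Vec[OF Vec_single[OF one_in_component_zero], of 0 b] by simp
    thus False by simp
  qed
  have unique: "b = b'" if "b \<in> B 0" "b' \<in> B 0" for b b'
  proof (rule ccontr)
    assume ne: "b \<noteq> b'"
    \<comment> \<open>This combination is mapped to zero, yet its coordinate at \<open>b\<close> is
      the nonzero scalar \<open>c b'\<close>.\<close>
    let ?x = "single b (scale (c b') 1) + single b' (scale (- c b) 1)"
    have "aug F ?x = (scale (c b') 1 * scale (c b) 1 + scale (- c b) 1 * scale (c b') 1) +o Ipow 1"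
      using R(4)[of "single b (scale (c b') 1)" "single b' (scale (- c b) 1)"] that
      by (simp add: aug_single coset_add B_def del: scale_minus_left)
    also have "\<dots> = Ipow 1" by (simp add: coset_zero mult.commute flip: scale_left_distrib)
    finally have "vpart 0 ?x = 0" using that by (intro ker_hc) (auto intro: free_closed)
    hence "lookup (vpart 0 ?x) b = 0" by simp
    hence "scale (c b') 1 = 0"
      using ne by (simp add: lookup_add lookup_single part_component[of _ 0])
    thus False using c_ne[OF that(2)] by simp
  qed
  \<comment> \<open>Otherwise \<open>A/\<mm>\<close> would be zero, that is, \<open>1\<close> would
    lie in \<open>\<mm>\<close>.\<close>
  have "B 0 \<noteq> {}"
  proof
    assume "B 0 = {}"
    hence "free (B 0) = {0 :: 'a vec}" by (auto simp: free_def)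
    moreover have "aug F 0 = Ipow 1"
    proof -
      have "lmap (s 0) 0 \<in> lmap (s 0) ` free (B 1)" by (rule imageI) simp
      thus ?thesis unfolding ker0[symmetric] by simp
    qed
    ultimately have "range (\<lambda>x. x +o Ipow 1) = {Ipow 1}"
      using R(7) by (simp add: B_def)
    hence "1 +o Ipow 1 = Ipow 1" by (metis rangeI singletonD)
    hence "1 +o Ipow 1 = 0 +o Ipow 1" by (simp only: coset_zero)
    hence "1 - 0 \<in> Ipow 1" unfolding coset_eq_iff .
    thus False by (simp add: Ipow_def part_component[of _ 0])
  qed
  then obtain b0 where "b0 \<in> B 0" by blast
  hence b0: "B 0 = {b0}" using unique by auto

  have "{x \<in> free {b0}. aug F x = Ipow 1} = mfree {b0}"
  proof (intro equalityI subsetI)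
    fix x assume x: "x \<in> mfree {b0}"
    hence xs: "x = single b0 (lookup x b0)"
      by (intro poly_mapping_eqI) (auto simp: mfree_iff free_iff lookup_single when_def)
    have "aug F x = (lookup x b0 * scale (c b0) 1) +o Ipow 1"
      using aug_single[of b0 "lookup x b0"] b0 xs by simp
    also have "\<dots> = 0 +o Ipow 1"
      using x by (subst coset_eq_iff) (simp add: Ipow_def mfree_iff part_zero_mult)
    finally show "x \<in> {x \<in> free {b0}. aug F x = Ipow 1}"
      using x by (simp add: coset_zero mfree_def)
  qed (use ker_hc b0 in \<open>auto simp: mfree_def\<close>)
  hence im0: "lmap (s 0) ` free (B 1) = mfree {b0}" using ker0 b0 by simp
  have fin: "finite (B n)" for n
  proof (induction n)
    case (Suc n)
    show ?case
    proof (rule finite_generators[OF Suc sV sfree])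
      fix f assume f: "f \<in> free (B (Suc n))" "f \<in> Vec 0" "lmap (s n) f = 0"
      hence "f \<in> lmap (s (Suc n)) ` free (B (Suc (Suc n)))" using Syz by (auto simp: Syz_def)
      hence "vpart 0 f = 0" using vpart_lmap_low[of _ "B (Suc (Suc n))" "s (Suc n)" 1 0] sV by auto
      thus "f = 0" using vpart_Vec[OF f(2), of 0] by simp
    qed
  qed (simp add: b0)
  show thesis
    by (rule that[OF fin b0 sV sfree im0 Syz])
qed

section \<open>Comparison of resolutions\<close>

lemma free_graded_induct [consumes 1, case_names zero add single]:
  assumes "x \<in> free B" "P 0" "\<And>x y. x \<in> free B \<Longrightarrow> y \<in> free B \<Longrightarrow> P x \<Longrightarrow> P y \<Longrightarrow> P (x + y)"
    "\<And>b r i. b \<in> B \<Longrightarrow> r \<in> A i \<Longrightarrow> P (single b r)"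
  shows "P x"
proof -
  have 1: "P (single b r)" if "b \<in> B" for b r
    by (induction r rule: graded_induct) (use assms(3,4) that in \<open>auto simp: single_add\<close>)
  have "P (\<Sum>b\<in>S. single b (lookup x b))" if "S \<subseteq> keys x" for S
    using finite_subset[OF that finite_keys] that
  proof (induction S)
    case (insert b S)
    have "b \<in> B" "S \<subseteq> B" using insert.prems assms(1) by (auto simp: free_def)
    thus ?case using insert by (auto intro!: assms(3) 1 free_closed(5))
  qed (simp add: assms(2))
  from this[of "keys x"] show ?thesis by (simp add: sum_keys_single)
qed

text \<open>The degree-\<open>j\<close> component of a family whose coordinate at \<open>b\<close>
  is shifted by \<open>dg b\<close>.\<close>

definition hpart :: "(nat \<Rightarrow> nat) \<Rightarrow> nat \<Rightarrow> (nat \<Rightarrow> 'a) \<Rightarrow> nat \<Rightarrow> 'a" where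
  "hpart dg j u b = (if dg b \<le> j then part (j - dg b) (u b) else 0)"

lemma hpart_component:
  assumes "\<And>b. if dg b \<le> i then u b \<in> A (i - dg b) else u b = 0"
  shows "hpart dg j u = (if i = j then u else (\<lambda>_. 0))"
proof (rule ext)
  fix b
  show "hpart dg j u b = (if i = j then u else (\<lambda>_. 0)) b"
    using assms[of b] by (cases "dg b \<le> i") (auto simp: hpart_def part_component)
qed

text \<open>The witness is the degree-\<open>j\<close> part of \<open>x\<close>, built by induction
  on \<open>x\<close>. The map is abstracted to a family-valued \<open>\<theta>\<close> so that one
  argument serves the differentials, through their coordinates, and the augmentation, through an
  embedding into \<open>A\<close>.\<close>

lemma homogeneous_preimage:
  fixes \<theta> :: "'a vec \<Rightarrow> nat \<Rightarrow> 'a"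
  assumes add: "\<And>x y. x \<in> free B \<Longrightarrow> y \<in> free B \<Longrightarrow> \<theta> (x + y) = (\<lambda>c. \<theta> x c + \<theta> y c)"
    and hom: "\<And>x i c. x \<in> fcomp B dg i \<Longrightarrow> if dg' c \<le> i then \<theta> x c \<in> A (i - dg' c) else \<theta> x c = 0"
    and x: "x \<in> free B"
  shows "\<exists>y\<in>fcomp B dg j. \<theta> y = hpart dg' j (\<theta> x)"
  using x
proof (induction rule: free_graded_induct)
  have "\<theta> 0 = (\<lambda>_. 0)"
    using add[of 0 0] by (auto simp: fun_eq_iff)
  hence 0: "\<theta> 0 = hpart dg' j (\<theta> 0)" "\<theta> 0 = (\<lambda>_. 0)"
    by (auto simp: fun_eq_iff hpart_def)
  {
    case zero
    show ?case using 0(1) fcomp_closed(1) by blast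
  next
    case (add x y)
    then obtain x' y' where xy: "x' \<in> fcomp B dg j" "y' \<in> fcomp B dg j"
      "\<theta> x' = hpart dg' j (\<theta> x)" "\<theta> y' = hpart dg' j (\<theta> y)" by blast
    have "\<theta> (x' + y') = hpart dg' j (\<theta> (x + y))"
      using xy add.hyps assms(1) fcomp_closed(4) by (auto simp: fun_eq_iff hpart_def part_add)
    thus ?case using xy fcomp_closed(2) by blast
  next
    case (single b r i)
    have "single b r \<in> fcomp B dg (dg b + i)"
      using single by (rule single_in_fcomp)
    moreover from hpart_component[OF hom[OF this], where j = j]
    have "hpart dg' j (\<theta> (single b r)) = (if dg b + i = j then \<theta> (single b r) else \<theta> 0)"
      using 0(2) by simp
    ultimately show ?case using fcomp_closed(1) by (cases "dg b + i = j") force+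
  }
qed

lemma lmap_homogeneous_preimage:
  assumes x: "x \<in> fcomp C dg' j" "x \<in> lmap s ` free B"
    and s: "\<And>b. b \<in> B \<Longrightarrow> s b \<in> fcomp C dg' (dg b)"
  shows "\<exists>y\<in>fcomp B dg j. lmap s y = x"
proof -
  obtain z where z: "z \<in> free B" "x = lmap s z" using x(2) by blast
  have "\<exists>y\<in>fcomp B dg j. lookup (lmap s y) = hpart dg' j (lookup (lmap s z))"
  proof (rule homogeneous_preimage[OF _ _ z(1)])
    show "if dg' c \<le> i then lookup (lmap s x) c \<in> A (i - dg' c) else lookup (lmap s x) c = 0"
      if "x \<in> fcomp B dg i" for x i c
      using lmap_in_fcomp[OF that s] by (simp add: fcomp_iff)
  qed (simp add: lmap_add lookup_add fun_eq_iff)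
  moreover have "hpart dg' j (lookup x) = lookup x"
    using x(1) hpart_component[of dg' j "lookup x" j] by (simp add: fcomp_iff)
  ultimately show ?thesis using z(2) by (metis poly_mapping_eqI)
qed

text \<open>
  A \<open>graded_module\<close> need not be the direct sum of its components. The following condition
  ensures it, so that homogeneous elements lift to homogeneous elements along augmentations.
\<close>

definition grading_embedding :: "('a, 'm) graded_module \<Rightarrow> ('m \<Rightarrow> 'a) \<Rightarrow> bool" where
  "grading_embedding M \<pi> \<longleftrightarrow> inj_on \<pi> (carr M) \<and>
     (\<forall>x\<in>carr M. \<forall>y\<in>carr M. \<pi> (add_of M x y) = \<pi> x + \<pi> y) \<and> (\<forall>j. \<forall>x\<in>comp_of M j. \<pi> x \<in> A j)"

lemma aug_homogeneous_preimage:
  assumes F: "graded_free_resolution A M F" and \<pi>: "grading_embedding M \<pi>"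
    and m: "m \<in> comp_of M j" "m \<in> carr M"
  shows "\<exists>y\<in>rcomp F 0 j. aug F y = m"
proof -
  note R = resolutionD[OF F]
  obtain z where z: "z \<in> rfree F 0" "m = aug F z"
    using R(7) m(2) by blast
  \<comment> \<open>The embedded augmentation as a constant family with shift 0.\<close>
  let ?\<theta> = "\<lambda>x (_::nat). \<pi> (aug F x)"
  have "\<exists>y\<in>rcomp F 0 j. ?\<theta> y = hpart (\<lambda>_. 0) j (?\<theta> z)"
    using \<pi> R(3,4,6) z(1) by (intro homogeneous_preimage) (auto simp: grading_embedding_def)
  moreover have "hpart (\<lambda>_. 0) j (?\<theta> z) = ?\<theta> z"
    using \<pi> m(1) unfolding z(2)
    by (auto simp: hpart_def grading_embedding_def fun_eq_iff intro!: part_component[THEN trans])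
  ultimately obtain y where y: "y \<in> rcomp F 0 j" "\<pi> (aug F y) = \<pi> m"
    using z(2) by (metis (no_types))
  moreover have "aug F y \<in> carr M"
    using R(3) fcomp_closed(4)[OF y(1)] by blast
  ultimately have "aug F y = m"
    using \<pi> m(2) by (auto simp: grading_embedding_def dest: inj_onD)
  thus ?thesis using y(1) by blast
qed

text \<open>The kernel of the map leaving the \<open>n\<close>-th module, with the augmentation at
  \<open>n = 0\<close>, so that the liftings below treat all stages alike.\<close>

definition cycles :: "('a, 'm) graded_module \<Rightarrow> ('a, 'm) resolution \<Rightarrow> nat \<Rightarrow> 'a vec set" where
  "cycles M F n = {x \<in> rfree F n. case n of 0 \<Rightarrow> aug F x = zero_of M | Suc m \<Rightarrow> lmap (dmap F m) x = 0}"

lemma cycles_eq: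
  assumes "graded_free_resolution A M F"
  shows "cycles M F n = lmap (dmap F n) ` rfree F (Suc n)"
  using resolutionD(8,9)[OF assms] by (cases n) (auto simp: cycles_def)

lemma cycles_Suc: "x \<in> cycles M F (Suc n) \<longleftrightarrow> x \<in> rfree F (Suc n) \<and> lmap (dmap F n) x = 0"
  by (simp add: cycles_def)

lemma dmap_in_cycles:
  assumes "graded_free_resolution A M F" "b \<in> basis F (Suc n)"
  shows "dmap F n b \<in> cycles M F n"
  unfolding cycles_eq[OF assms(1)] using assms(2) by (intro image_eqI[of _ _ "single b 1"]) auto

lemma cycles_preimage:
  assumes F: "graded_free_resolution A M F"
    and x: "x \<in> cycles M F n" "x \<in> rcomp F n j"
  shows "\<exists>y\<in>rcomp F (Suc n) j. lmap (dmap F n) y = x"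
  using x resolutionD(2)[OF F] by (intro lmap_homogeneous_preimage) (auto simp: cycles_eq[OF F])

text \<open>A \<open>graded_module\<close> comes without group laws. The difference is therefore
  expressed by \<open>add_of\<close> and the action of \<open>-1\<close>, \<open>aug F x\<close> is
  replaced by \<open>aug F y\<close>, and the result is read backwards as the image of
  \<open>y - y\<close>.\<close>

lemma aug_diff_eq_zero:
  assumes F: "graded_free_resolution A M F" and x: "x \<in> rfree F 0" "y \<in> rfree F 0"
    and eq: "aug F x = aug F y"
  shows "aug F (x - y) = zero_of M"
proof -
  note R = resolutionD[OF F]
  have 0: "aug F 0 = zero_of M"
  proof -
    have "lmap (dmap F 0) 0 \<in> lmap (dmap F 0) ` rfree F 1" by (rule imageI) simp
    thus ?thesis unfolding R(8)[symmetric] by simp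
  qed
  have "aug F (x - y) = aug F (x + free_scale (- 1) y)" by simp
  also have "\<dots> = add_of M (aug F y) (act M (- 1) (aug F y))"
    using x eq by (simp add: R(4,5) free_closed del: free_scale_uminus)
  also have "\<dots> = aug F (y + free_scale (- 1) y)"
    using x by (simp add: R(4,5) free_closed del: free_scale_uminus)
  also have "\<dots> = zero_of M" by (simp add: 0)
  finally show ?thesis .
qed

section \<open>Chain maps and homotopies between two resolutions\<close>

definition chain_map :: "('a, 'm) resolution \<Rightarrow> ('a, 'm) resolution \<Rightarrow> (nat \<Rightarrow> nat \<Rightarrow> 'a vec) \<Rightarrow> bool" where
  "chain_map F G \<phi> \<longleftrightarrow>
     (\<forall>n. \<forall>b\<in>basis F n. \<phi> n b \<in> rcomp G n (bdeg F n b)) \<and>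
     (\<forall>x\<in>rfree F 0. aug G (lmap (\<phi> 0) x) = aug F x) \<and>
     (\<forall>n. \<forall>x\<in>rfree F (Suc n). lmap (dmap G n) (lmap (\<phi> (Suc n)) x) = lmap (\<phi> n) (lmap (dmap F n) x))"

text \<open>The comparison theorem. The value at a basis element is a homogeneous preimage of a
  cycle, so the invariant carried from stage to stage is that cycles go to cycles.\<close>

lemma chain_map_exists:
  assumes F: "graded_free_resolution A M F" and G: "graded_free_resolution A M G"
    and \<pi>: "grading_embedding M \<pi>"
  obtains \<phi> where "chain_map F G \<phi>"
proof -
  note R = resolutionD[OF F] and S = resolutionD[OF G]
  define aok where "aok = (\<lambda>f. \<forall>x\<in>rfree F 0. aug G (lmap f x) = aug F x)"
  define P where "P = (\<lambda>n f. (\<forall>b\<in>basis F n. f b \<in> rcomp G n (bdeg F n b)) \<and>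
    (\<forall>x\<in>cycles M F n. lmap f x \<in> cycles M G n) \<and> (n = 0 \<longrightarrow> aok f))"
  define Q where "Q = (\<lambda>n f f'. \<forall>b\<in>basis F (Suc n). lmap (dmap G n) (f' b) = lmap f (dmap F n b))"
  have PfreeD: "lmap f x \<in> rfree G n" if "P n f" "x \<in> rfree F n" for n f x
    using that fcomp_closed(4) unfolding P_def by (intro lmap_in_free[of "basis F n"]) blast+
  have "\<exists>\<phi>. \<forall>n. P n (\<phi> n) \<and> Q n (\<phi> n) (\<phi> (Suc n))"
  proof (rule dependent_nat_choice)
    have "\<exists>y\<in>rcomp G 0 (bdeg F 0 b). aug G y = aug F (single b 1)"
      if "b \<in> basis F 0" for b
      using aug_homogeneous_preimage[OF G \<pi>] R(6)[OF single_in_fcomp[OF that one_in_component_zero]]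
        R(3)[of "single b 1"] that by simp
    then obtain f where f: "\<And>b. b \<in> basis F 0 \<Longrightarrow> f b \<in> rcomp G 0 (bdeg F 0 b)"
      "\<And>b. b \<in> basis F 0 \<Longrightarrow> aug G (f b) = aug F (single b 1)" by metis
    have ffree: "lmap f x \<in> rfree G 0" if "x \<in> rfree F 0" for x
      using f(1) fcomp_closed(4) by (intro lmap_in_free[OF _ that]) blast
    have aug0: "aug G (lmap f x) = aug F x" if "x \<in> rfree F 0" for x
      using that
    proof (induction rule: free_graded_induct)
      case zero
      have "aug F 0 = zero_of M" "aug G 0 = zero_of M"
        using aug_diff_eq_zero[OF F, of 0 0] aug_diff_eq_zero[OF G, of 0 0] by simp_all
      thus ?case by simp
    next
      case (add x y)
      thus ?case by (simp add: lmap_add R(4) S(4) ffree)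
    next
      case (single b r i)
      have "single b r = free_scale r (single b 1)" by simp
      moreover have "aug F (free_scale r (single b 1)) = act M r (aug F (single b 1))"
        using single by (intro R(5)) simp
      moreover have "aug G (free_scale r (f b)) = act M r (aug G (f b))"
        using fcomp_closed(4)[OF f(1)[OF single(1)]] by (rule S(5))
      ultimately show ?case using f(2)[OF single(1)] by simp
    qed
    have "P 0 f"
      using f aug0 ffree by (auto simp: P_def aok_def cycles_def)
    thus "\<exists>f. P 0 f" by blast
  next
    fix f n assume P: "P n f"
    have "\<exists>y\<in>rcomp G (Suc n) (bdeg F (Suc n) b). lmap (dmap G n) y = lmap f (dmap F n b)"
      if b: "b \<in> basis F (Suc n)" for b
    proof (rule cycles_preimage[OF G])
      show "lmap f (dmap F n b) \<in> cycles M G n"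
        using P dmap_in_cycles[OF F b] by (auto simp: P_def)
      show "lmap f (dmap F n b) \<in> rcomp G n (bdeg F (Suc n) b)"
        using lmap_in_fcomp[OF R(2)[OF b]] P by (auto simp: P_def)
    qed
    then obtain f' where f': "\<And>b. b \<in> basis F (Suc n) \<Longrightarrow>
        f' b \<in> rcomp G (Suc n) (bdeg F (Suc n) b)"
      "\<And>b. b \<in> basis F (Suc n) \<Longrightarrow> lmap (dmap G n) (f' b) = lmap f (dmap F n b)" by metis
    have "lmap (dmap G n) (lmap f' x) = lmap f (lmap (dmap F n) x)" if "x \<in> rfree F (Suc n)" for x
      unfolding lmap_lmap by (rule lmap_cong[OF _ that]) (rule f'(2))
    moreover have "lmap f' x \<in> rfree G (Suc n)" if "x \<in> rfree F (Suc n)" for x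
      using f'(1) fcomp_closed(4) by (intro lmap_in_free[OF _ that]) blast
    ultimately have "P (Suc n) f'"
      using f'(1) by (auto simp: P_def cycles_Suc)
    thus "\<exists>f'. P (Suc n) f' \<and> Q n f f'"
      using f'(2) by (auto simp: Q_def)
  qed
  then obtain \<phi> where \<phi>: "\<And>n. P n (\<phi> n)" "\<And>n. Q n (\<phi> n) (\<phi> (Suc n))" by blast
  have "chain_map F G \<phi>"
    unfolding chain_map_def
  proof (intro conjI allI ballI)
    show "\<phi> n b \<in> rcomp G n (bdeg F n b)" if "b \<in> basis F n" for n b
      using \<phi>(1)[of n] that by (auto simp: P_def)
    show "aug G (lmap (\<phi> 0) x) = aug F x" if "x \<in> rfree F 0" for x
      using \<phi>(1)[of 0] that by (auto simp: P_def aok_def)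
    show "lmap (dmap G n) (lmap (\<phi> (Suc n)) x) = lmap (\<phi> n) (lmap (dmap F n) x)"
      if "x \<in> rfree F (Suc n)" for n x
      unfolding lmap_lmap by (rule lmap_cong[OF _ that]) (use \<phi>(2)[of n] in \<open>auto simp: Q_def\<close>)
  qed
  thus thesis by (rule that)
qed

lemma chain_mapD:
  assumes "chain_map F G \<phi>"
  shows "\<And>n b. b \<in> basis F n \<Longrightarrow> \<phi> n b \<in> rcomp G n (bdeg F n b)"
    "\<And>n b. b \<in> basis F n \<Longrightarrow> \<phi> n b \<in> rfree G n"
    "\<And>x. x \<in> rfree F 0 \<Longrightarrow> aug G (lmap (\<phi> 0) x) = aug F x"
    "\<And>n x. x \<in> rfree F (Suc n) \<Longrightarrow> lmap (dmap G n) (lmap (\<phi> (Suc n)) x) = lmap (\<phi> n) (lmap (dmap F n) x)"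
    "\<And>n x. x \<in> rfree F n \<Longrightarrow> lmap (\<phi> n) x \<in> rfree G n"
    "\<And>n j x. x \<in> rcomp F n j \<Longrightarrow> lmap (\<phi> n) x \<in> rcomp G n j"
proof -
  show 1: "\<phi> n b \<in> rcomp G n (bdeg F n b)" if "b \<in> basis F n" for n b
    using assms that by (auto simp: chain_map_def)
  show 2: "\<phi> n b \<in> rfree G n" if "b \<in> basis F n" for n b
    using fcomp_closed(4)[OF 1[OF that]] .
  show "\<And>x. x \<in> rfree F 0 \<Longrightarrow> aug G (lmap (\<phi> 0) x) = aug F x"
    "\<And>n x. x \<in> rfree F (Suc n) \<Longrightarrow> lmap (dmap G n) (lmap (\<phi> (Suc n)) x) = lmap (\<phi> n) (lmap (dmap F n) x)"
    using assms by (auto simp: chain_map_def)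
  show "lmap (\<phi> n) x \<in> rfree G n" if "x \<in> rfree F n" for n x
    using lmap_in_free[OF 2 that] .
  show "lmap (\<phi> n) x \<in> rcomp G n j"
    if "x \<in> rcomp F n j" for n j x
    using lmap_in_fcomp[OF that 1] .
qed

text \<open>\<open>\<eta>\<close> is a homotopy from the identity of \<open>F\<close> to \<open>\<psi> \<circ> \<phi>\<close>.\<close>

lemma homotopy_exists:
  assumes F: "graded_free_resolution A M F"
    and \<phi>: "chain_map F G \<phi>" and \<psi>: "chain_map G F \<psi>"
  obtains \<eta> where
    "\<And>n b. b \<in> basis F n \<Longrightarrow> \<eta> n b \<in> rcomp F (Suc n) (bdeg F n b)"
    "\<And>x. x \<in> rfree F 0 \<Longrightarrow> x = lmap (\<psi> 0) (lmap (\<phi> 0) x) + lmap (dmap F 0) (lmap (\<eta> 0) x)"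
    "\<And>n x. x \<in> rfree F (Suc n) \<Longrightarrow> x = lmap (\<psi> (Suc n)) (lmap (\<phi> (Suc n)) x) +
       lmap (dmap F (Suc n)) (lmap (\<eta> (Suc n)) x) + lmap (\<eta> n) (lmap (dmap F n) x)"
proof -
  note R = resolutionD[OF F] and \<phi>D = chain_mapD[OF \<phi>] and \<psi>D = chain_mapD[OF \<psi>]
  define \<delta> where "\<delta> = (\<lambda>n b. single b 1 - lmap (\<psi> n) (\<phi> n b))"
  have lmap\<delta>: "lmap (\<delta> n) x = x - lmap (\<psi> n) (lmap (\<phi> n) x)" for n x
    by (simp add: \<delta>_def lmap_family_diff lmap_lmap)
  have \<delta>in: "\<delta> n b \<in> rcomp F n (bdeg F n b)" if "b \<in> basis F n" for n b
    unfolding \<delta>_def using single_in_fcomp[OF that one_in_component_zero, of "bdeg F n"]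
    by (intro fcomp_closed(3) \<psi>D(6) \<phi>D(1) that) simp
  have chain: "lmap (dmap F n) (lmap (\<delta> (Suc n)) x) = lmap (\<delta> n) (lmap (dmap F n) x)"
    if "x \<in> rfree F (Suc n)" for n x
    using that by (simp add: lmap\<delta> lmap_diff \<psi>D(4) \<phi>D(4,5))
  \<comment> \<open>That \<open>\<eta>\<close> lifts \<open>\<delta>\<close> on cycles is the
    invariant that makes \<open>\<delta> - \<eta> d\<close> a cycle at the next stage.\<close>
  define P where "P = (\<lambda>n \<eta>. (\<forall>b\<in>basis F n. \<eta> b \<in> rcomp F (Suc n) (bdeg F n b)) \<and>
    (\<forall>x\<in>cycles M F n. lmap (dmap F n) (lmap \<eta> x) = lmap (\<delta> n) x) \<and>
    (n = 0 \<longrightarrow> (\<forall>b\<in>basis F 0. lmap (dmap F 0) (\<eta> b) = \<delta> 0 b)))"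
  define Q where "Q = (\<lambda>n \<eta> \<eta>'. \<forall>b\<in>basis F (Suc n). lmap (dmap F (Suc n)) (\<eta>' b) = \<delta> (Suc n) b - lmap \<eta> (dmap F n b))"
  have "\<exists>\<eta>. \<forall>n. P n (\<eta> n) \<and> Q n (\<eta> n) (\<eta> (Suc n))"
  proof (rule dependent_nat_choice)
    have "\<exists>y\<in>rcomp F (Suc 0) (bdeg F 0 b). lmap (dmap F 0) y = \<delta> 0 b"
      if "b \<in> basis F 0" for b
    proof (rule cycles_preimage[OF F _ \<delta>in[OF that]])
      have "\<delta> 0 b \<in> rfree F 0"
        using fcomp_closed(4)[OF \<delta>in[OF that]] .
      moreover have "aug F (\<delta> 0 b) = zero_of M"
        unfolding \<delta>_def
        using that \<psi>D(3,5) \<phi>D(3)[of "single b 1"] \<phi>D(2)[OF that] by (intro aug_diff_eq_zero[OF F]) auto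
      ultimately show "\<delta> 0 b \<in> cycles M F 0" by (simp add: cycles_def)
    qed
    then obtain \<eta> where \<eta>: "\<And>b. b \<in> basis F 0 \<Longrightarrow> \<eta> b \<in> rcomp F (Suc 0) (bdeg F 0 b)"
      "\<And>b. b \<in> basis F 0 \<Longrightarrow> lmap (dmap F 0) (\<eta> b) = \<delta> 0 b" by metis
    have "lmap (dmap F 0) (lmap \<eta> x) = lmap (\<delta> 0) x" if "x \<in> rfree F 0" for x
      unfolding lmap_lmap by (rule lmap_cong[OF _ that]) (rule \<eta>(2))
    thus "\<exists>\<eta>. P 0 \<eta>"
      using \<eta> by (intro exI[of _ \<eta>]) (auto simp: P_def cycles_def)
  next
    fix \<eta> n assume P: "P n \<eta>"
    have "\<exists>y\<in>rcomp F (Suc (Suc n)) (bdeg F (Suc n) b).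
        lmap (dmap F (Suc n)) y = \<delta> (Suc n) b - lmap \<eta> (dmap F n b)" if b: "b \<in> basis F (Suc n)" for b
    proof (rule cycles_preimage[OF F])
      have "lmap \<eta> (dmap F n b) \<in> rcomp F (Suc n) (bdeg F (Suc n) b)"
        using lmap_in_fcomp[OF R(2)[OF b]] P by (auto simp: P_def)
      thus *: "\<delta> (Suc n) b - lmap \<eta> (dmap F n b) \<in> rcomp F (Suc n) (bdeg F (Suc n) b)"
        by (intro fcomp_closed(3) \<delta>in b)
      have "lmap (dmap F n) (lmap \<eta> (dmap F n b)) = lmap (\<delta> n) (dmap F n b)"
        using P dmap_in_cycles[OF F b] by (auto simp: P_def)
      moreover have "lmap (dmap F n) (\<delta> (Suc n) b) = lmap (\<delta> n) (dmap F n b)"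
        using chain[of "single b 1" n] b by simp
      ultimately show "\<delta> (Suc n) b - lmap \<eta> (dmap F n b) \<in> cycles M F (Suc n)"
        using fcomp_closed(4)[OF *] by (simp add: cycles_Suc lmap_diff)
    qed
    then obtain \<eta>' where \<eta>': "\<And>b. b \<in> basis F (Suc n) \<Longrightarrow>
        \<eta>' b \<in> rcomp F (Suc (Suc n)) (bdeg F (Suc n) b)"
      "\<And>b. b \<in> basis F (Suc n) \<Longrightarrow> lmap (dmap F (Suc n)) (\<eta>' b) = \<delta> (Suc n) b - lmap \<eta> (dmap F n b)" by metis
    have "lmap (dmap F (Suc n)) (lmap \<eta>' x) = lmap (\<delta> (Suc n)) x" if "x \<in> cycles M F (Suc n)" for x
    proof -
      have x: "x \<in> rfree F (Suc n)" "lmap (dmap F n) x = 0" using that by (auto simp: cycles_Suc)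
      have "lmap (dmap F (Suc n)) (lmap \<eta>' x) = lmap (\<lambda>b. \<delta> (Suc n) b - lmap \<eta> (dmap F n b)) x"
        unfolding lmap_lmap by (rule lmap_cong[OF _ x(1)]) (rule \<eta>'(2))
      thus ?thesis using x(2) by (simp add: lmap_family_diff flip: lmap_lmap)
    qed
    hence "P (Suc n) \<eta>'" "Q n \<eta> \<eta>'"
      using \<eta>' by (auto simp: P_def Q_def)
    thus "\<exists>\<eta>'. P (Suc n) \<eta>' \<and> Q n \<eta> \<eta>'" by blast
  qed
  then obtain \<eta> where \<eta>: "\<And>n. P n (\<eta> n)" "\<And>n. Q n (\<eta> n) (\<eta> (Suc n))" by blast
  show thesis
  proof (rule that[of \<eta>])
    show "\<eta> n b \<in> rcomp F (Suc n) (bdeg F n b)" if "b \<in> basis F n" for n b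
      using \<eta>(1)[of n] that by (auto simp: P_def)
    show "x = lmap (\<psi> 0) (lmap (\<phi> 0) x) + lmap (dmap F 0) (lmap (\<eta> 0) x)" if "x \<in> rfree F 0" for x
    proof -
      have "lmap (dmap F 0) (lmap (\<eta> 0) x) = lmap (\<delta> 0) x"
        unfolding lmap_lmap by (rule lmap_cong[OF _ that]) (use \<eta>(1)[of 0] in \<open>auto simp: P_def\<close>)
      thus ?thesis by (simp add: lmap\<delta>)
    qed
    show "x = lmap (\<psi> (Suc n)) (lmap (\<phi> (Suc n)) x) +
       lmap (dmap F (Suc n)) (lmap (\<eta> (Suc n)) x) + lmap (\<eta> n) (lmap (dmap F n) x)"
      if "x \<in> rfree F (Suc n)" for n x
    proof -
      have "lmap (dmap F (Suc n)) (lmap (\<eta> (Suc n)) x) = lmap (\<lambda>b. \<delta> (Suc n) b - lmap (\<eta> n) (dmap F n b)) x"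
        unfolding lmap_lmap by (rule lmap_cong[OF _ that]) (use \<eta>(2)[of n] in \<open>auto simp: Q_def\<close>)
      also have "\<dots> = lmap (\<delta> (Suc n)) x - lmap (\<eta> n) (lmap (dmap F n) x)"
        by (simp add: lmap_family_diff lmap_lmap)
      finally show ?thesis by (simp add: lmap\<delta>)
    qed
  qed
qed

section \<open>Betti numbers from minimal resolutions\<close>

lemma minimal_iff:
  "minimal_graded_free_resolution scale A M F \<longleftrightarrow> graded_free_resolution A M F \<and>
     (\<forall>n. \<forall>b\<in>basis F (Suc n). dmap F n b \<in> rmfree F n)"
proof (cases "graded_free_resolution A M F")
  case True
  have "diff F n ` rfree F (Suc n) \<subseteq> rmfree F n \<longleftrightarrow>
      (\<forall>b\<in>basis F (Suc n). dmap F n b \<in> rmfree F n)" for n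
  proof
    assume "diff F n ` rfree F (Suc n) \<subseteq> rmfree F n"
    thus "\<forall>b\<in>basis F (Suc n). dmap F n b \<in> rmfree F n"
      by (auto simp: dmap_def image_subset_iff)
  next
    assume "\<forall>b\<in>basis F (Suc n). dmap F n b \<in> rmfree F n"
    thus "diff F n ` rfree F (Suc n) \<subseteq> rmfree F n"
      using diff_eq_lmap[OF True] lmap_family_in_mfree[of _ "basis F (Suc n)"] by (auto simp: image_subset_iff)
  qed
  thus ?thesis
    using True by (simp add: minimal_graded_free_resolution_def res_module_def ideal_times_free_module)
qed (simp add: minimal_graded_free_resolution_def)

text \<open>With no basis element in degree \<open>j\<close>, every nonzero coordinate of a vector
  of degree \<open>j\<close> has positive degree.\<close>

lemma fcomp_in_mfree:
  assumes "x \<in> fcomp B dg j" "\<And>b. b \<in> B \<Longrightarrow> dg b \<noteq> j"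
  shows "x \<in> mfree B"
proof -
  have "part 0 (lookup x b) = 0" for b
  proof (cases "b \<in> B \<and> dg b \<le> j")
    case True
    hence "lookup x b \<in> A (j - dg b)" "j - dg b \<noteq> 0"
      using assms(1) assms(2)[of b] by (auto simp: fcomp_iff)
    thus ?thesis by (simp add: part_component)
  next
    case False
    hence "lookup x b = 0" using assms(1) by (auto simp: fcomp_iff free_iff)
    thus ?thesis by simp
  qed
  thus ?thesis using fcomp_closed(4)[OF assms(1)] by (simp add: mfree_iff)
qed

text \<open>Minimality of \<open>F\<close> puts both homotopy terms into \<open>\<mm> F\<close>, so
  \<open>\<psi> \<phi>\<close> is the identity modulo \<open>\<mm>\<close>.\<close>

lemma homotopy_minimal:
  assumes F: "minimal_graded_free_resolution scale A M F"
    and \<phi>: "chain_map F G \<phi>" and \<psi>: "chain_map G F \<psi>" and x: "x \<in> rfree F i"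
  shows "x - lmap (\<psi> i) (lmap (\<phi> i) x) \<in> rmfree F i"
proof -
  from F have res: "graded_free_resolution A M F"
    and D: "\<And>n b. b \<in> basis F (Suc n) \<Longrightarrow> dmap F n b \<in> rmfree F n"
    by (auto simp: minimal_iff)
  obtain \<eta> where \<eta>: "\<And>n b. b \<in> basis F n \<Longrightarrow> \<eta> n b \<in> rcomp F (Suc n) (bdeg F n b)"
    "\<And>x. x \<in> rfree F 0 \<Longrightarrow> x = lmap (\<psi> 0) (lmap (\<phi> 0) x) + lmap (dmap F 0) (lmap (\<eta> 0) x)"
    "\<And>n x. x \<in> rfree F (Suc n) \<Longrightarrow> x = lmap (\<psi> (Suc n)) (lmap (\<phi> (Suc n)) x) +
       lmap (dmap F (Suc n)) (lmap (\<eta> (Suc n)) x) + lmap (\<eta> n) (lmap (dmap F n) x)"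
    using homotopy_exists[OF res \<phi> \<psi>] by metis
  have \<eta>f: "\<eta> n b \<in> rfree F (Suc n)" if "b \<in> basis F n" for n b
    using fcomp_closed(4)[OF \<eta>(1)[OF that]] .
  have dmap: "lmap (dmap F n) y \<in> rmfree F n" if "y \<in> rfree F (Suc n)" for n y
    using lmap_family_in_mfree[OF that] D by blast
  show ?thesis
  proof (cases i)
    case 0
    have "x - lmap (\<psi> i) (lmap (\<phi> i) x) = lmap (dmap F 0) (lmap (\<eta> 0) x)"
      using \<eta>(2)[of x] x 0 by (simp add: algebra_simps)
    thus ?thesis using dmap[of "lmap (\<eta> 0) x" 0] lmap_in_free[where f = x, OF \<eta>f] x 0 by simp
  next
    case (Suc n)
    have "x - lmap (\<psi> i) (lmap (\<phi> i) x) = lmap (dmap F (Suc n)) (lmap (\<eta> (Suc n)) x) + lmap (\<eta> n) (lmap (dmap F n) x)"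
      using \<eta>(3)[of x n] x Suc by (simp add: algebra_simps)
    moreover have "lmap (dmap F (Suc n)) (lmap (\<eta> (Suc n)) x) \<in> rmfree F i"
      using dmap[of "lmap (\<eta> (Suc n)) x" "Suc n"] lmap_in_free[where f = x, OF \<eta>f] x Suc by simp
    moreover have "lmap (\<eta> n) (lmap (dmap F n) x) \<in> rmfree F i"
      using lmap_in_mfree[OF dmap[of x n] \<eta>f] x Suc by simp
    ultimately show ?thesis by (simp add: mfree_closed)
  qed
qed

text \<open>A basis element of \<open>F\<close> in a wrong degree would go into
  \<open>\<mm> G\<close> and be sent back into \<open>\<mm> F\<close>; but
  \<open>\<psi> \<phi>\<close> reproduces it modulo \<open>\<mm> F\<close>, so it would lie in
  \<open>\<mm> F\<close> itself.\<close>

lemma minimal_linear: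
  assumes F: "minimal_graded_free_resolution scale A M F" and G: "graded_free_resolution A M G"
    and \<pi>: "grading_embedding M \<pi>" and linear: "linear_resolution A a G"
  shows "linear_resolution A a F"
proof -
  from F have res: "graded_free_resolution A M F" by (simp add: minimal_iff)
  obtain \<phi> where \<phi>: "chain_map F G \<phi>" using chain_map_exists[OF res G \<pi>] by blast
  obtain \<psi> where \<psi>: "chain_map G F \<psi>" using chain_map_exists[OF G res \<pi>] by blast
  have deg: "bdeg G n b = n + a" if "b \<in> basis G n" for n b
    using linear that by (simp add: linear_resolution_def res_module_def generated_in_degree_free_module)
  have "bdeg F n b = n + a" if b: "b \<in> basis F n" for n b
  proof (rule ccontr)
    assume "bdeg F n b \<noteq> n + a"
    hence "\<phi> n b \<in> rmfree G n"
      using deg by (intro fcomp_in_mfree[OF chain_mapD(1)[OF \<phi> b]]) auto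
    hence "lmap (\<psi> n) (\<phi> n b) \<in> rmfree F n"
      using lmap_in_mfree chain_mapD(2)[OF \<psi>] by blast
    moreover have "single b 1 - lmap (\<psi> n) (\<phi> n b) \<in> rmfree F n"
      using homotopy_minimal[OF F \<phi> \<psi>, of "single b 1" n] b by simp
    ultimately have "(single b 1 - lmap (\<psi> n) (\<phi> n b)) + lmap (\<psi> n) (\<phi> n b) \<in> rmfree F n"
      by (intro mfree_closed(2))
    hence "single b 1 \<in> rmfree F n" by simp
    hence "part 0 (lookup (single b 1) b) = 0" by (simp only: mfree_iff)
    thus False by (simp add: part_component[of _ 0])
  qed
  thus ?thesis
    by (simp add: linear_resolution_def res_module_def generated_in_degree_free_module)
qed

lemma quotient_dim_eq:
  assumes "\<exists>S\<subseteq>Z. finite S \<and> card S \<le> N \<and> Z \<subseteq> module.span s (W \<union> S)"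
    and "\<And>S. S \<subseteq> Z \<Longrightarrow> finite S \<Longrightarrow> Z \<subseteq> module.span s (W \<union> S) \<Longrightarrow> N \<le> card S"
  shows "quotient_dim s Z W = N"
  unfolding quotient_dim_def
proof (rule Least_equality)
  show "\<exists>S\<subseteq>Z. finite S \<and> card S = N \<and> Z \<subseteq> module.span s (W \<union> S)"
    using assms by (metis le_antisym)
qed (use assms(2) in blast)

text \<open>An arbitrary \<open>F\<close> is compared with the minimal \<open>G\<close>, whose
  differentials vanish modulo \<open>\<mm>\<close>. The images under \<open>\<psi>\<close> of the
  basis elements of degree \<open>j\<close> generate the cycles modulo boundaries. Conversely, the
  scalar coordinates of \<open>\<phi>\<close> give a linear map that kills boundaries and separates
  these images, so fewer generators cannot suffice.\<close>

lemma tor_dim: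
  assumes F: "graded_free_resolution A M F" and G: "minimal_graded_free_resolution scale A M G"
    and \<pi>: "grading_embedding M \<pi>"
    and fin: "finite {b \<in> basis G i. bdeg G i b = j}"
  shows "quotient_dim (\<lambda>c. free_scale (scale c 1)) (tor_cycles scale A F i j) (tor_boundaries scale A F i j)
    = card {b \<in> basis G i. bdeg G i b = j}"
proof -
  from G have Gres: "graded_free_resolution A M G"
    and Gmin: "\<And>n b. b \<in> basis G (Suc n) \<Longrightarrow> dmap G n b \<in> rmfree G n"
    by (auto simp: minimal_iff)
  note R = resolutionD[OF F]
  obtain \<phi> where \<phi>: "chain_map F G \<phi>" using chain_map_exists[OF F Gres \<pi>] by blast
  obtain \<psi> where \<psi>: "chain_map G F \<psi>" using chain_map_exists[OF Gres F \<pi>] by blast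
  note \<phi>D = chain_mapD[OF \<phi>] and \<psi>D = chain_mapD[OF \<psi>]
  define Z where "Z = tor_cycles scale A F i j"
  define W where "W = tor_boundaries scale A F i j"
  define J where "J = {b \<in> basis G i. bdeg G i b = j}"
  define FB where "FB = rcomp F i j"
  have J: "finite J" using fin by (simp add: J_def)
  have Z_iff: "x \<in> Z \<longleftrightarrow> x \<in> FB \<and> (\<forall>n. i = Suc n \<longrightarrow> lmap (dmap F n) x \<in> rmfree F n)" for x
    unfolding Z_def tor_cycles_def FB_def res_module_def ideal_times_free_module comp_free_module
    using R(1) fcomp_closed(4) by auto
  have W_iff: "x \<in> W \<longleftrightarrow> (\<exists>y w. x = lmap (dmap F i) y + w \<and>
      y \<in> rcomp F (Suc i) j \<and> w \<in> FB \<and> w \<in> rmfree F i)" for x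
    unfolding W_def tor_boundaries_def FB_def res_module_def ideal_times_free_module comp_free_module
    using R(1) fcomp_closed(4) by (auto, metis, metis)
  \<comment> \<open>The homotopy formula: since \<open>z\<close> is a cycle modulo
    \<open>\<mm>\<close>, the term \<open>\<eta> d z\<close> lies in \<open>\<mm> F\<close> and goes
    into the remainder \<open>r\<close>.\<close>
  have decomp: "\<exists>y r. z = lmap (\<psi> i) (lmap (\<phi> i) z) + lmap (dmap F i) y + r \<and>
      y \<in> rcomp F (Suc i) j \<and> r \<in> rmfree F i" if z: "z \<in> Z" for z
  proof -
    have zF: "z \<in> FB" and zf: "z \<in> rfree F i"
      using z fcomp_closed(4) by (auto simp: Z_iff FB_def)
    obtain \<eta> where \<eta>: "\<And>n b. b \<in> basis F n \<Longrightarrow> \<eta> n b \<in> rcomp F (Suc n) (bdeg F n b)"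
      "\<And>x. x \<in> rfree F 0 \<Longrightarrow> x = lmap (\<psi> 0) (lmap (\<phi> 0) x) + lmap (dmap F 0) (lmap (\<eta> 0) x)"
      "\<And>n x. x \<in> rfree F (Suc n) \<Longrightarrow> x = lmap (\<psi> (Suc n)) (lmap (\<phi> (Suc n)) x) +
         lmap (dmap F (Suc n)) (lmap (\<eta> (Suc n)) x) + lmap (\<eta> n) (lmap (dmap F n) x)"
      using homotopy_exists[OF F \<phi> \<psi>] by metis
    have \<eta>z: "lmap (\<eta> i) z \<in> rcomp F (Suc i) j"
      using lmap_in_fcomp[OF zF[unfolded FB_def] \<eta>(1)] .
    show ?thesis
    proof (cases i)
      case 0
      thus ?thesis using \<eta>(2)[of z] zf \<eta>z mfree_closed(1)
        by (intro exI[of _ "lmap (\<eta> 0) z"] exI[of _ 0]) simp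
    next
      case (Suc n)
      have "lmap (\<eta> n) (lmap (dmap F n) z) \<in> rmfree F i"
        using z Suc fcomp_closed(4)[OF \<eta>(1)] lmap_in_mfree[of "lmap (dmap F n) z" "basis F n" "\<eta> n" "basis F i"]
        by (simp add: Z_iff)
      thus ?thesis using \<eta>(3)[of z n] zf \<eta>z Suc
        by (intro exI[of _ "lmap (\<eta> i) z"] exI[of _ "lmap (\<eta> n) (lmap (dmap F n) z)"]) simp
    qed
  qed
  have \<psi>Z: "\<psi> i b \<in> Z" if b: "b \<in> J" for b
  proof -
    have bG: "b \<in> basis G i" "bdeg G i b = j" using b by (auto simp: J_def)
    have "lmap (dmap F n) (\<psi> i b) \<in> rmfree F n" if "i = Suc n" for n
    proof -
      have "lmap (dmap F n) (\<psi> i b) = lmap (\<psi> n) (dmap G n b)"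
        using \<psi>D(4)[of "single b 1" n] bG that by simp
      thus ?thesis using lmap_in_mfree[OF Gmin \<psi>D(2)] bG that by auto
    qed
    thus ?thesis using \<psi>D(1)[OF bG(1)] bG(2) by (auto simp: Z_iff FB_def)
  qed
  have \<phi>W: "lmap (\<phi> i) x \<in> rmfree G i" if "x \<in> W" for x
  proof -
    obtain y w where yw: "x = lmap (dmap F i) y + w" "y \<in> rcomp F (Suc i) j"
      "w \<in> rmfree F i" using \<open>x \<in> W\<close> W_iff by blast
    have "lmap (\<phi> i) (lmap (dmap F i) y) = lmap (dmap G i) (lmap (\<phi> (Suc i)) y)"
      using \<phi>D(4) fcomp_closed(4)[OF yw(2)] by simp
    also have "\<dots> \<in> rmfree G i"
      by (rule lmap_family_in_mfree[OF \<phi>D(5)[OF fcomp_closed(4)[OF yw(2)]] Gmin])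
    finally show ?thesis
      using lmap_in_mfree[OF yw(3) \<phi>D(2)] by (simp add: yw(1) lmap_add mfree_closed)
  qed
  have "\<exists>S\<subseteq>Z. finite S \<and> card S \<le> card J \<and> Z \<subseteq> V.span (W \<union> S)"
  proof (intro exI[of _ "\<psi> i ` J"] conjI)
    show "\<psi> i ` J \<subseteq> Z" using \<psi>Z by blast
    show "finite (\<psi> i ` J)" "card (\<psi> i ` J) \<le> card J" using J card_image_le by auto
    show "Z \<subseteq> V.span (W \<union> \<psi> i ` J)"
    proof
      fix z assume z: "z \<in> Z"
      define x where "x = lmap (\<phi> i) z"
      have xG: "x \<in> rcomp G i j"
        using \<phi>D(6) z by (simp add: x_def Z_iff FB_def)
      have "\<exists>c. b \<in> J \<longrightarrow> lookup x b = scale c 1" for b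
        using xG by (auto simp: fcomp_iff J_def component_zero dest!: spec[of _ b])
      then obtain c where c: "\<And>b. b \<in> J \<Longrightarrow> lookup x b = scale (c b) 1" by metis
      have kvG: "svec J c \<in> rcomp G i j"
        unfolding svec_def
      proof (rule fcomp_sum)
        fix b assume "b \<in> J"
        thus "single b (scale (c b) 1) \<in> rcomp G i j"
          using single_in_fcomp[of b "basis G i" "scale (c b) 1" 0 "bdeg G i"] by (simp add: J_def)
      qed
      \<comment> \<open>Removing the scalar coordinates at \<open>J\<close> leaves a vector in
        \<open>\<mm> G\<close>: every other coordinate has positive degree or vanishes.\<close>
      define x' where "x' = x - svec J c"
      have x'G: "x' \<in> rcomp G i j"
        unfolding x'_def by (rule fcomp_closed(3)[OF xG kvG])
      have "part 0 (lookup x' b) = 0" for b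
      proof (cases "b \<in> J")
        case True
        thus ?thesis by (simp add: x'_def lookup_minus lookup_svec[OF J] c)
      next
        case False
        show ?thesis
        proof (cases "b \<in> basis G i \<and> bdeg G i b \<le> j")
          case True
          hence "lookup x' b \<in> A (j - bdeg G i b)" "j - bdeg G i b \<noteq> 0"
            using x'G False by (auto simp: fcomp_iff J_def)
          thus ?thesis by (simp add: part_component)
        next
          case False
          hence "lookup x' b = 0" using x'G by (auto simp: fcomp_iff free_iff)
          thus ?thesis by simp
        qed
      qed
      hence x'm: "x' \<in> rmfree G i" using fcomp_closed(4)[OF x'G] by (simp add: mfree_iff)
      obtain y r where yr: "z = lmap (\<psi> i) x + lmap (dmap F i) y + r"
        "y \<in> rcomp F (Suc i) j" "r \<in> rmfree F i"
        using decomp[OF z] unfolding x_def by blast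
      have x: "x = svec J c + x'" by (simp add: x'_def)
      let ?w = "lmap (\<psi> i) x' + r"
      have Dy: "lmap (dmap F i) y \<in> FB"
        unfolding FB_def using lmap_in_fcomp[OF yr(2) R(2)] by blast
      \<comment> \<open>\<open>W\<close> admits only homogeneous remainders; \<open>r\<close> has
        degree \<open>j\<close> because all other terms of the decomposition do.\<close>
      have "r = z - lmap (\<psi> i) x - lmap (dmap F i) y" using yr(1) by simp
      moreover have "lmap (\<psi> i) x \<in> FB" "lmap (\<psi> i) x' \<in> FB"
        unfolding FB_def by (rule \<psi>D(6), fact)+
      ultimately have "?w \<in> FB"
        using z Dy fcomp_closed(2,3) unfolding FB_def Z_iff by metis
      moreover have "?w \<in> rmfree F i"
        by (intro mfree_closed(2) yr(3) lmap_in_mfree[OF x'm \<psi>D(2)])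
      ultimately have "lmap (dmap F i) y + ?w \<in> W"
        using yr(2) W_iff by blast
      hence "lmap (\<psi> i) (svec J c) + (lmap (dmap F i) y + ?w) \<in> V.span (W \<union> \<psi> i ` J)"
        unfolding lmap_svec
        by (intro V.span_add[OF V.span_sum V.span_base] V.span_scale) (auto intro: V.span_base)
      moreover have "z = lmap (\<psi> i) (svec J c) + (lmap (dmap F i) y + ?w)"
        using yr(1) by (subst (asm) x) (simp add: lmap_add algebra_simps)
      ultimately show "z \<in> V.span (W \<union> \<psi> i ` J)" by simp
    qed
  qed
  moreover have "card J \<le> card S" if S: "S \<subseteq> Z" "finite S" "Z \<subseteq> V.span (W \<union> S)" for S
  proof -
    \<comment> \<open>The scalar part of \<open>\<phi> z\<close> at the basis elements in
      \<open>J\<close>: zero on boundaries, and the unit vector at \<open>b\<close> on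
      \<open>\<psi> i b\<close>.\<close>
    define \<kappa> where "\<kappa> = (\<lambda>z. \<Sum>b\<in>J. single b (part 0 (lookup (lmap (\<phi> i) z) b)))"
    have \<kappa>_add: "\<kappa> (x + y) = \<kappa> x + \<kappa> y" for x y
      by (simp add: \<kappa>_def lmap_add lookup_add part_add single_add sum.distrib)
    have \<kappa>_scale: "\<kappa> (vscale c x) = vscale c (\<kappa> x)" for c x
      by (simp add: \<kappa>_def lmap_scale part_scale free_scale_sum)
    have \<kappa>_0: "\<kappa> x = 0" if "lmap (\<phi> i) x \<in> rmfree G i" for x
      using that by (simp add: \<kappa>_def mfree_iff)
    have \<kappa>_span: "\<kappa> x \<in> V.span (\<kappa> ` S)" if "x \<in> V.span (W \<union> S)" for x
      using that
    proof (induction rule: V.span_induct_alt)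
      case base
      have "\<kappa> 0 = 0" by (rule \<kappa>_0) (simp add: mfree_closed)
      thus ?case using V.span_zero by simp
    next
      case (step c x y)
      have "\<kappa> x \<in> V.span (\<kappa> ` S)"
        using step(1) \<kappa>_0[OF \<phi>W] V.span_zero V.span_base by auto
      thus ?case using step(2) by (auto simp: \<kappa>_add \<kappa>_scale intro: V.span_add V.span_scale)
    qed
    have \<kappa>\<psi>: "\<kappa> (\<psi> i b) = single b 1" if b: "b \<in> J" for b
    proof -
      have "single b 1 - lmap (\<phi> i) (\<psi> i b) \<in> rmfree G i"
        using homotopy_minimal[OF G \<psi> \<phi>, of "single b 1" i] b by (simp add: J_def)
      hence "part 0 (lookup (lmap (\<phi> i) (\<psi> i b)) c) = part 0 (lookup (single b 1) c)" for c
        by (simp add: mfree_iff lookup_minus part_diff)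
      hence "\<kappa> (\<psi> i b) = (\<Sum>c\<in>J. if c = b then single b 1 else 0)"
        unfolding \<kappa>_def by (intro sum.cong) (auto simp: lookup_single part_component[of _ 0])
      thus ?thesis using J b by simp
    qed
    define e :: "nat \<Rightarrow> 'a vec" where "e = (\<lambda>b. single b 1)"
    have "inj_on e J \<and> V.independent (e ` J)"
      unfolding V.independent_family_iff[OF J] lmap_svec[symmetric]
      using svec_eq_0_iff[OF J] by (simp add: e_def)
    moreover have "e ` J \<subseteq> V.span (\<kappa> ` S)"
    proof clarify
      fix b assume b: "b \<in> J"
      have "\<kappa> (\<psi> i b) \<in> V.span (\<kappa> ` S)"
        using \<psi>Z[OF b] S(3) by (intro \<kappa>_span) auto
      thus "e b \<in> V.span (\<kappa> ` S)" by (simp add: \<kappa>\<psi>[OF b] e_def)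
    qed
    ultimately have "card J \<le> card (\<kappa> ` S)"
      using V.independent_span_bound[of "\<kappa> ` S" "e ` J"] S(2) card_image[of e J] by auto
    thus ?thesis using card_image_le[OF S(2), of \<kappa>] by simp
  qed
  ultimately have "quotient_dim (\<lambda>c. free_scale (scale c 1)) Z W = card J"
    by (rule quotient_dim_eq)
  thus ?thesis by (simp only: Z_def W_def J_def)
qed

text \<open>\<open>tor_dim\<close> holds for every resolution, in particular for the chosen one;
  \<open>G\<close> itself shows that there is one to choose.\<close>

lemma betti_eq:
  assumes G: "minimal_graded_free_resolution scale A M G" and \<pi>: "grading_embedding M \<pi>"
    and fin: "finite (basis G i)"
  shows "betti scale A M i j = card {b \<in> basis G i. bdeg G i b = j}"
proof -
  have "graded_free_resolution A M G" using G by (simp add: minimal_iff)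
  hence "graded_free_resolution A M (SOME F. graded_free_resolution A M F)"
    by (rule someI)
  thus ?thesis
    unfolding betti_def Let_def using fin by (intro tor_dim[OF _ G \<pi>]) auto
qed

end

section \<open>The quadratic dual\<close>

interpretation fs: vector_space "fun_scale :: 'k::field \<Rightarrow> ('x \<Rightarrow> 'k) \<Rightarrow> 'x \<Rightarrow> 'k"
  by unfold_locales (auto simp: fun_eq_iff algebra_simps)

lemma fun_sum_apply: "sum f S x = (\<Sum>s\<in>S. f s x)"
  by (induction S rule: infinite_finite_induct) auto

text \<open>The product of \<open>f\<close>, as a tensor of degree one, with \<open>\<psi>\<close>.
  It peels off the first letter of a word, which allows induction on the number of factors.\<close>

definition tcons :: "('a \<Rightarrow> 'k::field) \<Rightarrow> ('a list \<Rightarrow> 'k) \<Rightarrow> 'a list \<Rightarrow> 'k" where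
  "tcons f \<psi> vs = (case vs of [] \<Rightarrow> 0 | v # vs \<Rightarrow> f v * \<psi> vs)"

lemma tcons_simps [simp]: "tcons f \<psi> [] = 0" "tcons f \<psi> (v # vs) = f v * \<psi> vs"
  by (simp_all add: tcons_def)

lemma pure_tensor_Nil: "pure_tensor [] vs = (if vs = [] then 1 else 0)"
  by (simp add: pure_tensor_def)

lemma pure_tensor_Cons: "pure_tensor (f # fs) = tcons f (pure_tensor fs)"
proof (rule ext)
  fix vs show "pure_tensor (f # fs) vs = tcons f (pure_tensor fs) vs"
    by (cases vs) (auto simp: pure_tensor_def)
qed

lemma tensor_mult_Nil: "tensor_mult (pure_tensor []) \<chi> = \<chi>"
proof (rule ext)
  fix vs :: "'a list"
  have "tensor_mult (pure_tensor []) \<chi> vs = (\<Sum>p\<le>length vs. if p = 0 then \<chi> vs else 0)"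
    unfolding tensor_mult_def by (intro sum.cong) (auto simp: pure_tensor_Nil)
  thus "tensor_mult (pure_tensor []) \<chi> vs = \<chi> vs" by simp
qed

lemma tensor_mult_tcons: "tensor_mult (tcons f \<psi>) \<chi> = tcons f (tensor_mult \<psi> \<chi>)"
proof (rule ext)
  fix vs show "tensor_mult (tcons f \<psi>) \<chi> vs = tcons f (tensor_mult \<psi> \<chi>) vs"
  proof (cases vs)
    case (Cons v ws)
    have "tensor_mult (tcons f \<psi>) \<chi> vs =
        (\<Sum>p\<le>Suc (length ws). tcons f \<psi> (take p (v # ws)) * \<chi> (drop p (v # ws)))"
      by (simp add: tensor_mult_def Cons)
    also have "\<dots> = (\<Sum>p\<le>length ws. f v * (\<psi> (take p ws) * \<chi> (drop p ws)))"
      by (subst sum.atMost_Suc_shift) (simp add: mult.assoc)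
    finally show ?thesis by (simp add: Cons tensor_mult_def sum_distrib_left)
  qed (simp add: tensor_mult_def)
qed

lemma tensor_mult_add_left: "tensor_mult (\<psi> + \<psi>') \<chi> = tensor_mult \<psi> \<chi> + tensor_mult \<psi>' \<chi>"
  by (auto simp: tensor_mult_def fun_eq_iff distrib_right sum.distrib)

lemma tensor_mult_scale_left: "tensor_mult (fun_scale c \<psi>) \<chi> = fun_scale c (tensor_mult \<psi> \<chi>)"
  by (auto simp: tensor_mult_def fun_eq_iff sum_distrib_left mult.assoc)

lemma tensor_mult_zero_left: "tensor_mult 0 \<chi> = 0"
  by (simp add: tensor_mult_def fun_eq_iff)

lemma tcons_add: "tcons f (\<psi> + \<psi>') = tcons f \<psi> + tcons f \<psi>'"
  by (auto simp: fun_eq_iff tcons_def distrib_left split: list.splits)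

lemma tcons_scale: "tcons f (fun_scale c \<psi>) = fun_scale c (tcons f \<psi>)"
  by (auto simp: fun_eq_iff tcons_def split: list.splits)

lemma tcons_zero: "tcons f 0 = 0"
  by (auto simp: fun_eq_iff tcons_def split: list.splits)

section \<open>Tensors over the dual of \<open>V\<close> and the ideal of the quadratic dual\<close>

context standard_graded_algebra
begin

abbreviation Vdual where "Vdual \<equiv> dual_space scale (A 1)"
abbreviation T where "T \<equiv> tensor_component scale A"
abbreviation QI where "QI \<equiv> quadratic_dual_ideal scale A"

lemma VdualD:
  assumes "f \<in> Vdual"
  shows "\<And>x y. x \<in> A 1 \<Longrightarrow> y \<in> A 1 \<Longrightarrow> f (x + y) = f x + f y"
    "\<And>c x. x \<in> A 1 \<Longrightarrow> f (scale c x) = c * f x" "\<And>x. x \<notin> A 1 \<Longrightarrow> f x = 0"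
  using assms by (auto simp: dual_space_def)

lemma dual_basis:
  obtains S f where "finite S" "S \<subseteq> A 1" "\<And>x. x \<in> S \<Longrightarrow> f x \<in> Vdual"
    "\<And>v. v \<in> A 1 \<Longrightarrow> v = (\<Sum>x\<in>S. scale (f x v) x)"
    "\<And>g v. g \<in> Vdual \<Longrightarrow> g v = (\<Sum>x\<in>S. g x * f x v)"
proof -
  obtain S where S: "finite S" "S \<subseteq> A 1" "independent S" "span S = A 1"
    using component_basis[of 1] by metis
  \<comment> \<open>Coordinate functions, set to 0 outside \<open>A 1\<close> as
    \<open>dual_space\<close> prescribes, so that the expansion of forms holds at every
    argument.\<close>
  define f where "f = (\<lambda>x v. if v \<in> A 1 then representation S v x else 0)"
  have 1: "f x \<in> Vdual" for x
    using S(3,4) by (auto simp: f_def dual_space_def component_add component_scale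
        representation_add representation_scale)
  have 2: "v = (\<Sum>x\<in>S. scale (f x v) x)" if "v \<in> A 1" for v
    using sum_representation_eq[OF S(3), of v S] S that by (simp add: f_def)
  have 3: "g v = (\<Sum>x\<in>S. g x * f x v)" if g: "g \<in> Vdual" for g v
  proof (cases "v \<in> A 1")
    case True
    have g0: "g 0 = 0" using VdualD(2)[OF g, of 0 0] by simp
    have sum: "g (\<Sum>x\<in>R. scale (f x v) x) = (\<Sum>x\<in>R. f x v * g x)" if "R \<subseteq> S" for R
      using finite_subset[OF that S(1)] that
    proof (induction R)
      case (insert x R)
      have "x \<in> A 1" "(\<Sum>x\<in>R. scale (f x v) x) \<in> A 1"
        using insert.prems S(2) by (auto intro!: component_sum component_scale)
      thus ?case using insert VdualD(1,2)[OF g] by (simp add: component_scale)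
    qed (simp add: g0)
    have "g v = g (\<Sum>x\<in>S. scale (f x v) x)"
      by (rule arg_cong[OF 2[OF True]])
    also have "\<dots> = (\<Sum>x\<in>S. g x * f x v)"
      using sum[of S] by (simp add: mult.commute)
    finally show ?thesis .
  next
    case False
    thus ?thesis using VdualD(3)[OF g] by (simp add: f_def)
  qed
  show thesis by (rule that[OF S(1,2) 1 2 3])
qed

lemma T_pure: "set fs \<subseteq> Vdual \<Longrightarrow> pure_tensor fs \<in> T (length fs)"
  unfolding tensor_component_def by (rule fs.span_base) blast

lemma T_closed:
  "0 \<in> T n" "\<phi> \<in> T n \<Longrightarrow> \<psi> \<in> T n \<Longrightarrow> \<phi> + \<psi> \<in> T n" "\<phi> \<in> T n \<Longrightarrow> \<psi> \<in> T n \<Longrightarrow> \<phi> - \<psi> \<in> T n"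
  "\<phi> \<in> T n \<Longrightarrow> fun_scale c \<phi> \<in> T n" "(\<And>x. x \<in> S \<Longrightarrow> h x \<in> T n) \<Longrightarrow> sum h S \<in> T n"
  unfolding tensor_component_def
  by (auto intro: fs.span_zero fs.span_add fs.span_diff fs.span_scale fs.span_sum)

lemma T_induct [consumes 1, case_names zero step]:
  assumes "\<phi> \<in> T n" "P 0"
    "\<And>c fs \<psi>. set fs \<subseteq> Vdual \<Longrightarrow> length fs = n \<Longrightarrow> \<psi> \<in> T n \<Longrightarrow> P \<psi> \<Longrightarrow> P (fun_scale c (pure_tensor fs) + \<psi>)"
  shows "P \<phi>"
proof -
  have "\<phi> \<in> T n \<and> P \<phi>"
    using assms(1)[unfolded tensor_component_def]
  proof (induction rule: fs.span_induct_alt)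
    case (step c x y)
    then obtain fs where "set fs \<subseteq> Vdual" "length fs = n" "x = pure_tensor fs" by blast
    thus ?case using step(2) assms(3)[of fs y c] T_pure[of fs]
      by (simp add: T_closed del: zero_fun_apply plus_fun_apply)
  qed (simp add: assms(2) T_closed del: zero_fun_apply plus_fun_apply)
  thus ?thesis ..
qed

lemma T_subset: "\<phi> \<in> T n \<Longrightarrow> \<phi> \<in> tensor_algebra scale A"
  unfolding tensor_component_def tensor_algebra_def by (erule fs.span_mono[THEN subsetD, rotated]) blast

lemma T_length: "\<phi> \<in> T n \<Longrightarrow> length vs \<noteq> n \<Longrightarrow> \<phi> vs = 0"
  by (induction rule: T_induct) (auto simp: pure_tensor_def)

lemma T_tcons:
  assumes "f \<in> Vdual" "\<psi> \<in> T n"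
  shows "tcons f \<psi> \<in> T (Suc n)"
  using assms(2)
proof (induction rule: T_induct)
  case (step c fs \<psi>)
  thus ?case
    using T_pure[of "f # fs"] assms(1) by (simp add: tcons_add tcons_scale pure_tensor_Cons T_closed
        del: zero_fun_apply plus_fun_apply)
qed (simp add: tcons_zero T_closed del: zero_fun_apply plus_fun_apply)

lemma T_tail: "\<phi> \<in> T (Suc n) \<Longrightarrow> (\<lambda>vs. \<phi> (v # vs)) \<in> T n"
proof (induction rule: T_induct)
  case zero
  thus ?case using T_closed(1)[of n] by (simp add: zero_fun_def)
next
  case (step c fs \<psi>)
  then obtain f gs where fs: "fs = f # gs" "set gs \<subseteq> Vdual" "length gs = n"
    by (auto simp: length_Suc_conv)
  have "(\<lambda>vs. (fun_scale c (pure_tensor fs) + \<psi>) (v # vs)) =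
      fun_scale (c * f v) (pure_tensor gs) + (\<lambda>vs. \<psi> (v # vs))"
    by (auto simp: fs pure_tensor_Cons fun_eq_iff)
  thus ?case using step(4) T_pure[of gs] fs by (simp add: T_closed)
qed

lemma T_tail_add:
  "\<phi> \<in> T n \<Longrightarrow> v \<in> A 1 \<Longrightarrow> w \<in> A 1 \<Longrightarrow> \<phi> ((v + w) # vs) = \<phi> (v # vs) + \<phi> (w # vs)"
proof (induction rule: T_induct)
  case (step c fs \<psi>)
  thus ?case by (cases fs) (auto simp: pure_tensor_Nil pure_tensor_Cons VdualD algebra_simps)
qed simp

lemma T_tail_scale:
  "\<phi> \<in> T n \<Longrightarrow> v \<in> A 1 \<Longrightarrow> \<phi> (scale r v # vs) = r * \<phi> (v # vs)"
proof (induction rule: T_induct)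
  case (step c fs \<psi>)
  thus ?case by (cases fs) (auto simp: pure_tensor_Nil pure_tensor_Cons VdualD algebra_simps)
qed simp

text \<open>The first letter is contracted with a basis and tensored back with the dual basis; this
  later reduces membership in the ideal to the contractions.\<close>

lemma T_expand:
  assumes "\<phi> \<in> T (Suc n)" and f: "\<And>g v. g \<in> Vdual \<Longrightarrow> g v = (\<Sum>x\<in>S. g x * f x v)"
  shows "\<phi> = (\<Sum>x\<in>S. tcons (f x) (\<lambda>vs. \<phi> (x # vs)))"
proof -
  have *: "\<phi> vs = (\<Sum>x\<in>S. tcons (f x) (\<lambda>vs. \<phi> (x # vs)) vs)" for vs
    using assms(1)
  proof (induction rule: T_induct)
    case zero
    thus ?case by (cases vs) auto
  next
    case (step c fs \<psi>)
    then obtain g gs where fs: "fs = g # gs" "g \<in> Vdual"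
      by (auto simp: length_Suc_conv)
    show ?case
    proof (cases vs)
      case Nil
      thus ?thesis using step by (simp add: fs pure_tensor_Cons)
    next
      case (Cons v ws)
      have "(\<Sum>x\<in>S. f x v * (c * (g x * pure_tensor gs ws) + \<psi> (x # ws))) =
          c * ((\<Sum>x\<in>S. g x * f x v) * pure_tensor gs ws) + (\<Sum>x\<in>S. f x v * \<psi> (x # ws))"
        by (simp add: sum.distrib sum_distrib_left sum_distrib_right algebra_simps)
      thus ?thesis using step(4) f[OF fs(2), of v] by (simp add: fs pure_tensor_Cons Cons)
    qed
  qed
  show ?thesis
    by (rule ext) (unfold fun_sum_apply, rule *)
qed

lemma QI_closed:
  "0 \<in> QI" "\<phi> \<in> QI \<Longrightarrow> \<psi> \<in> QI \<Longrightarrow> \<phi> + \<psi> \<in> QI" "(\<And>x. x \<in> S \<Longrightarrow> h x \<in> QI) \<Longrightarrow> sum h S \<in> QI"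
  unfolding quadratic_dual_ideal_def by (auto intro: fs.span_zero fs.span_add fs.span_sum)

lemma QI_base:
  "\<psi> \<in> tensor_algebra scale A \<Longrightarrow> \<phi> \<in> quadratic_orthogonal scale A \<Longrightarrow> \<chi> \<in> tensor_algebra scale A \<Longrightarrow>
    tensor_mult (tensor_mult \<psi> \<phi>) \<chi> \<in> QI"
  unfolding quadratic_dual_ideal_def by (rule fs.span_base) blast

lemma tensor_algebra_tcons:
  assumes "f \<in> Vdual" "\<psi> \<in> tensor_algebra scale A"
  shows "tcons f \<psi> \<in> tensor_algebra scale A"
  using assms(2) unfolding tensor_algebra_def
proof (induction rule: fs.span_induct_alt)
  case base
  thus ?case by (simp add: tcons_zero fs.span_zero del: zero_fun_apply plus_fun_apply)
next
  case (step c x y)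
  then obtain gs where "set gs \<subseteq> Vdual" "x = pure_tensor gs" by blast
  hence "tcons f x \<in> fs.span {pure_tensor fs | fs. set fs \<subseteq> Vdual}"
    using assms(1) by (intro fs.span_base) (auto simp flip: pure_tensor_Cons intro!: exI[of _ "f # gs"])
  thus ?case using step(2)
    by (simp add: tcons_add tcons_scale fs.span_add fs.span_scale del: zero_fun_apply plus_fun_apply)
qed

lemma QI_tcons:
  assumes "f \<in> Vdual" "\<phi> \<in> QI"
  shows "tcons f \<phi> \<in> QI"
  using assms(2) unfolding quadratic_dual_ideal_def
proof (induction rule: fs.span_induct_alt)
  case base
  thus ?case by (simp add: tcons_zero fs.span_zero del: zero_fun_apply plus_fun_apply)
next
  case (step c x y)
  then obtain \<psi> \<phi> \<chi> where *: "x = tensor_mult (tensor_mult \<psi> \<phi>) \<chi>" "\<psi> \<in> tensor_algebra scale A"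
    "\<phi> \<in> quadratic_orthogonal scale A" "\<chi> \<in> tensor_algebra scale A" by blast
  have "tcons f x = tensor_mult (tensor_mult (tcons f \<psi>) \<phi>) \<chi>"
    by (simp add: * tensor_mult_tcons)
  hence "tcons f x \<in> QI" using * tensor_algebra_tcons[OF assms(1)] QI_base by simp
  thus ?case using step(2)
    by (simp add: tcons_add tcons_scale fs.span_add fs.span_scale quadratic_dual_ideal_def
        del: zero_fun_apply plus_fun_apply)
qed

text \<open>A linear form on \<open>A\<^sub>2\<close> pulls back along multiplication to an element of \<open>Q\<^sub>2\<^sup>\<bottom>\<close>.\<close>

lemma quadratic_orthogonalI:
  assumes add: "\<And>x y. \<theta> (x + y) = \<theta> x + \<theta> y" and scale: "\<And>c x. \<theta> (scale c x) = c * \<theta> x"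
  obtains q where "q \<in> quadratic_orthogonal scale A"
    "\<And>v w. v \<in> A 1 \<Longrightarrow> w \<in> A 1 \<Longrightarrow> q [v, w] = \<theta> (v * w)"
proof -
  obtain S f where S: "finite S" "S \<subseteq> A 1" "\<And>x. x \<in> S \<Longrightarrow> f x \<in> Vdual"
    "\<And>v. v \<in> A 1 \<Longrightarrow> v = (\<Sum>x\<in>S. scale (f x v) x)"
    by (rule dual_basis) blast
  define q where "q = (\<Sum>x\<in>S. \<Sum>y\<in>S. fun_scale (\<theta> (x * y)) (pure_tensor [f x, f y]))"
  have \<theta>0: "\<theta> 0 = 0" using scale[of 0 0] by simp
  have \<theta>_sum: "\<theta> (sum g R) = (\<Sum>x\<in>R. \<theta> (g x))" for g :: "'a \<Rightarrow> 'a" and R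
    by (induction R rule: infinite_finite_induct) (simp_all add: \<theta>0 add)
  have qv: "q [v, w] = \<theta> (v * w)" if "v \<in> A 1" "w \<in> A 1" for v w
  proof -
    have "\<theta> (v * w) = \<theta> ((\<Sum>x\<in>S. scale (f x v) x) * (\<Sum>y\<in>S. scale (f y w) y))"
      using S(4)[OF that(1)] S(4)[OF that(2)] by simp
    also have "\<dots> = (\<Sum>x\<in>S. \<Sum>y\<in>S. f x v * (f y w * \<theta> (x * y)))"
      by (simp add: sum_product scale_mult_left scale_mult_right \<theta>_sum scale mult.assoc mult.left_commute)
    also have "\<dots> = q [v, w]"
      by (simp add: q_def fun_sum_apply pure_tensor_Cons pure_tensor_Nil mult.commute mult.left_commute)
    finally show ?thesis ..
  qed
  have "q \<in> T 2"
    unfolding q_def using T_pure[of "[f x, f y]" for x y] S(3)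
    by (auto intro!: T_closed(4,5) simp: numeral_2_eq_2)
  moreover have "(\<Sum>(v, w)\<leftarrow>ps. q [v, w]) = \<theta> (\<Sum>(v, w)\<leftarrow>ps. v * w)"
    if "set ps \<subseteq> A 1 \<times> A 1" for ps
    using that by (induction ps) (auto simp: \<theta>0 add qv)
  ultimately have "q \<in> quadratic_orthogonal scale A"
    by (simp add: quadratic_orthogonal_def \<theta>0)
  thus thesis using qv that by blast
qed

text \<open>A form that vanishes on the kernel of \<open>L\<close> in \<open>X\<close> descends to
  the image of \<open>X\<close>. It is prescribed through preimages on a basis of the span of that
  image and extended linearly to the whole space.\<close>

lemma linear_form_factor:
  fixes L :: "'a vec \<Rightarrow> 'a vec" and H :: "'a vec \<Rightarrow> 'k"
  assumes X: "V.subspace X"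
    and l: "\<And>x y. L (x + y) = L x + L y" "\<And>c x. L (vscale c x) = vscale c (L x)"
    and H: "\<And>x y. x \<in> X \<Longrightarrow> y \<in> X \<Longrightarrow> H (x + y) = H x + H y"
      "\<And>c x. x \<in> X \<Longrightarrow> H (vscale c x) = c * H x"
    and ker: "\<And>x. x \<in> X \<Longrightarrow> L x = 0 \<Longrightarrow> H x = 0"
  obtains \<Theta> where "\<And>x y. \<Theta> (x + y) = \<Theta> x + \<Theta> y" "\<And>c x. \<Theta> (vscale c x) = c * \<Theta> x"
    "\<And>x. x \<in> X \<Longrightarrow> \<Theta> (L x) = H x"
proof -
  interpret vp: vector_space_pair "\<lambda>c. free_scale (scale c 1) :: 'a vec \<Rightarrow> _" "(*) :: 'k \<Rightarrow> 'k \<Rightarrow> 'k"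
    by unfold_locales (auto simp: algebra_simps)
  obtain Bs where Bs: "Bs \<subseteq> L ` X" "V.independent Bs" "L ` X \<subseteq> V.span Bs"
    using V.maximal_independent_subset by metis
  define p where "p = (\<lambda>y. SOME x. x \<in> X \<and> L x = y)"
  have p: "p y \<in> X \<and> L (p y) = y" if "y \<in> L ` X" for y
    unfolding p_def by (rule someI_ex) (use that in auto)
  obtain \<Theta> where lin: "Vector_Spaces.linear (\<lambda>c. free_scale (scale c 1)) (*) \<Theta>"
    and \<Theta>: "\<And>y. y \<in> Bs \<Longrightarrow> \<Theta> y = H (p y)"
    using vp.linear_independent_extend[OF Bs(2), of "\<lambda>y. H (p y)"] by blast
  interpret \<Theta>: Vector_Spaces.linear "\<lambda>c. free_scale (scale c 1) :: 'a vec \<Rightarrow> _" "(*) :: 'k \<Rightarrow> 'k \<Rightarrow> 'k" \<Theta>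
    by (rule lin)
  have "\<forall>x\<in>X. L x = y \<longrightarrow> \<Theta> y = H x" if "y \<in> V.span Bs" for y
    using that
  proof (induction rule: V.span_induct_alt)
    case base
    show ?case using ker \<Theta>.zero by simp
  next
    case (step c y z)
    show ?case
    proof (intro ballI impI)
      fix x assume x: "x \<in> X" "L x = vscale c y + z"
      have py: "p y \<in> X" "L (p y) = y" using p[of y] step(1) Bs(1) by auto
      let ?d = "vscale (- c) (p y)"
      have d: "?d \<in> X" by (rule V.subspace_scale[OF X py(1)])
      have xd: "x + ?d \<in> X" by (rule V.subspace_add[OF X x(1) d])
      have "vscale c y + vscale (- c) y = 0"
        using V.scale_left_distrib[of c "- c" y] V.scale_zero_left[of y] by simp
      hence "L (x + ?d) = z"
        unfolding l py x(2) by (simp add: add.assoc add.commute add.left_commute)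
      hence "\<Theta> z = H (x + ?d)" using step(2) xd by blast
      also have "\<dots> = H x - c * H (p y)"
        using H(1)[OF x(1) d] H(2)[OF py(1), of "- c"] by simp
      finally show "\<Theta> (vscale c y + z) = H x"
        using \<Theta>[OF step(1)] \<Theta>.add \<Theta>.scale by simp
    qed
  qed
  hence "\<Theta> (L x) = H x" if "x \<in> X" for x
    using Bs(3) that by blast
  thus thesis using \<Theta>.add \<Theta>.scale that by blast
qed

lemma T_tensor_mult:
  assumes "\<psi> \<in> T p" "\<tau> \<in> T n"
  shows "tensor_mult \<psi> \<tau> \<in> T (p + n)"
  using assms(1)
proof (induction rule: T_induct)
  case zero
  show ?case by (simp only: tensor_mult_zero_left T_closed)
next
  case (step c fs \<psi>)
  have "tensor_mult (pure_tensor fs) \<tau> \<in> T (length fs + n)"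
    using step(1) by (induction fs)
      (auto simp: tensor_mult_Nil assms(2) pure_tensor_Cons tensor_mult_tcons intro: T_tcons)
  thus ?case using step(2,4)
    by (simp only: tensor_mult_add_left tensor_mult_scale_left T_closed)
qed

text \<open>\<open>q\<close> sees only words of length 2, so of all cuts in the convolution only the
  one after two letters survives.\<close>

lemma tensor_mult_T2:
  assumes "q \<in> T 2"
  shows "tensor_mult q \<chi> [] = 0" "tensor_mult q \<chi> [v] = 0"
    "tensor_mult q \<chi> (v # w # vs) = q [v, w] * \<chi> vs"
proof -
  note len = T_length[OF assms]
  show "tensor_mult q \<chi> [] = 0" "tensor_mult q \<chi> [v] = 0"
    by (auto simp: tensor_mult_def len)
  have "tensor_mult q \<chi> (v # w # vs) =
      (\<Sum>p\<le>Suc (Suc (length vs)). if p = 2 then q [v, w] * \<chi> vs else 0)"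
    unfolding tensor_mult_def
    by (intro sum.cong) (auto simp: len numeral_2_eq_2 min_def)
  thus "tensor_mult q \<chi> (v # w # vs) = q [v, w] * \<chi> vs" by (simp del: sum.atMost_Suc)
qed

lemma quadratic_orthogonal_T2: "q \<in> quadratic_orthogonal scale A \<Longrightarrow> q \<in> T 2"
  by (simp add: quadratic_orthogonal_def)

end

text \<open>The linear resolution of \<open>k\<close> in matrix form: row \<open>b\<close> of the
  \<open>n\<close>-th differential is \<open>s n b\<close>, with entries in \<open>A 1\<close>. The
  type variables are renamed here: \<open>'a\<close> is the field and \<open>'b\<close> the
  algebra.\<close>

locale koszul_data = standard_graded_algebra +
  fixes B :: "nat \<Rightarrow> nat set" and s :: "nat \<Rightarrow> nat \<Rightarrow> 'b vec" and b0 :: nat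
  assumes finB: "finite (B n)" and B0: "B 0 = {b0}"
    and sV: "b \<in> B (Suc n) \<Longrightarrow> s n b \<in> Vec 1" and sfree: "b \<in> B (Suc n) \<Longrightarrow> s n b \<in> free (B n)"
    and im0: "lmap (s 0) ` free (B 1) = mfree {b0}"
    and exact: "Syz (B (Suc n)) (s n) = lmap (s (Suc n)) ` free (B (Suc (Suc n)))"
begin

text \<open>
  The \<open>b\<close>-th generator of the \<open>n\<close>-th module of the resolution, unfolded by the differentials
  into an element of \<open>V\<^bsup>\<otimes>n\<^esup>\<close>, defines a linear form on \<open>T(V\<^sup>*)\<^sub>n\<close>; \<open>Phi n \<phi> b\<close> is its value at \<open>\<phi>\<close>.
\<close>

primrec Phi :: "nat \<Rightarrow> ('b list \<Rightarrow> 'a) \<Rightarrow> nat \<Rightarrow> 'a" where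
  "Phi 0 \<phi> b = \<phi> []"
| "Phi (Suc n) \<phi> b = (\<Sum>c\<in>B n. Phi n (\<lambda>vs. \<phi> (lookup (s n b) c # vs)) c)"

lemma Phi_add: "Phi n (\<lambda>vs. \<phi> vs + \<psi> vs) b = Phi n \<phi> b + Phi n \<psi> b"
  by (induction n arbitrary: \<phi> \<psi> b) (auto simp: sum.distrib)

lemma Phi_scale: "Phi n (\<lambda>vs. k * \<phi> vs) b = k * Phi n \<phi> b"
  by (induction n arbitrary: \<phi> b) (auto simp: sum_distrib_left)

lemma Phi_plus: "Phi n (\<phi> + \<psi>) b = Phi n \<phi> b + Phi n \<psi> b"
  using Phi_add[of n \<phi> \<psi> b] by (simp add: plus_fun_def)

lemma Phi_zero: "Phi n (\<lambda>_. 0) b = 0"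
  by (induction n arbitrary: b) auto

lemma Phi_sum: "Phi n (sum h S) b = (\<Sum>x\<in>S. Phi n (h x) b)"
proof (induction S rule: infinite_finite_induct)
  case (insert x S)
  thus ?case using Phi_add[of n "h x" "sum h S" b] by (simp add: plus_fun_def)
qed (simp_all add: zero_fun_def Phi_zero)

lemma Phi_diff: "Phi n (\<phi> - \<psi>) b = Phi n \<phi> b - Phi n \<psi> b"
  using Phi_add[of n "\<phi> - \<psi>" \<psi> b] by (simp add: algebra_simps)

lemma Phi_tcons: "Phi (Suc n) (tcons f Y) b = (\<Sum>c\<in>B n. f (lookup (s n b) c) * Phi n Y c)"
  by (simp add: Phi_scale)

text \<open>Consecutive differentials compose to zero. In coordinates, with left coefficients in
  this order, every entry is a relation between products of two elements of \<open>A 1\<close>, that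
  is, it gives an element of \<open>Q_2\<close>.\<close>

lemma differential_squared:
  assumes "b \<in> B (Suc (Suc n))"
  shows "(\<Sum>c\<in>B (Suc n). lookup (s (Suc n) b) c * lookup (s n c) e) = 0"
proof -
  have "s (Suc n) b \<in> lmap (s (Suc n)) ` free (B (Suc (Suc n)))"
    using assms by (intro image_eqI[of _ _ "single b 1"]) auto
  hence "lmap (s n) (s (Suc n) b) = 0"
    by (simp add: exact[symmetric] Syz_def)
  moreover have "lookup (lmap (s n) (s (Suc n) b)) e =
      (\<Sum>c\<in>B (Suc n). lookup (s (Suc n) b) c * lookup (s n c) e)"
    using lmap_superset[OF finB, of "s (Suc n) b" "Suc n" "s n"] sfree[OF assms]
    by (simp add: free_def lookup_sum)
  ultimately show ?thesis by simp
qed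

text \<open>A factor from \<open>quadratic_orthogonal\<close> is evaluated at the entries of two
  consecutive differentials, which form an element of \<open>Q_2\<close>, so the result is zero. The
  factors in front of it are consumed one at a time by \<open>Phi_tcons\<close>.\<close>

lemma Phi_QI:
  assumes "\<phi> \<in> QI" "b \<in> B n"
  shows "Phi n \<phi> b = 0"
proof -
  have base: "Phi n (tensor_mult \<phi> \<chi>) b = 0"
    if \<phi>: "\<phi> \<in> quadratic_orthogonal scale A" and b: "b \<in> B n" for \<phi> \<chi> n b
  proof -
    note mult = tensor_mult_T2[OF quadratic_orthogonal_T2[OF \<phi>]]
    consider "n = 0" | "n = 1" | m where "n = Suc (Suc m)"
      by (metis One_nat_def not0_implies_Suc)
    thus ?thesis
    proof cases
      case (3 m)
      have "(\<Sum>c\<in>B (Suc m). \<phi> [lookup (s (Suc m) b) c, lookup (s m c) e]) = 0" for e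
      proof -
        \<comment> \<open>\<open>quadratic_orthogonal\<close> speaks of lists of pairs, so the sum
          over the basis is written as a list.\<close>
        define L where "L = sorted_list_of_set (B (Suc m))"
        define ps where "ps = map (\<lambda>c. (lookup (s (Suc m) b) c, lookup (s m c) e)) L"
        have L: "distinct L" "set L = B (Suc m)" using finB by (simp_all add: L_def)
        have "set ps \<subseteq> A 1 \<times> A 1"
          using L sV b 3 by (auto simp: ps_def Vec_def)
        moreover have "(\<Sum>(v, w)\<leftarrow>ps. v * w) = 0"
          using differential_squared[of b m e] b 3 L
          by (simp add: ps_def comp_def sum_list_distinct_conv_sum_set)
        ultimately have "(\<Sum>(v, w)\<leftarrow>ps. \<phi> [v, w]) = 0"
          using \<phi> by (simp add: quadratic_orthogonal_def)
        thus ?thesis using L by (simp add: ps_def comp_def sum_list_distinct_conv_sum_set)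
      qed
      moreover have "Phi n (tensor_mult \<phi> \<chi>) b =
          (\<Sum>c\<in>B (Suc m). \<Sum>e\<in>B m. \<phi> [lookup (s (Suc m) b) c, lookup (s m c) e] * Phi m \<chi> e)"
        by (simp add: 3 mult Phi_scale)
      ultimately show ?thesis
        by (subst (asm) sum.swap) (simp flip: sum_distrib_right)
    qed (simp_all add: mult)
  qed
  have pure: "Phi n (tensor_mult (tensor_mult (pure_tensor fs) \<phi>) \<chi>) b = 0"
    if "\<phi> \<in> quadratic_orthogonal scale A" "b \<in> B n" for fs \<phi> \<chi> n b
    using that(2)
  proof (induction fs arbitrary: n b)
    case Nil
    thus ?case using base that(1) by (simp add: tensor_mult_Nil)
  next
    case (Cons f fs)
    show ?case
    proof (cases n)
      case (Suc m)
      thus ?thesis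
        using Cons.IH[of _ m] by (simp only: pure_tensor_Cons tensor_mult_tcons Phi_tcons) simp
    qed (simp add: pure_tensor_Cons tensor_mult_tcons)
  qed
  have gen: "Phi n (tensor_mult (tensor_mult \<psi> \<phi>) \<chi>) b = 0"
    if "\<psi> \<in> tensor_algebra scale A" and \<phi>: "\<phi> \<in> quadratic_orthogonal scale A" for \<psi> \<phi> \<chi>
    using that(1) unfolding tensor_algebra_def
  proof (induction rule: fs.span_induct_alt)
    case base
    have "Phi n 0 b = 0" using Phi_zero[of n b] by (simp only: zero_fun_def)
    thus ?case by (simp only: tensor_mult_zero_left)
  next
    case (step c x y)
    then obtain fs where "x = pure_tensor fs" by blast
    thus ?case
      using step(2) pure[OF \<phi> assms(2)]
      by (simp only: tensor_mult_add_left tensor_mult_scale_left Phi_plus Phi_scale) simp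
  qed
  show ?thesis
    using assms(1) unfolding quadratic_dual_ideal_def
  proof (induction rule: fs.span_induct_alt)
    case base
    show ?case using Phi_zero[of n b] by (simp only: zero_fun_def)
  next
    case (step c x y)
    thus ?case using gen by (simp only: Phi_plus Phi_scale) auto
  qed
qed

lemma kernel_vpart: "f \<in> Syz (B (Suc n)) (s n) \<Longrightarrow> vpart 0 f = 0"
  using vpart_lmap_low[of _ "B (Suc (Suc n))" "s (Suc n)" 1 0] sV by (auto simp: exact)

lemma s_independent: "inj_on (s n) (B (Suc n)) \<and> V.independent (s n ` B (Suc n))"
  unfolding V.independent_family_iff[OF finB] lmap_svec[symmetric]
proof (intro allI impI)
  fix c assume "lmap (s n) (svec (B (Suc n)) c) = 0"
  hence "vpart 0 (svec (B (Suc n)) c) = 0"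
    using svec_in(1) by (intro kernel_vpart) (auto simp: Syz_def)
  hence "svec (B (Suc n)) c = 0" using vpart_Vec[OF svec_in(2), of 0] by simp
  thus "\<forall>i\<in>B (Suc n). c i = 0" using svec_eq_0_iff[OF finB] by blast
qed

text \<open>Independence of the rows allows a linear form \<open>L\<close> with
  \<open>L (s n b) = g b\<close>. Its restrictions \<open>f c\<close> to the coordinates, tensored
  with elements \<open>\<tau> c\<close> dual to the generators of the stage below, add up to the
  required tensor.\<close>

lemma Phi_surj: "\<exists>\<phi>\<in>T n. \<forall>b\<in>B n. Phi n \<phi> b = g b"
proof (induction n arbitrary: g)
  case 0
  have "pure_tensor [] \<in> T 0" using T_pure[of "[]"] by simp
  hence "fun_scale (g b0) (pure_tensor []) \<in> T 0" by (rule T_closed(4))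
  moreover have "\<forall>b\<in>B 0. Phi 0 (fun_scale (g b0) (pure_tensor [])) b = g b"
    by (simp add: B0 pure_tensor_Nil)
  ultimately show ?case by blast
next
  case (Suc n)
  interpret vp: vector_space_pair "\<lambda>c. free_scale (scale c 1) :: 'b vec \<Rightarrow> _" "(*) :: 'a \<Rightarrow> 'a \<Rightarrow> 'a"
    by unfold_locales (auto simp: algebra_simps)
  obtain L where lin: "Vector_Spaces.linear (\<lambda>c. free_scale (scale c 1)) (*) L"
    and L: "\<And>x. x \<in> s n ` B (Suc n) \<Longrightarrow> L x = g (the_inv_into (B (Suc n)) (s n) x)"
    using vp.linear_independent_extend[OF conjunct2[OF s_independent],
        of _ "\<lambda>x. g (the_inv_into (B (Suc _)) (s _) x)"] by blast
  interpret L: Vector_Spaces.linear "\<lambda>c. free_scale (scale c 1) :: 'b vec \<Rightarrow> _" "(*) :: 'a \<Rightarrow> 'a \<Rightarrow> 'a" L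
    by (rule lin)
  have Ls: "L (s n b) = g b" if "b \<in> B (Suc n)" for b
    using L[of "s n b"] that the_inv_into_f_f[OF conjunct1[OF s_independent]] by simp
  define f where "f = (\<lambda>c v. if v \<in> A 1 then L (single c v) else 0)"
  have f: "f c \<in> Vdual" for c
  proof -
    have "L (single c (v + w)) = L (single c v) + L (single c w)" for v w
      by (simp add: single_add L.add)
    moreover have "L (single c (scale r v)) = r * L (single c v)" for r v
      using L.scale[of r "single c v"] by simp
    ultimately show ?thesis
      by (auto simp: f_def dual_space_def component_add component_scale)
  qed
  have "\<exists>\<phi>\<in>T n. \<forall>b\<in>B n. Phi n \<phi> b = (if b = c then 1 else 0)" for c
    by (rule Suc)
  then obtain \<tau> where \<tau>: "\<And>c. \<tau> c \<in> T n" "\<And>c b. b \<in> B n \<Longrightarrow> Phi n (\<tau> c) b = (if b = c then 1 else 0)"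
    by metis
  define \<phi> where "\<phi> = (\<Sum>c\<in>B n. tcons (f c) (\<tau> c))"
  have "\<phi> \<in> T (Suc n)"
    unfolding \<phi>_def using f \<tau>(1) by (intro T_closed(5) T_tcons)
  moreover have "Phi (Suc n) \<phi> b = g b" if b: "b \<in> B (Suc n)" for b
  proof -
    have "Phi (Suc n) \<phi> b = (\<Sum>c\<in>B n. \<Sum>c'\<in>B n. f c (lookup (s n b) c') * Phi n (\<tau> c) c')"
      unfolding \<phi>_def Phi_sum Phi_tcons ..
    also have "\<dots> = (\<Sum>c\<in>B n. \<Sum>c'\<in>B n. if c' = c then f c (lookup (s n b) c) else 0)"
      by (intro sum.cong) (auto simp: \<tau>(2))
    also have "\<dots> = (\<Sum>c\<in>B n. L (single c (lookup (s n b) c)))"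
      using finB sV[OF b] by (auto simp: f_def Vec_def intro!: sum.cong)
    also have "\<dots> = L (\<Sum>c\<in>B n. single c (lookup (s n b) c))"
      by (simp add: L.sum)
    also have "(\<Sum>c\<in>B n. single c (lookup (s n b) c)) = s n b"
      using lmap_superset[OF finB, of "s n b" n "\<lambda>b. single b 1"] sfree[OF b] by (simp add: free_def)
    finally show ?thesis using Ls[OF b] by simp
  qed
  ultimately show ?case by blast
qed

text \<open>Induction on \<open>n\<close> by contracting the first letter. The contractions of
  \<open>\<phi>\<close> need not be killed by \<open>Phi n\<close>, so \<open>\<phi>\<close> is
  first corrected by an element \<open>\<phi>2\<close> of the ideal. The form \<open>H\<close> on
  the degree-1 part \<open>X\<close> of the \<open>n\<close>-th module vanishes on boundaries, which
  are the kernel of the preceding differential; it therefore factors through degree 2 of the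
  preceding module, and the pullbacks to \<open>V \<otimes> V\<close> are the \<open>q e\<close>
  from which \<open>\<phi>2\<close> is made.\<close>

lemma Phi_ker:
  assumes "\<phi> \<in> T n" "\<And>b. b \<in> B n \<Longrightarrow> Phi n \<phi> b = 0"
  shows "\<phi> \<in> QI"
  using assms
proof (induction n arbitrary: \<phi>)
  case 0
  have "\<phi> [] = 0" using 0(2)[of b0] by (simp add: B0)
  hence "\<phi> vs = 0" for vs using T_length[OF 0(1), of vs] by (cases vs) auto
  hence "\<phi> = 0" by auto
  thus ?case using QI_closed(1) by (simp only:)
next
  case (Suc n)
  obtain S f where S: "finite S" "S \<subseteq> A 1" "\<And>x. x \<in> S \<Longrightarrow> f x \<in> Vdual"
    "\<And>g v. g \<in> Vdual \<Longrightarrow> g v = (\<Sum>x\<in>S. g x * f x v)"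
    by (rule dual_basis) blast
  have reduce: "\<phi>' \<in> QI" if \<phi>': "\<phi>' \<in> T (Suc n)"
    and tail: "\<And>v c. v \<in> A 1 \<Longrightarrow> c \<in> B n \<Longrightarrow> Phi n (\<lambda>vs. \<phi>' (v # vs)) c = 0" for \<phi>'
  proof -
    have "(\<lambda>vs. \<phi>' (x # vs)) \<in> QI" if "x \<in> S" for x
      using T_tail[OF \<phi>'] tail S(2) that by (intro Suc.IH) auto
    hence "(\<Sum>x\<in>S. tcons (f x) (\<lambda>vs. \<phi>' (x # vs))) \<in> QI"
      using S(3) by (intro QI_closed(3) QI_tcons)
    moreover have "\<phi>' = (\<Sum>x\<in>S. tcons (f x) (\<lambda>vs. \<phi>' (x # vs)))"
      by (rule T_expand[OF \<phi>']) (rule S(4))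
    ultimately show ?thesis by (rule ssubst[rotated])
  qed
  define X where "X = {x \<in> free (B n). x \<in> Vec 1}"
  \<comment> \<open>All contractions at once: at \<open>v\<close> in coordinate \<open>c\<close> the
    form has the value of \<open>Phi n\<close> at the contraction of \<open>\<phi>\<close> by
    \<open>v\<close>, and \<open>H (s n b)\<close> is \<open>Phi (Suc n) \<phi> b\<close>, which is
    zero.\<close>
  define H where "H = (\<lambda>x. \<Sum>c\<in>B n. Phi n (\<lambda>vs. \<phi> (lookup x c # vs)) c)"
  have X: "V.subspace X"
    by (auto simp: X_def V.subspace_def free_closed Vec_closed)
  have XA: "lookup x c \<in> A 1" if "x \<in> X" for x c
    using that by (auto simp: X_def Vec_def)
  have H_add: "H (x + y) = H x + H y" if "x \<in> X" "y \<in> X" for x y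
    unfolding H_def sum.distrib[symmetric] Phi_add[symmetric] lookup_add
    by (simp only: T_tail_add[OF Suc.prems(1) XA[OF that(1)] XA[OF that(2)]])
  have H_scale: "H (vscale r x) = r * H x" if "x \<in> X" for r x
    unfolding H_def sum_distrib_left Phi_scale[symmetric] lookup_free_scale scale_one_mult
    by (simp only: T_tail_scale[OF Suc.prems(1) XA[OF that]])
  have H_single: "H (single c v) = Phi n (\<lambda>vs. \<phi> (v # vs)) c" if "c \<in> B n" "v \<in> A 1" for c v
  proof -
    have "\<phi> (0 # vs) = 0" for vs
      using T_tail_scale[OF Suc.prems(1) zero_in_component, of 0 vs] by simp
    hence "H (single c v) = (\<Sum>c'\<in>B n. if c' = c then Phi n (\<lambda>vs. \<phi> (v # vs)) c else 0)"
      unfolding H_def by (intro sum.cong) (auto simp: lookup_single Phi_zero)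
    thus ?thesis using finB that by simp
  qed
  \<comment> \<open>A boundary of degree 1 is a scalar combination of the rows \<open>s n b\<close>,
    on each of which \<open>H\<close> vanishes.\<close>
  have H_im: "H x = 0" if x: "x \<in> X" "x \<in> lmap (s n) ` free (B (Suc n))" for x
  proof -
    obtain g where g: "g \<in> free (B (Suc n))" "x = lmap (s n) g" using x(2) by blast
    have "x = vpart 1 x" using vpart_Vec[of x 1 1] x(1) by (simp add: X_def)
    also have "\<dots> = lmap (s n) (vpart 0 g)"
      unfolding g(2) using vpart_lmap[OF g(1) sV, where i = 0] by simp
    finally have "x = lmap (s n) (vpart 0 g)" .
    moreover obtain k where "vpart 0 g = svec (B (Suc n)) k"
      using svec_ex[OF finB vpart_free[OF g(1)] vpart_in_Vec] by blast
    ultimately have xk: "x = (\<Sum>b\<in>B (Suc n). vscale (k b) (s n b))"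
      by (simp add: lmap_svec)
    have sX: "s n b \<in> X" if "b \<in> B (Suc n)" for b
      using sV sfree that by (simp add: X_def)
    have "H (\<Sum>b\<in>R. vscale (k b) (s n b)) = 0" if "R \<subseteq> B (Suc n)" for R
      using finite_subset[OF that finB] that
    proof (induction R)
      case empty
      have "H 0 = 0" using H_scale[of 0 0] V.subspace_0[OF X] by simp
      thus ?case by simp
    next
      case (insert b R)
      have "s n b \<in> X" "(\<Sum>b\<in>R. vscale (k b) (s n b)) \<in> X"
        using insert.prems sX by (auto intro!: V.subspace_sum[OF X] V.subspace_scale[OF X])
      moreover have "H (s n b) = 0"
        using Suc.prems(2)[of b] insert.prems by (simp add: H_def)
      ultimately show ?case
        using insert by (simp add: H_add H_scale V.subspace_scale[OF X])
    qed
    thus ?thesis using xk by blast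
  qed
  show ?case
  proof (cases n)
    \<comment> \<open>On the first module the boundaries are all of \<open>\<mm>\<close>, so
      \<open>H\<close> is zero and \<open>\<phi>\<close> can be reduced without a
      correction.\<close>
    case 0
    have "H x = 0" if "x \<in> X" for x
    proof (rule H_im[OF that])
      have "x \<in> mfree {b0}"
        using that vpart_Vec[of x 1 0] by (simp add: X_def mfree_def 0 B0)
      thus "x \<in> lmap (s n) ` free (B (Suc n))" using im0 by (simp add: 0)
    qed
    moreover have "single c v \<in> X" if "c \<in> B n" "v \<in> A 1" for c v
      using that by (auto simp: X_def intro: Vec_single)
    ultimately show ?thesis
      using H_single by (intro reduce[OF Suc.prems(1)]) metis
  next
    case (Suc m)
    have ker: "H x = 0" if "x \<in> X" "lmap (s m) x = 0" for x
      using that exact[of m] by (intro H_im) (auto simp: Suc X_def Syz_def)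
    obtain \<Theta> where \<Theta>: "\<And>x y. \<Theta> (x + y) = \<Theta> x + \<Theta> y"
      "\<And>c x. \<Theta> (vscale c x) = c * \<Theta> x" "\<And>x. x \<in> X \<Longrightarrow> \<Theta> (lmap (s m) x) = H x"
    proof (rule linear_form_factor[OF X, of "lmap (s m)" H])
      fix \<Theta> :: "'b vec \<Rightarrow> 'a"
      assume "\<And>x y. \<Theta> (x + y) = \<Theta> x + \<Theta> y" "\<And>c x. \<Theta> (vscale c x) = c * \<Theta> x"
        "\<And>x. x \<in> X \<Longrightarrow> \<Theta> (lmap (s m) x) = H x"
      thus thesis by (rule that)
    qed (simp_all add: lmap_add lmap_scale H_add H_scale ker)
    have \<Theta>_sum: "\<Theta> (sum h R) = (\<Sum>x\<in>R. \<Theta> (h x))" for h :: "nat \<Rightarrow> _" and R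
      using \<Theta>(2)[of 0 0] by (induction R rule: infinite_finite_induct) (simp_all add: \<Theta>(1))
    have "\<exists>q. q \<in> quadratic_orthogonal scale A \<and>
        (\<forall>v w. v \<in> A 1 \<longrightarrow> w \<in> A 1 \<longrightarrow> q [v, w] = \<Theta> (single e (v * w)))" for e
    proof -
      have 1: "\<Theta> (single e (x + y)) = \<Theta> (single e x) + \<Theta> (single e y)" for x y
        by (simp add: single_add \<Theta>(1))
      have 2: "\<Theta> (single e (scale c x)) = c * \<Theta> (single e x)" for c x
        using \<Theta>(2)[of c "single e x"] by simp
      show ?thesis
        by (rule quadratic_orthogonalI[of "\<lambda>x. \<Theta> (single e x)"]) (use 1 2 in blast)+
    qed
    then obtain q where q: "\<And>e. q e \<in> quadratic_orthogonal scale A"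
      "\<And>e v w. v \<in> A 1 \<Longrightarrow> w \<in> A 1 \<Longrightarrow> q e [v, w] = \<Theta> (single e (v * w))" by metis
    have "\<exists>\<phi>\<in>T m. \<forall>b\<in>B m. Phi m \<phi> b = (if b = c then 1 else 0)" for c
      by (rule Phi_surj)
    then obtain \<tau> where \<tau>: "\<And>c. \<tau> c \<in> T m" "\<And>c b. b \<in> B m \<Longrightarrow> Phi m (\<tau> c) b = (if b = c then 1 else 0)"
      by metis
    \<comment> \<open>As \<open>\<tau>\<close> is dual to the generators of stage \<open>m\<close>,
      applying \<open>Phi n\<close> to the contraction of \<open>\<phi>2\<close> by \<open>v\<close>
      recovers \<open>\<Theta>\<close> at \<open>v\<close> times the row \<open>s m c\<close>, which
      is \<open>H (single c v)\<close>.\<close>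
    define \<phi>2 where "\<phi>2 = (\<Sum>e\<in>B m. tensor_mult (q e) (\<tau> e))"
    have \<phi>2T: "\<phi>2 \<in> T (Suc n)"
      unfolding \<phi>2_def using T_tensor_mult[OF quadratic_orthogonal_T2[OF q(1)] \<tau>(1)]
      by (intro T_closed(5)) (simp add: Suc)
    have \<phi>2QI: "\<phi>2 \<in> QI"
      unfolding \<phi>2_def
    proof (rule QI_closed(3))
      fix e
      have "pure_tensor [] \<in> tensor_algebra scale A" using T_subset[OF T_pure[of "[]"]] by simp
      from QI_base[OF this q(1) T_subset[OF \<tau>(1)]] show "tensor_mult (q e) (\<tau> e) \<in> QI"
        by (simp only: tensor_mult_Nil)
    qed
    have "\<phi> - \<phi>2 \<in> QI"
    proof (rule reduce[OF T_closed(3)[OF Suc.prems(1) \<phi>2T]])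
      fix v c assume v: "v \<in> A 1" and c: "c \<in> B n"
      have w: "lookup (s m c) e \<in> A 1" for e
        using sV c by (simp add: Suc Vec_def)
      have "Phi n (\<lambda>vs. \<phi>2 (v # vs)) c =
          (\<Sum>e'\<in>B m. Phi m (\<Sum>e\<in>B m. (\<lambda>vs. q e [v, lookup (s m c) e'] * \<tau> e vs)) e')"
        by (simp add: Suc \<phi>2_def fun_sum_apply[abs_def] tensor_mult_T2[OF quadratic_orthogonal_T2[OF q(1)]])
      also have "\<dots> = (\<Sum>e'\<in>B m. \<Sum>e\<in>B m. if e' = e then q e [v, lookup (s m c) e] else 0)"
        unfolding Phi_sum Phi_scale by (intro sum.cong) (auto simp: \<tau>(2))
      also have "\<dots> = (\<Sum>e\<in>B m. \<Theta> (single e (v * lookup (s m c) e)))"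
        using finB q(2)[OF v w] by simp
      also have "\<dots> = \<Theta> (free_scale v (s m c))"
      proof -
        have "s m c = (\<Sum>e\<in>B m. single e (lookup (s m c) e))"
          using lmap_superset[OF finB, of "s m c" m "\<lambda>b. single b 1"] sfree c by (simp add: free_def Suc)
        hence "free_scale v (s m c) = free_scale v (\<Sum>e\<in>B m. single e (lookup (s m c) e))"
          by (rule arg_cong)
        thus ?thesis by (simp add: free_scale_sum \<Theta>_sum)
      qed
      also have "\<dots> = H (single c v)"
        using \<Theta>(3)[of "single c v"] v c by (simp add: X_def Vec_single)
      finally have "Phi n (\<lambda>vs. \<phi>2 (v # vs)) c = Phi n (\<lambda>vs. \<phi> (v # vs)) c"
        using H_single[OF c v] by simp
      thus "Phi n (\<lambda>vs. (\<phi> - \<phi>2) (v # vs)) c = 0"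
        using Phi_diff[of n "\<lambda>vs. \<phi> (v # vs)" "\<lambda>vs. \<phi>2 (v # vs)" c] by (simp add: fun_diff_def)
    qed
    from QI_closed(2)[OF this \<phi>2QI] show ?thesis by (simp only: diff_add_cancel)
  qed
qed

text \<open>The forms given by \<open>Phi n\<close> at the \<open>b\<close> in \<open>B n\<close>
  are a basis: \<open>Phi_QI\<close> makes them vanish on the ideal, the dual tensors
  \<open>\<tau>\<close> make them independent, and by \<open>Phi_ker\<close> a tensor differs from
  its expansion in \<open>\<tau>\<close> by an element of the ideal, so they span.\<close>

lemma dim_quadratic_dual_star: "dim_quadratic_dual_star scale A n = card (B n)"
proof -
  have "\<exists>\<phi>\<in>T n. \<forall>b\<in>B n. Phi n \<phi> b = (if b = c then 1 else 0)" for c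
    by (rule Phi_surj)
  then obtain \<tau> where \<tau>: "\<And>c. \<tau> c \<in> T n" "\<And>c b. b \<in> B n \<Longrightarrow> Phi n (\<tau> c) b = (if b = c then 1 else 0)"
    by metis
  define \<xi> where "\<xi> = (\<lambda>b \<phi>. if \<phi> \<in> T n then Phi n \<phi> b else 0)"
  let ?Q = "quadratic_dual_star scale A n"
  have \<xi>Q: "\<xi> b \<in> ?Q" if "b \<in> B n" for b
  proof -
    have "\<xi> b \<in> dual_space fun_scale (T n)"
      using T_closed(2,4) Phi_add Phi_scale by (simp add: dual_space_def \<xi>_def plus_fun_def)
    moreover have "\<xi> b \<phi> = 0" if "\<phi> \<in> T n \<inter> QI" for \<phi>
      using Phi_QI[OF _ \<open>b \<in> B n\<close>] that by (simp add: \<xi>_def)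
    ultimately show ?thesis by (simp add: quadratic_dual_star_def)
  qed
  have ind: "inj_on \<xi> (B n) \<and> fs.independent (\<xi> ` B n)"
    unfolding fs.independent_family_iff[OF finB]
  proof (intro allI impI ballI)
    fix c b assume 0: "(\<Sum>i\<in>B n. fun_scale (c i) (\<xi> i)) = 0" and b: "b \<in> B n"
    have "(\<Sum>i\<in>B n. fun_scale (c i) (\<xi> i)) (\<tau> b) = (\<Sum>i\<in>B n. if i = b then c b else 0)"
      unfolding fun_sum_apply by (intro sum.cong) (auto simp: \<xi>_def \<tau>)
    thus "c b = 0" using 0 finB b by simp
  qed
  have "?Q \<subseteq> fs.span (\<xi> ` B n)"
  proof
    fix z assume z: "z \<in> ?Q"
    hence add: "\<And>x y. x \<in> T n \<Longrightarrow> y \<in> T n \<Longrightarrow> z (x + y) = z x + z y"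
      and scl: "\<And>c x. x \<in> T n \<Longrightarrow> z (fun_scale c x) = c * z x"
      and out: "\<And>x. x \<notin> T n \<Longrightarrow> z x = 0"
      and ker: "\<And>x. x \<in> T n \<Longrightarrow> x \<in> QI \<Longrightarrow> z x = 0"
      by (auto simp: quadratic_dual_star_def dual_space_def)
    have z0: "z 0 = 0" using ker T_closed(1) QI_closed(1) by blast
    have zsum: "z (sum h R) = (\<Sum>x\<in>R. z (h x))" if "finite R" and h: "\<And>x. h x \<in> T n"
      for h :: "nat \<Rightarrow> _" and R
      using that(1)
    proof (induction R)
      case empty
      show ?case by (simp only: sum.empty z0)
    next
      case (insert x R)
      have "z (h x + sum h R) = z (h x) + z (sum h R)"
        using h by (intro add T_closed(5))
      thus ?case using insert by (simp del: plus_fun_apply)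
    qed
    have "z \<phi> = (\<Sum>b\<in>B n. fun_scale (z (\<tau> b)) (\<xi> b)) \<phi>" for \<phi>
    proof (cases "\<phi> \<in> T n")
      case True
      define \<phi>' where "\<phi>' = (\<Sum>b\<in>B n. fun_scale (Phi n \<phi> b) (\<tau> b))"
      have \<phi>'T: "\<phi>' \<in> T n" unfolding \<phi>'_def by (intro T_closed(5) T_closed(4) \<tau>)
      have d: "\<phi> - \<phi>' \<in> T n" by (rule T_closed(3)[OF True \<phi>'T])
      have "Phi n (\<phi> - \<phi>') b = 0" if "b \<in> B n" for b
      proof -
        have "Phi n \<phi>' b = (\<Sum>b'\<in>B n. if b = b' then Phi n \<phi> b' else 0)"
          unfolding \<phi>'_def Phi_sum Phi_scale using \<tau>(2)[OF that] by (intro sum.cong) auto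
        thus ?thesis using finB that by (simp add: Phi_diff)
      qed
      hence "z (\<phi> - \<phi>') = 0" using ker[OF d] Phi_ker[OF d] by blast
      hence "z \<phi> = z \<phi>'" using add[OF d \<phi>'T] by (simp only: diff_add_cancel add_0)
      also have "\<dots> = (\<Sum>b\<in>B n. Phi n \<phi> b * z (\<tau> b))"
        unfolding \<phi>'_def by (subst zsum[OF finB T_closed(4)[OF \<tau>(1)]]) (simp only: scl[OF \<tau>(1)])
      also have "\<dots> = (\<Sum>b\<in>B n. fun_scale (z (\<tau> b)) (\<xi> b)) \<phi>"
        using True by (simp add: fun_sum_apply \<xi>_def mult.commute)
      finally show ?thesis .
    next
      case False
      thus ?thesis using out by (simp add: fun_sum_apply \<xi>_def)
    qed
    hence "z = (\<Sum>b\<in>B n. fun_scale (z (\<tau> b)) (\<xi> b))" by (rule ext)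
    thus "z \<in> fs.span (\<xi> ` B n)"
      unfolding fs.span_family[OF finB] by (rule exI[of _ "\<lambda>b. z (\<tau> b)"])
  qed
  moreover have "\<xi> ` B n \<subseteq> ?Q" using \<xi>Q by blast
  ultimately have "fs.dim ?Q = card (\<xi> ` B n)"
    using ind by (intro fs.dim_unique) auto
  thus ?thesis using card_image[of \<xi> "B n"] ind by (simp add: dim_quadratic_dual_star_def)
qed

end

context standard_graded_algebra
begin

section \<open>The resolutions of the powers and their quotients\<close>

lemma graded_free_resolutionI:
  fixes F :: "('a, 'm) resolution"
  assumes diff: "\<And>n. diff F n = lmap (dmap F n)"
    and D: "\<And>n b. b \<in> basis F (Suc n) \<Longrightarrow> dmap F n b \<in> rcomp F n (bdeg F (Suc n) b)"
    and e: "\<And>x. x \<in> rfree F 0 \<Longrightarrow> aug F x \<in> carr M"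
      "\<And>x y. x \<in> rfree F 0 \<Longrightarrow> y \<in> rfree F 0 \<Longrightarrow> aug F (x + y) = add_of M (aug F x) (aug F y)"
      "\<And>r x. x \<in> rfree F 0 \<Longrightarrow> aug F (free_scale r x) = act M r (aug F x)"
      "\<And>j x. x \<in> rcomp F 0 j \<Longrightarrow> aug F x \<in> comp_of M j"
    and surj: "carr M \<subseteq> aug F ` rfree F 0"
    and ker: "{x \<in> rfree F 0. aug F x = zero_of M} = lmap (dmap F 0) ` rfree F 1"
    and exact: "\<And>n. Syz (basis F (Suc n)) (dmap F n) = lmap (dmap F (Suc n)) ` rfree F (Suc (Suc n))"
  shows "graded_free_resolution A M F"
proof -
  have "lmap (dmap F n) x \<in> rfree F n" if "x \<in> rfree F (Suc n)" for n x
    using lmap_in_free[OF _ that] D fcomp_closed(4) by blast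
  moreover have "lmap (dmap F n) x \<in> rcomp F n j"
    if "x \<in> rcomp F (Suc n) j" for n x j
    using lmap_in_fcomp[OF that D] .
  ultimately show ?thesis
    unfolding graded_free_resolution_def graded_hom_def res_module_def free_module_simps comp_free_module
    using e surj ker exact by (auto simp: diff lmap_add lmap_scale Syz_def)
qed

lemma left_ideal_simps [simp]:
  "carr (left_ideal_module A I) = I" "zero_of (left_ideal_module A I) = 0"
  "add_of (left_ideal_module A I) = (+)" "act (left_ideal_module A I) = (*)"
  "comp_of (left_ideal_module A I) j = I \<inter> A j"
  by (simp_all add: left_ideal_module_def)

lemma grading_embedding_ideal: "grading_embedding (left_ideal_module A I) (\<lambda>x. x)"
  by (simp add: grading_embedding_def)

text \<open>\<open>A/\<mm>\<^sup>a\<close> is identified with the components of degree below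
  \<open>a\<close>; these depend only on the coset, so the choice of a representative is
  immaterial.\<close>

lemma grading_embedding_quotient:
  "grading_embedding (quotient_module A (Ipow a)) (\<lambda>C. \<Sum>i<a. part i (SOME x. C = x +o Ipow a))"
proof -
  define \<pi> where "\<pi> = (\<lambda>C. \<Sum>i<a. part i (SOME x. C = x +o Ipow a))"
  have \<pi>: "\<pi> (x +o Ipow a) = (\<Sum>i<a. part i x)" for x
  proof -
    define y where "y = (SOME y. x +o Ipow a = y +o Ipow a)"
    have "x +o Ipow a = y +o Ipow a"
      unfolding y_def by (rule someI[of _ x]) (rule refl)
    hence "x - y \<in> Ipow a" by (simp only: coset_eq_iff)
    hence "part i y = part i x" if "i < a" for i
      using that by (simp add: Ipow_def part_diff)
    thus ?thesis unfolding \<pi>_def y_def[symmetric] by simp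
  qed
  have eqI: "x +o Ipow a = y +o Ipow a" if "(\<Sum>i<a. part i x) = (\<Sum>i<a. part i y)" for x y
  proof -
    have "part j x = part j y" if "j < a" for j
      using arg_cong[OF \<open>(\<Sum>i<a. part i x) = (\<Sum>i<a. part i y)\<close>, of "part j"] that
      by (simp add: part_sum part_part)
    thus ?thesis unfolding coset_eq_iff by (simp add: Ipow_def part_diff)
  qed
  have "inj_on \<pi> (range (\<lambda>x. x +o Ipow a))"
  proof (rule inj_onI)
    fix X Y assume "X \<in> range (\<lambda>x. x +o Ipow a)" "Y \<in> range (\<lambda>x. x +o Ipow a)" and eq: "\<pi> X = \<pi> Y"
    then obtain x y where XY: "X = x +o Ipow a" "Y = y +o Ipow a" by blast
    show "X = Y" unfolding XY using eq by (intro eqI) (simp only: XY \<pi>)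
  qed
  moreover have "\<pi> (X + Y) = \<pi> X + \<pi> Y"
    if "X \<in> range (\<lambda>x. x +o Ipow a)" "Y \<in> range (\<lambda>x. x +o Ipow a)" for X Y
  proof -
    from that obtain x y where XY: "X = x +o Ipow a" "Y = y +o Ipow a" by blast
    show ?thesis unfolding XY coset_add \<pi> by (simp add: part_add sum.distrib)
  qed
  moreover have "\<pi> X \<in> A j" if "X \<in> (\<lambda>x. x +o Ipow a) ` A j" for X j
  proof -
    from that obtain x where X: "X = x +o Ipow a" "x \<in> A j" by blast
    show ?thesis unfolding X(1) \<pi> by (intro component_sum) (simp add: part_component[OF X(2)] X(2))
  qed
  ultimately have "grading_embedding (quotient_module A (Ipow a)) \<pi>"
    unfolding grading_embedding_def quotient_simps by blast
  thus ?thesis by (simp add: \<pi>_def)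
qed

text \<open>The resolution of the syzygies of \<open>t\<close> is preceded by \<open>t\<close>, read
  as an augmentation onto \<open>\<mm>\<^sup>a\<close>. For the quotient, \<open>t\<close> becomes
  the first differential, into a copy of \<open>A\<close> in degree 0, and \<open>a \<ge> 1\<close>
  makes that differential minimal.\<close>

lemma max_ideal_power_resolution:
  assumes \<omega>: "lin (mfree {b0}) \<omega>" and w: "w 0 = 1" "\<And>n. w (Suc n) = \<omega> n" and a: "a \<ge> 1"
  shows "\<exists>G. minimal_graded_free_resolution scale A (left_ideal_module A (Ipow a)) G \<and>
      (\<forall>n. \<forall>b\<in>basis G n. bdeg G n b = n + a) \<and>
      (\<forall>n. finite (basis G n) \<and> int (card (basis G n)) = power_rank w a n)" (is ?ideal)
    and "\<exists>G. minimal_graded_free_resolution scale A (quotient_module A (Ipow a)) G \<and>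
      basis G 0 = {0} \<and> bdeg G 0 0 = 0 \<and> (\<forall>n. \<forall>b\<in>basis G (Suc n). bdeg G (Suc n) b = n + a) \<and>
      (\<forall>n. finite (basis G n)) \<and> (\<forall>n. int (card (basis G (Suc n))) = power_rank w a n)" (is ?quotient)
proof -
  obtain C t \<rho> where C: "finite C" and t: "\<And>b. b \<in> C \<Longrightarrow> t b \<in> Vec a"
      "\<And>b. b \<in> C \<Longrightarrow> t b \<in> free {0}" and gen: "lmap t ` free C = Ivec a" and lin: "lin (Syz C t) \<rho>"
      and rank: "int (card C) = power_rank w a 0" "\<And>n. int (\<rho> n) = power_rank w a (Suc n)"
    using max_ideal_power_linear[OF \<omega> w, where a = a] by metis
  obtain E u where E: "\<And>n. finite (E n)" "\<And>n. card (E n) = \<rho> n"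
    "\<And>n b. b \<in> E n \<Longrightarrow> u n b \<in> Vec 1" "Syz C t = lmap (u 0) ` free (E 0)"
    "\<And>n. Syz (E n) (u n) = lmap (u (Suc n)) ` free (E (Suc n))"
    by (rule lin_resolution[OF lin]) blast
  have u_im: "u n b \<in> lmap (u n) ` free (E n)" if "b \<in> E n" for n b
    using that by (intro image_eqI[of _ _ "single b 1"]) auto
  have u0: "u 0 b \<in> free C" if "b \<in> E 0" for b
    using u_im[OF that] by (simp add: E(4)[symmetric] Syz_def)
  have uS: "u (Suc n) b \<in> free (E n)" if "b \<in> E (Suc n)" for n b
    using u_im[OF that] by (simp add: E(5)[symmetric] Syz_def)
  have fcompI: "x \<in> fcomp D (\<lambda>_. d) (i + d)" if "x \<in> free D" "x \<in> Vec i" for x D d i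
    using that by (simp add: fcomp_iff Vec_def)
  have mBI: "x \<in> mfree D" if "x \<in> free D" "x \<in> Vec i" "i \<ge> 1" for x D i
    using that vpart_Vec[OF that(2), of 0] by (simp add: mfree_def)
  have tfree: "lmap t x \<in> free {0}" if "x \<in> free C" for x
    using lmap_in_free[OF t(2) that] .
  have tcomp: "lmap t x \<in> fcomp {0} (\<lambda>_. 0) j" if "x \<in> fcomp C (\<lambda>_. a) j" for x j
  proof (rule lmap_in_fcomp[OF that])
    fix b assume "b \<in> C"
    thus "t b \<in> fcomp {0} (\<lambda>_. 0) a" using fcompI[of "t b" "{0}" a 0] t by simp
  qed
  have ker_t: "{x \<in> free C. lookup (lmap t x) 0 = 0} = Syz C t"
  proof -
    have "lmap t x = 0 \<longleftrightarrow> lookup (lmap t x) 0 = 0" if "x \<in> free C" for x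
      using tfree[OF that] by (auto simp: free_iff intro!: poly_mapping_eqI) (metis neq0_conv)
    thus ?thesis by (auto simp: Syz_def)
  qed
  have Ia_lookup: "lookup (lmap t x) 0 \<in> Ipow a" if "x \<in> free C" for x
    using gen that by (auto simp: Ivec_def Ipow_def)

  define G :: "('a, 'a) resolution" where
    "G = \<lparr>basis = case_nat C E, bdeg = (\<lambda>n _. n + a), diff = (\<lambda>n. lmap (u n)), aug = (\<lambda>x. lookup (lmap t x) 0)\<rparr>"
  have G: "basis G = case_nat C E" "bdeg G n = (\<lambda>_. n + a)" "diff G n = lmap (u n)"
    "aug G = (\<lambda>x. lookup (lmap t x) 0)" "dmap G n = u n" for n
  proof -
    show "dmap G n = u n" by (rule ext) (simp add: dmap_def G_def)
  qed (simp_all add: G_def)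
  have GD: "u n b \<in> rfree G n" if "b \<in> basis G (Suc n)" for n b
    using that u0 uS by (cases n) (simp_all add: G)
  have "graded_free_resolution A (left_ideal_module A (Ipow a)) G"
  proof (rule graded_free_resolutionI)
    show "dmap G n b \<in> rcomp G n (bdeg G (Suc n) b)" if "b \<in> basis G (Suc n)" for n b
      using fcompI[OF GD[OF that] E(3), of "n + a"] that by (simp add: G)
    show "aug G x \<in> comp_of (left_ideal_module A (Ipow a)) j"
      if "x \<in> rcomp G 0 j" for j x
    proof -
      have x: "x \<in> fcomp C (\<lambda>_. a) j" using that by (simp add: G)
      have "lookup (lmap t x) 0 \<in> A j" using tcomp[OF x] by (simp add: fcomp_iff)
      thus ?thesis using Ia_lookup[OF fcomp_closed(4)[OF x]] by (simp add: G)
    qed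
    show "carr (left_ideal_module A (Ipow a)) \<subseteq> aug G ` rfree G 0"
    proof
      fix x assume "x \<in> carr (left_ideal_module A (Ipow a))"
      hence "single 0 x \<in> lmap t ` free C" by (simp add: gen Ivec_def Ipow_def)
      then obtain f where "f \<in> free C" "lmap t f = single 0 x" by auto
      thus "x \<in> aug G ` rfree G 0" by (intro image_eqI[of _ _ f]) (simp_all add: G)
    qed
    show "{x \<in> rfree G 0. aug G x = zero_of (left_ideal_module A (Ipow a))} =
        lmap (dmap G 0) ` rfree G 1"
      using ker_t E(4) by (simp add: G)
  qed (auto simp: G lmap_add lookup_add lmap_scale E(5) Ia_lookup)
  hence "minimal_graded_free_resolution scale A (left_ideal_module A (Ipow a)) G"
    using mBI[OF GD E(3)] by (auto simp: minimal_iff G)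
  moreover have "finite (basis G n) \<and> int (card (basis G n)) = power_rank w a n" for n
    using C rank E(1,2) by (cases n) (simp_all add: G)
  ultimately show ?ideal by (intro exI[of _ G]) (simp add: G)

  define G' :: "('a, 'a set) resolution" where
    "G' = \<lparr>basis = case_nat {0} (case_nat C E), bdeg = case_nat (\<lambda>_. 0) (\<lambda>n _. n + a),
      diff = case_nat (lmap t) (\<lambda>n. lmap (u n)), aug = (\<lambda>x. lookup x 0 +o Ipow a)\<rparr>"
  have G': "basis G' = case_nat {0} (case_nat C E)" "bdeg G' = case_nat (\<lambda>_. 0) (\<lambda>n _. n + a)"
    "diff G' = case_nat (lmap t) (\<lambda>n. lmap (u n))" "aug G' = (\<lambda>x. lookup x 0 +o Ipow a)" by (simp_all add: G'_def)
  have dmapG': "dmap G' 0 = t" "dmap G' (Suc n) = u n" for n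
    by (simp_all add: dmap_def G' fun_eq_iff)
  have "graded_free_resolution A (quotient_module A (Ipow a)) G'"
  proof (rule graded_free_resolutionI)
    show "diff G' n = lmap (dmap G' n)" for n
      by (cases n) (simp_all add: dmapG', simp_all add: G')
    show "dmap G' n b \<in> rcomp G' n (bdeg G' (Suc n) b)"
      if "b \<in> basis G' (Suc n)" for n b
    proof (cases n)
      case 0
      thus ?thesis using that fcompI[OF t(2,1), of b 0] by (simp add: dmapG') (simp add: G')
    next
      case (Suc m)
      have bE: "b \<in> E m" "u m b \<in> free (case_nat C E m)"
        using that GD[of b m] by (simp_all add: Suc G' G)
      thus ?thesis using fcompI[OF bE(2) E(3)[OF bE(1)], of "m + a"] by (simp add: dmapG' Suc) (simp add: G')
    qed
    show "aug G' x \<in> carr (quotient_module A (Ipow a))" for x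
      by (simp add: G' quotient_simps)
    show "aug G' (x + y) = add_of (quotient_module A (Ipow a)) (aug G' x) (aug G' y)" for x y
      by (simp add: G' quotient_simps coset_add lookup_add)
    show "aug G' (free_scale r x) = act (quotient_module A (Ipow a)) r (aug G' x)" for r x
      by (simp add: G' quotient_simps)
    show "aug G' x \<in> comp_of (quotient_module A (Ipow a)) j" if "x \<in> rcomp G' 0 j" for j x
      using that by (auto simp: G' quotient_simps fcomp_iff)
    show "carr (quotient_module A (Ipow a)) \<subseteq> aug G' ` rfree G' 0"
    proof
      fix Y assume "Y \<in> carr (quotient_module A (Ipow a))"
      then obtain x where "Y = x +o Ipow a" by (auto simp: quotient_simps)
      thus "Y \<in> aug G' ` rfree G' 0"
        by (intro image_eqI[of _ _ "single 0 x"]) (simp_all add: G')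
    qed
    have coset0: "x +o Ipow a = Ipow a \<longleftrightarrow> x \<in> Ipow a" for x
      using coset_eq_iff[of x a 0] by (simp add: coset_zero)
    have "Ivec a = {x \<in> free {0}. lookup x 0 \<in> Ipow a}"
      by (simp add: Ivec_def Ipow_def)
    hence "{x \<in> free {0}. lookup x 0 +o Ipow a = Ipow a} = lmap t ` free C"
      by (simp only: coset0 gen)
    thus "{x \<in> rfree G' 0. aug G' x = zero_of (quotient_module A (Ipow a))} =
        lmap (dmap G' 0) ` rfree G' 1"
      by (simp add: dmapG') (simp add: G' quotient_simps)
    show "Syz (basis G' (Suc n)) (dmap G' n) = lmap (dmap G' (Suc n)) ` rfree G' (Suc (Suc n))" for n
      by (cases n) (simp_all add: dmapG' G' E(4,5))
  qed
  moreover have "dmap G' n b \<in> rmfree G' n" if "b \<in> basis G' (Suc n)" for n b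
  proof (cases n)
    case 0
    thus ?thesis using that mBI[OF t(2,1) a, of b] by (simp add: dmapG') (simp add: G')
  next
    case (Suc m)
    have bE: "b \<in> E m" "u m b \<in> free (case_nat C E m)"
      using that GD[of b m] by (simp_all add: Suc G' G)
    thus ?thesis using mBI[OF bE(2) E(3)[OF bE(1)]] by (simp add: dmapG' Suc) (simp add: G')
  qed
  ultimately have "minimal_graded_free_resolution scale A (quotient_module A (Ipow a)) G'"
    by (simp add: minimal_iff)
  moreover have "finite (basis G' n)" for n
    using C E(1) by (simp add: G' split: nat.split)
  moreover have "int (card (basis G' (Suc n))) = power_rank w a n" for n
    using rank E(2) by (cases n) (simp_all add: G')
  ultimately show ?quotient by (intro exI[of _ G']) (simp add: G')
qed

text \<open>Both sides count the minimal generators of the \<open>m\<close>-th power. With the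
  closed form of \<open>power_rank\<close> this is the Koszul relation
  \<open>H(t) H_A(-t) = 1\<close>, coefficient by coefficient.\<close>

lemma power_rank_zero:
  assumes \<omega>: "lin (mfree {b0}) \<omega>" and w: "w 0 = 1" "\<And>n. w (Suc n) = \<omega> n"
  shows "power_rank w m 0 = int (dim (A m))"
proof -
  obtain C t \<rho> where "finite C" "\<And>b. b \<in> C \<Longrightarrow> t b \<in> Vec m"
      "\<And>b. b \<in> C \<Longrightarrow> t b \<in> free {0}" "lmap t ` free C = Ivec m" "lin (Syz C t) \<rho>"
      "int (card C) = power_rank w m 0"
    using max_ideal_power_linear[OF \<omega> w, where a = m] by metis
  thus ?thesis using card_generators[of C t m \<rho>] by simp
qed

lemma power_rank_sum:
  assumes "a \<ge> 1"
  shows "power_rank w a n = (\<Sum>i=1..a. (-1) ^ (i + 1) * int (w (n + i)) * int (dim (A (a - i))))"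
  using power_rank_eq[of w "a - 1" n] assms by simp

text \<open>The substitution \<open>i = a - j\<close> turns the alternating sum of
  \<open>power_rank_sum\<close> into a convolution; the sign in front comes from
  \<open>(-1)^(a-i) = -(-1)^a (-1)^(i+1)\<close>.\<close>

lemma power_rank_convolution:
  assumes "a \<ge> 1"
  shows "(\<Sum>j<a. int (w (n + a - j)) * ((-1) ^ j * int (dim (A j)))) = - ((-1) ^ a) * power_rank w a n"
proof -
  have "(\<Sum>j<a. int (w (n + a - j)) * ((-1) ^ j * int (dim (A j)))) =
      (\<Sum>i=1..a. int (w (n + i)) * ((-1) ^ (a - i) * int (dim (A (a - i)))))"
    by (rule sum.reindex_bij_witness[of _ "\<lambda>i. a - i" "\<lambda>j. a - j"]) auto
  also have "\<dots> = (\<Sum>i=1..a. - ((-1) ^ a) * ((-1) ^ (i + 1) * int (w (n + i)) * int (dim (A (a - i)))))"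
  proof (intro sum.cong refl)
    fix i assume "i \<in> {1..a}"
    hence eq: "(-1 :: int) ^ a = (-1) ^ (a - i) * (-1) ^ i" by (simp flip: power_add)
    have sq: "(-1 :: int) ^ i * (-1) ^ i = 1" by (simp flip: power_mult_distrib)
    show "int (w (n + i)) * ((-1) ^ (a - i) * int (dim (A (a - i)))) =
        - ((-1) ^ a) * ((-1) ^ (i + 1) * int (w (n + i)) * int (dim (A (a - i))))"
    proof -
      have "- (u * y) * (y * - 1 * v * x) = v * (u * x)" if "y * y = 1" for u v x y :: int
      proof -
        have "- (u * y) * (y * - 1 * v * x) = (y * y) * (v * (u * x))"
          by (simp add: mult_ac)
        thus ?thesis using that by simp
      qed
      from this[OF sq] show ?thesis
        unfolding eq power_add power_one_right by (rule sym)
    qed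
  qed
  finally show ?thesis
    by (simp only: power_rank_sum[OF assms] sum_distrib_left)
qed

text \<open>This is the coefficient of \<open>t^m\<close> in the product of the two Hilbert series.
  Below \<open>a\<close> the truncation is not felt and the Koszul relation applies; from
  \<open>a\<close> on the sum has its full length \<open>a\<close> and is a Betti number up to
  sign.\<close>

lemma hilbert_product_nth:
  assumes \<omega>: "lin (mfree {b0}) \<omega>" and w: "w 0 = 1" "\<And>n. w (Suc n) = \<omega> n" and a: "a \<ge> 1"
  shows "(\<Sum>j\<le>m. int (w (m - j)) * (if j < a then (-1) ^ j * int (dim (A j)) else 0)) =
    (if m = 0 then 1 else if m < a then 0 else - ((-1) ^ a) * power_rank w a (m - a))"
proof -
  note dim0 = power_rank_zero[OF \<omega> w]
  consider "m = 0" | "0 < m" "m < a" | "m \<ge> a" "m > 0" by linarith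
  thus ?thesis
  proof cases
    case 1
    thus ?thesis using a w(1) dim0[of 0] by simp
  next
    case 2
    \<comment> \<open>The first \<open>m\<close> terms are the convolution for the power
      \<open>m\<close> at \<open>n = 0\<close>, the last one has \<open>w 0 = 1\<close>; they cancel
      by \<open>power_rank_zero\<close>.\<close>
    have "(\<Sum>j\<le>m. int (w (m - j)) * (if j < a then (-1) ^ j * int (dim (A j)) else 0)) =
        (\<Sum>j<m. int (w (0 + m - j)) * ((-1) ^ j * int (dim (A j)))) + (-1) ^ m * int (dim (A m))"
      using 2 w(1) by (subst lessThan_Suc_atMost[symmetric], subst sum.lessThan_Suc) (auto intro!: sum.cong)
    also have "\<dots> = 0"
      using power_rank_convolution[of m w 0] 2 dim0[of m] by simp
    finally show ?thesis using 2 by simp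
  next
    case 3
    have "(\<Sum>j\<le>m. int (w (m - j)) * (if j < a then (-1) ^ j * int (dim (A j)) else 0)) =
        (\<Sum>j<a. int (w ((m - a) + a - j)) * ((-1) ^ j * int (dim (A j))))"
      using 3 by (intro sum.mono_neutral_cong_right) auto
    also have "\<dots> = - ((-1) ^ a) * power_rank w a (m - a)"
      by (rule power_rank_convolution[OF a])
    finally show ?thesis using 3 by simp
  qed
qed

end

section \<open>The Poincare series\<close>

text \<open>Laurent series enter only through \<open>z^(-a)\<close>; after multiplication by
  \<open>z^a\<close> the identity compares power series. The coefficient of \<open>z^m\<close> on
  either side is an integer times \<open>y^m\<close>: for the Poincare series because
  \<open>c n j\<close> is concentrated in \<open>j = n + a\<close>, while the factor
  \<open>z^a\<close> moves \<open>n\<close> to \<open>m = n + a\<close>.\<close>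

lemma poincare_identity:
  fixes H K :: "int fps" and r :: "nat \<Rightarrow> int"
  assumes P: "\<And>n j. c n j = (if j = n + a then r n else 0)"
    and conv: "\<And>m. (\<Sum>j\<le>m. fps_nth H (m - j) * ((-1) ^ j * fps_nth K j)) =
      (if m = 0 then 1 else if m < a then 0 else - ((-1) ^ a) * r (m - a))"
    and a: "a \<ge> 1"
  shows "fps_to_fls (Abs_fps (\<lambda>i. Abs_fps (c i))) =
    - ((- fls_X_inv) ^ a) * (fps_to_fls (subst_yz 1 H) * fps_to_fls (subst_yz (-1) K) - 1)"
proof -
  define S where "S = Abs_fps (\<lambda>i. Abs_fps (c i))"
  \<comment> \<open>The sign \<open>(-1)^a\<close> as a constant series in both variables; being its
    own inverse, it can be moved across the equation.\<close>
  define e :: "int fps fps" where "e = fps_const (fps_const ((-1) ^ a))"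
  have ee: "e * e = 1"
    by (simp add: e_def flip: power_mult_distrib)
  have "subst_yz 1 H * subst_yz (-1) K - 1 = - e * fps_X ^ a * S"
  proof (rule fps_ext)
    fix m
    have "fps_nth (subst_yz 1 H * subst_yz (-1) K) m =
        (\<Sum>j\<le>m. fps_const (fps_nth H (m - j) * ((-1) ^ j * fps_nth K j)) * fps_X ^ m)"
    proof -
      have "fps_nth (subst_yz (-1) K * subst_yz 1 H) m =
          (\<Sum>j=0..m. (fps_const ((-1) ^ j * fps_nth K j) * fps_X ^ j) *
            (fps_const (1 ^ (m - j) * fps_nth H (m - j)) * fps_X ^ (m - j)))"
        by (simp add: fps_mult_nth subst_yz_def)
      also have "\<dots> = (\<Sum>j\<le>m. fps_const (fps_nth H (m - j) * ((-1) ^ j * fps_nth K j)) * fps_X ^ m)"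
      proof (rule sum.cong)
        fix j assume "j \<in> {..m}"
        hence "fps_X ^ m = (fps_X ^ j * fps_X ^ (m - j) :: int fps)" by (simp flip: power_add)
        thus "(fps_const ((-1) ^ j * fps_nth K j) * fps_X ^ j) *
            (fps_const (1 ^ (m - j) * fps_nth H (m - j)) * fps_X ^ (m - j)) =
            fps_const (fps_nth H (m - j) * ((-1) ^ j * fps_nth K j)) * fps_X ^ m"
          by (simp add: mult_ac flip: fps_const_mult)
      qed (auto simp: atLeast0AtMost)
      finally show ?thesis by (simp only: mult.commute)
    qed
    also have "\<dots> = fps_const (\<Sum>j\<le>m. fps_nth H (m - j) * ((-1) ^ j * fps_nth K j)) * fps_X ^ m"
    proof -
      have "fps_const (\<Sum>j\<le>m. f j) = (\<Sum>j\<le>m. fps_const (f j))" for f :: "nat \<Rightarrow> int"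
        by (rule fps_ext) (simp add: fps_sum_nth)
      thus ?thesis by (simp add: sum_distrib_right)
    qed
    finally have prod: "fps_nth (subst_yz 1 H * subst_yz (-1) K) m =
      fps_const (if m = 0 then 1 else if m < a then 0 else - ((-1) ^ a) * r (m - a)) * fps_X ^ m"
      by (simp only: conv)
    have Sn: "fps_nth S n = fps_const (r n) * fps_X ^ (n + a)" for n
      by (rule fps_ext) (simp add: S_def P)
    have "fps_nth (- e * fps_X ^ a * S) m =
        - (fps_const ((-1) ^ a) * (if m < a then 0 else fps_nth S (m - a)))"
      by (simp add: e_def mult.assoc fps_X_power_mult_nth flip: fps_const_neg)
    thus "fps_nth (subst_yz 1 H * subst_yz (-1) K - 1) m = fps_nth (- e * fps_X ^ a * S) m"
      using a prod by (auto simp: Sn mult.assoc simp flip: fps_const_mult fps_const_neg)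
  qed
  hence "fps_to_fls (subst_yz 1 H) * fps_to_fls (subst_yz (-1) K) - 1 =
      fps_to_fls (- e * fps_X ^ a * S)"
    by (simp flip: fls_times_fps_to_fls fps_to_fls_minus fps_one_to_fls)
  also have "\<dots> = - fps_to_fls e * fls_X ^ a * fps_to_fls S"
    by (simp add: fls_times_fps_to_fls fps_to_fls_power)
  finally have prod: "fps_to_fls (subst_yz 1 H) * fps_to_fls (subst_yz (-1) K) - 1 =
      - fps_to_fls e * fls_X ^ a * fps_to_fls S" .
  have "e = (- 1) ^ a"
    unfolding e_def by (cases "even a") (simp_all flip: fps_const_neg)
  hence "fps_to_fls e = (- 1) ^ a"
    by (simp add: fps_to_fls_power)
  hence inv: "(- fls_X_inv) ^ a = fps_to_fls e * (fls_X_inv ^ a :: int fps fls)"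
    by (subst power_minus) simp
  have X: "(fls_X_inv * fls_X :: int fps fls) = 1"
    by (simp add: fls_X_inv_times_conv_shift(1) fls_X_conv_shift_1)
  have "- (fps_to_fls e * (fls_X_inv ^ a)) * (- fps_to_fls e * fls_X ^ a * fps_to_fls S) =
      fps_to_fls (e * e) * (fls_X_inv * fls_X) ^ a * fps_to_fls S"
    by (simp add: fls_times_fps_to_fls power_mult_distrib mult_ac)
  thus ?thesis
    unfolding prod inv by (simp add: ee X S_def)
qed

text \<open>Everything is a reading of \<open>power_rank w a\<close>: it counts the generators of
  the minimal resolutions of \<open>\<mm>\<^sup>a\<close> and, one step later, of
  \<open>A/\<mm>\<^sup>a\<close>; its closed form is the alternating sum, and its convolution
  identity is the formula for the series.\<close>

theorem corollary5p5:
  fixes scale :: "'k::field \<Rightarrow> 'a::ring_1 \<Rightarrow> 'a"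
    and A :: "nat \<Rightarrow> 'a set"
    and a :: nat
  assumes "standard_graded_algebra scale A"
    and "koszul scale A"
    and "a \<ge> 1"
  shows
    "((\<forall>n. int (betti scale A (max_ideal_power_module scale A a) n (n + a)) =
          (\<Sum>i=1..a. (-1) ^ (i + 1) * int (dim_quadratic_dual_star scale A (n + i))
                       * int (vector_space.dim scale (A (a - i))))) \<and>
      (\<forall>n j. j \<noteq> n + a \<longrightarrow> betti scale A (max_ideal_power_module scale A a) n j = 0) \<and>
      (\<exists>F. minimal_graded_free_resolution scale A (max_ideal_power_module scale A a) F) \<and>
      (\<forall>F. minimal_graded_free_resolution scale A (max_ideal_power_module scale A a) F
             \<longrightarrow> linear_resolution A a F)) \<and>
     fps_to_fls (poincare_series scale A (max_ideal_power_module scale A a)) =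
       - ((- fls_X_inv) ^ a) *
         (fps_to_fls (subst_yz 1 (hilbert_dual scale A)) *
          fps_to_fls (subst_yz (-1) (hilbert_truncated scale A a)) - 1) \<and>
     (\<forall>n j. int (betti scale A (max_ideal_power_quotient scale A a) n j) =
        (if n > 0 \<and> j = n + a - 1
         then (\<Sum>i=1..a. (-1) ^ (i + 1) * int (dim_quadratic_dual_star scale A (n + i - 1))
                           * int (vector_space.dim scale (A (a - i))))
         else if n = 0 \<and> j = 0 then 1 else 0))"
proof -
  interpret standard_graded_algebra scale A by fact
  obtain B s b0 where K: "\<And>n. finite (B n)" "B 0 = {b0}"
    "\<And>n b. b \<in> B (Suc n) \<Longrightarrow> s n b \<in> Vec 1" "\<And>n b. b \<in> B (Suc n) \<Longrightarrow> s n b \<in> free (B n)"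
    "lmap (s 0) ` free (B 1) = mfree {b0}"
    "\<And>n. Syz (B (Suc n)) (s n) = lmap (s (Suc n)) ` free (B (Suc (Suc n)))"
    by (rule koszul_resolution[OF assms(2)]) blast
  interpret koszul_data scale A B s b0
    by unfold_locales (use K in auto)
  define w where "w = dim_quadratic_dual_star scale A"
  \<comment> \<open>The resolution of \<open>\<mm>\<close> is that of \<open>k\<close> without its
    first module, hence the shift by one against \<open>w\<close>.\<close>
  define \<omega> where "\<omega> = (\<lambda>n. card (B (Suc n)))"
  have w: "w 0 = 1" "\<And>n. w (Suc n) = \<omega> n"
    by (simp_all add: w_def \<omega>_def dim_quadratic_dual_star K(2))
  have \<omega>: "lin (mfree {b0}) \<omega>"
    using lin_of_resolution[of "\<lambda>n. B (Suc n)" s] K by (simp add: \<omega>_def)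
  let ?M = "left_ideal_module A (Ipow a)" and ?Q = "quotient_module A (Ipow a)"
  obtain G where "minimal_graded_free_resolution scale A ?M G \<and>
      (\<forall>n. \<forall>b\<in>basis G n. bdeg G n b = n + a) \<and>
      (\<forall>n. finite (basis G n) \<and> int (card (basis G n)) = power_rank w a n)"
    using max_ideal_power_resolution(1)[OF \<omega> w assms(3)] by (elim exE)
  hence G: "minimal_graded_free_resolution scale A ?M G"
    "\<And>n b. b \<in> basis G n \<Longrightarrow> bdeg G n b = n + a" "\<And>n. finite (basis G n)"
    "\<And>n. int (card (basis G n)) = power_rank w a n"
    by simp_all
  obtain G' where "minimal_graded_free_resolution scale A ?Q G' \<and>
      basis G' 0 = {0} \<and> bdeg G' 0 0 = 0 \<and> (\<forall>n. \<forall>b\<in>basis G' (Suc n). bdeg G' (Suc n) b = n + a) \<and>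
      (\<forall>n. finite (basis G' n)) \<and> (\<forall>n. int (card (basis G' (Suc n))) = power_rank w a n)"
    using max_ideal_power_resolution(2)[OF \<omega> w assms(3)] by (elim exE)
  hence G': "minimal_graded_free_resolution scale A ?Q G'" "basis G' 0 = {0}" "bdeg G' 0 0 = 0"
    "\<And>n b. b \<in> basis G' (Suc n) \<Longrightarrow> bdeg G' (Suc n) b = n + a" "\<And>n. finite (basis G' n)"
    "\<And>n. int (card (basis G' (Suc n))) = power_rank w a n"
    by simp_all
  have betti_M: "int (betti scale A ?M n j) = (if j = n + a then power_rank w a n else 0)" for n j
  proof -
    have "{b \<in> basis G n. bdeg G n b = j} = (if j = n + a then basis G n else {})"
      by (auto simp: G(2))
    thus ?thesis
      unfolding betti_eq[OF G(1) grading_embedding_ideal G(3)] by (simp add: G(4))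
  qed
  have betti_Q: "int (betti scale A ?Q n j) =
      (if n > 0 \<and> j = n + a - 1 then power_rank w a (n - 1) else if n = 0 \<and> j = 0 then 1 else 0)" for n j
  proof (cases n)
    case 0
    have "{b \<in> basis G' 0. bdeg G' 0 b = j} = (if j = 0 then {0} else {})"
      unfolding G'(2) by (auto simp: G'(3))
    hence "betti scale A ?Q 0 j = (if j = 0 then 1 else 0)"
      unfolding betti_eq[OF G'(1) grading_embedding_quotient G'(5)] by simp
    thus ?thesis by (simp add: 0)
  next
    case (Suc m)
    have "{b \<in> basis G' (Suc m). bdeg G' (Suc m) b = j} = (if j = m + a then basis G' (Suc m) else {})"
      by (auto simp: G'(4))
    hence "int (betti scale A ?Q (Suc m) j) = (if j = m + a then power_rank w a m else 0)"
      unfolding betti_eq[OF G'(1) grading_embedding_quotient G'(5)] by (simp add: G'(6))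
    thus ?thesis by (simp add: Suc)
  qed
  have linear: "linear_resolution A a F" if "minimal_graded_free_resolution scale A ?M F" for F
  proof (rule minimal_linear[OF that _ grading_embedding_ideal])
    show "graded_free_resolution A ?M G" using G(1) by (simp add: minimal_iff)
    show "linear_resolution A a G"
      using G(2) by (simp add: linear_resolution_def res_module_def generated_in_degree_free_module)
  qed
  have trunc: "fps_nth (hilbert_truncated scale A a) j = (if j < a then int (dim (A j)) else 0)" for j
    by (simp add: hilbert_truncated_def fps_sum_nth if_distrib cong: if_cong)
  have series: "fps_to_fls (poincare_series scale A ?M) = - ((- fls_X_inv) ^ a) *
      (fps_to_fls (subst_yz 1 (hilbert_dual scale A)) *
       fps_to_fls (subst_yz (-1) (hilbert_truncated scale A a)) - 1)"
    unfolding poincare_series_def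
  proof (rule poincare_identity[OF betti_M _ assms(3)])
    fix m
    show "(\<Sum>j\<le>m. fps_nth (hilbert_dual scale A) (m - j) *
        ((-1) ^ j * fps_nth (hilbert_truncated scale A a) j)) =
        (if m = 0 then 1 else if m < a then 0 else - ((-1) ^ a) * power_rank w a (m - a))"
      unfolding hilbert_product_nth[OF \<omega> w assms(3), symmetric]
      by (intro sum.cong) (simp_all add: trunc hilbert_dual_def w_def)
  qed
  have rank: "power_rank w a n = (\<Sum>i=1..a. (-1) ^ (i + 1) *
      int (dim_quadratic_dual_star scale A (n + i)) * int (dim (A (a - i))))" for n
    by (simp only: power_rank_sum[OF assms(3)] w_def)
  have rank': "power_rank w a (n - 1) = (\<Sum>i=1..a. (-1) ^ (i + 1) *
      int (dim_quadratic_dual_star scale A (n + i - 1)) * int (dim (A (a - i))))" if "n > 0" for n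
  proof -
    have "n - 1 + i = n + i - 1" for i using that by simp
    thus ?thesis by (simp only: rank)
  qed
  show ?thesis
    unfolding ideal_power_Ipow
  proof (intro conjI allI impI)
    show "int (betti scale A ?M n (n + a)) = (\<Sum>i=1..a. (-1) ^ (i + 1) *
        int (dim_quadratic_dual_star scale A (n + i)) * int (dim (A (a - i))))" for n
      by (simp only: betti_M rank refl if_True)
    show "betti scale A ?M n j = 0" if "j \<noteq> n + a" for n j
      using betti_M[of n j] that by simp
    show "\<exists>F. minimal_graded_free_resolution scale A ?M F"
      using G(1) by (rule exI)
    show "int (betti scale A ?Q n j) =
        (if n > 0 \<and> j = n + a - 1
         then (\<Sum>i=1..a. (-1) ^ (i + 1) * int (dim_quadratic_dual_star scale A (n + i - 1))
                           * int (dim (A (a - i))))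
         else if n = 0 \<and> j = 0 then 1 else 0)" for n j
      unfolding betti_Q by (rule if_cong) (simp_all only: rank')
  qed (erule linear, rule series)
qed

end
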